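(* Consider the autoregressive stochastic-volatility model described in the context, in the nearly stationary regime $\rho_n = 1-\frac{c}{k_n}$, under the rate separation condition that $r_n^q=o(k_n)$ and $k_n r_n^q=o(n)$ for every fixed $q>0$, and with initial value satisfying $\mathbb{E}[y_0^4]=o(k_n^2)$. Let $m_n=\frac1n\sum_{t=1}^n\mathbb{E}[\sigma_t^2]$ and let $\widehat\rho_n=\sum_{t=1}^n y_{t-1}y_t\big/\sum_{t=1}^n y_{t-1}^2$. Then, as $n\to\infty$: (a) $\displaystyle \frac{1}{n\,m_n\,k_n}\sum_{t=1}^{n} y_{t-1}^2 \to \frac{1}{2c}$ in probability; (b) $\displaystyle \frac{1}{\sqrt{n k_n}\,m_n}\sum_{t=1}^n y_{t-1}u_t$ converges in distribution to $N\!\left(0,\frac{1}{2c}\right)$; (c) $\displaystyle \sqrt{n k_n}\,\bigl(\widehat{\rho}_n - \rho_n\bigr)$ converges in distribution to $N(0,2c)$.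
   Context: Model. Fixed constants: $c>0$, $d>0$, $\alpha>0$. Deterministic sequences: $k_n>0$ with $k_n\to\infty$ and $k_n=o(n)$; $r_n>1$, where either $r_n\to\infty$ or $r_n$ is constant. The volatility persistence parameter is $\phi_n=1-\frac{d}{\log r_n}$, and $|\phi_n|<1$. For each $n$ (triangular array; dependence on $n$ is suppressed in the notation) and $1\le t\le n$, $$y_t=\rho_n y_{t-1}+u_t,\qquad u_t=\sigma_t\varepsilon_t,\qquad \log\sigma_t^2=\phi_n\log\sigma_{t-1}^2+\eta_t .$$ Here $(\varepsilon_t)_{t\ge1}$ are i.i.d. with $\mathbb{E}[\varepsilon_t]=0$, $\mathbb{E}[\varepsilon_t^2]=1$, $\mathbb{E}[\varepsilon_t^4]<\infty$; $(\eta_t)_{t\ge1}$ are i.i.d. $N(0,\alpha^2)$; the sequences $(\varepsilon_t)$ and $(\eta_t)$ are independent of each other. The initial volatility is $\sigma_0=1$, and the initial value $y_0$ (possibly depending on $n$) is independent of $\{(\varepsilon_t,\eta_t):t\ge1\}$. The estimator $\widehat\rho_n$ is the least-squares estimator (defined when its denominator is nonzero). *)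

theory Defs
  imports "HOL-Probability.Probability" "HOL-Library.Landau_Symbols"
begin

definition tendsto_in_prob :: "'a measure \<Rightarrow> (nat \<Rightarrow> 'a \<Rightarrow> real) \<Rightarrow> real \<Rightarrow> bool" where
  "tendsto_in_prob M X l \<longleftrightarrow>
     (\<forall>e>0. (\<lambda>n. measure M {\<omega> \<in> space M. \<bar>X n \<omega> - l\<bar> > e}) \<longlonglongrightarrow> 0)"

text \<open>\<^const>\<open>normal_density\<close> is parametrised by the standard deviation, here by the variance.\<close>

definition normal_law :: "real \<Rightarrow> real \<Rightarrow> real measure" where
  "normal_law \<mu> v = density lborel (normal_density \<mu> (sqrt v))"

definition tendsto_in_distr :: "'a measure \<Rightarrow> (nat \<Rightarrow> 'a \<Rightarrow> real) \<Rightarrow> real measure \<Rightarrow> bool" where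
  "tendsto_in_distr M X L \<longleftrightarrow> weak_conv_m (\<lambda>n. distr M borel (X n)) L"

text \<open>
  The arrays \<open>vol n t\<close> (the volatility, usually written with the letter sigma),
  \<open>u n t\<close>, \<open>y n t\<close> have row index \<open>n\<close> and time index \<open>t\<close>; nothing is
  assumed about them outside of \<open>t \<le> n\<close>, nor about any row \<open>n = 0\<close>. The innovations
  \<open>eps t\<close>, \<open>eta t\<close>, \<open>t \<ge> 1\<close>, are shared by all rows, while the initial value \<open>y n 0\<close> may
  depend on \<open>n\<close>. Independence of random elements with values in different spaces is
  independence of the sigma-algebras they generate; \<^const>\<open>prob_space.indep_set\<close> includes that
  these consist of events, that is, measurability of \<open>y n 0\<close>.
\<close>

locale ar_stochastic_volatility = prob_space M
  for M :: "'a measure" +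
  fixes d \<alpha> :: real
    and k r \<phi> \<rho> :: "nat \<Rightarrow> real"
    and eps eta :: "nat \<Rightarrow> 'a \<Rightarrow> real"
    and vol u y :: "nat \<Rightarrow> nat \<Rightarrow> 'a \<Rightarrow> real"
  assumes d_pos: "d > 0"
    and \<alpha>_pos: "\<alpha> > 0"
    and k_pos: "\<And>n. n \<ge> 1 \<Longrightarrow> k n > 0"
    and k_tendsto: "filterlim k at_top sequentially"
    and k_small: "k \<in> o(\<lambda>n. real n)"
    and r_gt_1: "\<And>n. n \<ge> 1 \<Longrightarrow> r n > 1"
    and r_cases: "filterlim r at_top sequentially \<or> (\<exists>R. \<forall>n\<ge>1. r n = R)"
    and \<phi>_eq: "\<And>n. n \<ge> 1 \<Longrightarrow> \<phi> n = 1 - d / ln (r n)"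
    and \<phi>_abs: "\<And>n. n \<ge> 1 \<Longrightarrow> \<bar>\<phi> n\<bar> < 1"
    and eps_indep: "indep_vars (\<lambda>_. borel) eps {1..}"
    and eps_ident: "\<And>t. t \<ge> 1 \<Longrightarrow> distr M borel (eps t) = distr M borel (eps 1)"
    and eps_mean: "\<And>t. t \<ge> 1 \<Longrightarrow> expectation (eps t) = 0"
    and eps_var: "\<And>t. t \<ge> 1 \<Longrightarrow> expectation (\<lambda>\<omega>. (eps t \<omega>)^2) = 1"
    and eps_fourth: "\<And>t. t \<ge> 1 \<Longrightarrow> integrable M (\<lambda>\<omega>. (eps t \<omega>)^4)"
    and eta_indep: "indep_vars (\<lambda>_. borel) eta {1..}"
    and eta_normal: "\<And>t. t \<ge> 1 \<Longrightarrow> distr M borel (eta t) = normal_law 0 (\<alpha>^2)"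
    and eps_eta_indep:
      "indep_var (Pi\<^sub>M {1..} (\<lambda>_. borel)) (\<lambda>\<omega>. \<lambda>t\<in>{1..}. eps t \<omega>)
                 (Pi\<^sub>M {1..} (\<lambda>_. borel)) (\<lambda>\<omega>. \<lambda>t\<in>{1..}. eta t \<omega>)"
    and y0_indep: "\<And>n. n \<ge> 1 \<Longrightarrow>
      indep_set
        (sets (vimage_algebra (space M) (y n 0) borel))
        (sets (vimage_algebra (space M) (\<lambda>\<omega>. \<lambda>t\<in>{1..}. (eps t \<omega>, eta t \<omega>))
                 (Pi\<^sub>M {1..} (\<lambda>_. borel \<Otimes>\<^sub>M borel))))"
    and vol_init: "\<And>n \<omega>. \<lbrakk>n \<ge> 1; \<omega> \<in> space M\<rbrakk> \<Longrightarrow> vol n 0 \<omega> = 1"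
    and vol_pos: "\<And>n t \<omega>. \<lbrakk>1 \<le> t; t \<le> n; \<omega> \<in> space M\<rbrakk> \<Longrightarrow> vol n t \<omega> > 0"
    and vol_rec: "\<And>n t \<omega>. \<lbrakk>1 \<le> t; t \<le> n; \<omega> \<in> space M\<rbrakk> \<Longrightarrow>
      ln ((vol n t \<omega>)^2) = \<phi> n * ln ((vol n (t - 1) \<omega>)^2) + eta t \<omega>"
    and u_eq: "\<And>n t \<omega>. \<lbrakk>1 \<le> t; t \<le> n; \<omega> \<in> space M\<rbrakk> \<Longrightarrow>
      u n t \<omega> = vol n t \<omega> * eps t \<omega>"
    and y_rec: "\<And>n t \<omega>. \<lbrakk>1 \<le> t; t \<le> n; \<omega> \<in> space M\<rbrakk> \<Longrightarrow>
      y n t \<omega> = \<rho> n * y n (t - 1) \<omega> + u n t \<omega>"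

definition mean_vol :: "'a measure \<Rightarrow> (nat \<Rightarrow> nat \<Rightarrow> 'a \<Rightarrow> real) \<Rightarrow> nat \<Rightarrow> real" where
  "mean_vol M vol n = (1 / real n) * (\<Sum>t=1..n. (\<integral>\<omega>. (vol n t \<omega>)^2 \<partial>M))"

text \<open>
  Where the denominator vanishes, the value is \<open>0\<close> by the convention for division. Limits in
  distribution do not depend on this value if the denominator is nonzero with probability tending to \<open>1\<close>.
\<close>

definition lse :: "(nat \<Rightarrow> nat \<Rightarrow> 'a \<Rightarrow> real) \<Rightarrow> nat \<Rightarrow> 'a \<Rightarrow> real" where
  "lse y n \<omega> = (\<Sum>t=1..n. y n (t - 1) \<omega> * y n t \<omega>) / (\<Sum>t=1..n. (y n (t - 1) \<omega>)^2)"

end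

theory Submission
  imports Defs
begin

text \<open>
  The autoregression forgets its past over a time of order \<open>k\<close>, the volatility over a time of order
  \<open>1 / (1 - \<bar>\<phi>\<bar>)\<close>.  All moments of the volatility and its correlation length are bounded by powers of
  the single quantity \<open>vol_scale n = exp (\<alpha>\<^sup>2 / (1 - \<phi>\<^sup>2))\<close>, which grows at most like a power of \<open>r\<close>
  (\<open>vol_scale_growth\<close>).  The rate conditions therefore say that \<open>1\<close>, \<open>k\<close> and \<open>n\<close> are separated even
  after multiplication by any power of \<open>vol_scale\<close>, and every estimate below may be
  wasteful in such powers.  Let \<open>\<mu>\<close> be the stationary mean of \<open>vol\<^sup>2\<close>; it is asymptotically equivalent to the
  mean in the theorem (\<open>mean_ratio_tendsto\<close>).

  \<^emph>\<open>The sum of squares.\<close>  Squaring the recursion and summing over time gives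
  \<open>(1 - \<rho>\<^sup>2) \<Sum> y\<^bsub>t-1\<^esub>\<^sup>2 = \<Sum> u\<^sub>t\<^sup>2 + 2 \<rho> \<Sum> y\<^bsub>t-1\<^esub> u\<^sub>t - y\<^sub>n\<^sup>2 + y\<^sub>0\<^sup>2\<close>.  On the right-hand side \<open>\<Sum> u\<^sub>t\<^sup>2\<close> is \<open>n \<mu>\<close> up
  to a martingale and a sum of weakly correlated variables, and all else is of smaller order, by
  the bound \<open>E y\<^sub>t\<^sup>4 = O(k\<^sup>2 vol_scale\<^sup>2)\<close> (\<open>Y_fourth\<close>).  As \<open>1 - \<rho>\<^sup>2\<close> is about \<open>2 c / k\<close>, this is the first claim, and it
  holds in \<open>L\<^sup>1\<close> (\<open>norm_sum_squares_L1\<close>).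

  \<^emph>\<open>The score.\<close>  Conditionally on the initial value and on the whole sequence \<open>eta\<close>, the score
  \<open>\<Sum> y\<^bsub>t-1\<^esub> u\<^sub>t\<close> is a sum of martingale differences, with conditional variance \<open>\<Sum> y\<^bsub>t-1\<^esub>\<^sup>2 vol\<^sub>t\<^sup>2\<close>.  A central limit theorem
  with an explicit error bound (\<open>martingale_clt_bound\<close>) reduces the second claim to two facts.  The
  third moments are summed with Young's inequality, which requires only fourth moments of \<open>y\<close>
  (\<open>Y_vol_cube\<close>).  The conditional variance must be shown to be close to \<open>\<mu> \<Sum> y\<^bsub>t-1\<^esub>\<^sup>2\<close> although \<open>y\<^bsub>t-1\<^esub>\<close> and \<open>vol\<^sub>t\<close> are
  dependent.  To this end the deviations \<open>D\<^sub>t = vol\<^sub>t\<^sup>2 - \<mu>\<close> are written as \<open>A\<^sub>t - \<theta> A\<^bsub>t-1\<^esub>\<close> with an exponential filter \<open>A\<close>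
  whose time constant \<open>k\<^sup>1\<^sup>/\<^sup>2\<close> lies between the two memory lengths; summation by parts then trades \<open>D\<close> for the small
  increments of \<open>y\<^sup>2\<close> (\<open>weighted_vol_dev_bound\<close>).

  \<^emph>\<open>The estimator.\<close>  The normalised estimation error is the quotient of the two statistics, and
  Slutsky's lemma gives the variance \<open>(2 c)\<^sup>2 / (2 c) = 2 c\<close>.
\<close>

section \<open>Modes of convergence\<close>

lemma real_distribution_normal_law: "v > 0 \<Longrightarrow> real_distribution (normal_law 0 v)"
  by (simp add: normal_law_def real_distribution_def real_distribution_axioms_def prob_space_normal_density)

lemma normal_law_eq_scaled_std_normal:
  assumes "v > 0"
  shows "normal_law 0 v = distr std_normal_distribution borel (\<lambda>x. sqrt v * x)"
proof -
  interpret S: prob_space std_normal_distribution by (rule prob_space_normal_density) simp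
  have "distributed std_normal_distribution lborel (\<lambda>x. x) (normal_density 0 1)"
    by (auto simp: distributed_def distr_id2)
  from S.normal_density_affine[OF this, of "sqrt v" 0]
  have "distributed std_normal_distribution lborel (\<lambda>x. sqrt v * x) (normal_density 0 (sqrt v))"
    using assms by simp
  then have "distr std_normal_distribution lborel (\<lambda>x. sqrt v * x) = normal_law 0 v"
    by (simp add: distributed_def normal_law_def)
  moreover have "distr std_normal_distribution lborel (\<lambda>x. sqrt v * x)
      = distr std_normal_distribution borel (\<lambda>x. sqrt v * x)"
    by (rule distr_cong) auto
  ultimately show ?thesis by simp
qed

lemma char_normal_law:
  assumes "v > 0"
  shows "char (normal_law 0 v) s = of_real (exp (- (s\<^sup>2 * v / 2)))"
proof -
  have "char (normal_law 0 v) s = char std_normal_distribution (s * sqrt v)"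
    unfolding char_def normal_law_eq_scaled_std_normal[OF assms]
    by (subst integral_distr) (auto simp: mult_ac)
  also have "\<dots> = of_real (exp (- (s\<^sup>2 * v / 2)))"
  proof -
    have "(s * sqrt v)\<^sup>2 = s\<^sup>2 * v" using assms by (simp add: power_mult_distrib)
    then show ?thesis unfolding char_std_normal_distribution by simp
  qed
  finally show ?thesis .
qed

text \<open>Completing the square shifts the centre of the density to \<open>a \<sigma>\<^sup>2\<close>.\<close>

lemma normal_law_mgf:
  assumes "\<sigma> > 0"
  shows "integrable (normal_law 0 (\<sigma>\<^sup>2)) (\<lambda>x. exp (a * x))"
    and "integral\<^sup>L (normal_law 0 (\<sigma>\<^sup>2)) (\<lambda>x. exp (a * x)) = exp (a\<^sup>2 * \<sigma>\<^sup>2 / 2)"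
proof -
  have sq: "normal_density 0 \<sigma> x * exp (a * x)
      = exp (a\<^sup>2 * \<sigma>\<^sup>2 / 2) * normal_density (a * \<sigma>\<^sup>2) \<sigma> x" for x
  proof -
    have "- ((x - 0)\<^sup>2 / (2 * \<sigma>\<^sup>2)) + a * x = a\<^sup>2 * \<sigma>\<^sup>2 / 2 - (x - a * \<sigma>\<^sup>2)\<^sup>2 / (2 * \<sigma>\<^sup>2)"
      using assms by (simp add: field_simps power2_eq_square)
    then have "exp (- ((x - 0)\<^sup>2 / (2 * \<sigma>\<^sup>2))) * exp (a * x)
        = exp (a\<^sup>2 * \<sigma>\<^sup>2 / 2) * exp (- ((x - a * \<sigma>\<^sup>2)\<^sup>2 / (2 * \<sigma>\<^sup>2)))"
      by (metis exp_add add_uminus_conv_diff)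
    then show ?thesis by (simp add: normal_density_def)
  qed
  have [simp]: "sqrt (\<sigma>\<^sup>2) = \<sigma>" using assms by simp
  show "integrable (normal_law 0 (\<sigma>\<^sup>2)) (\<lambda>x. exp (a * x))"
    unfolding normal_law_def using assms
    by (subst integrable_density) (auto simp: sq intro!: integrable_mult_right integrable_normal_density)
  show "integral\<^sup>L (normal_law 0 (\<sigma>\<^sup>2)) (\<lambda>x. exp (a * x)) = exp (a\<^sup>2 * \<sigma>\<^sup>2 / 2)"
    unfolding normal_law_def using assms
    by (subst integral_density) (auto simp: sq integral_normal_density)
qed

context prob_space
begin

lemma square_integrable_imp_integrable:
  fixes X :: "'a \<Rightarrow> real"
  assumes [measurable]: "random_variable borel X" and "integrable M (\<lambda>\<omega>. (X \<omega>)\<^sup>2)"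
  shows "integrable M X"
proof (rule Bochner_Integration.integrable_bound)
  show "integrable M (\<lambda>\<omega>. 1 + (X \<omega>)\<^sup>2)" using assms by simp
  have "\<bar>x\<bar> \<le> 1 + x\<^sup>2" for x :: real
    using sum_squares_ge_zero[of "\<bar>x\<bar> - 1" 0] zero_le_power2[of x] by (simp add: power2_eq_square algebra_simps)
  then show "AE \<omega> in M. norm (X \<omega>) \<le> norm (1 + (X \<omega>)\<^sup>2)" by simp
qed simp

text \<open>The variance of \<open>\<bar>X\<bar>\<close> is nonnegative.\<close>

lemma expectation_abs_le_sqrt:
  assumes X[measurable]: "random_variable borel X" and X2: "integrable M (\<lambda>\<omega>. (X \<omega>)\<^sup>2)"
    and B: "expectation (\<lambda>\<omega>. (X \<omega>)\<^sup>2) \<le> B"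
  shows "expectation (\<lambda>\<omega>. \<bar>X \<omega>\<bar>) \<le> sqrt B"
proof -
  have "integrable M (\<lambda>\<omega>. \<bar>X \<omega>\<bar>)"
    using square_integrable_imp_integrable[OF X X2] by simp
  from variance_eq[OF this] X2
  have "(expectation (\<lambda>\<omega>. \<bar>X \<omega>\<bar>))\<^sup>2 \<le> expectation (\<lambda>\<omega>. (X \<omega>)\<^sup>2)"
    using variance_positive[of "\<lambda>\<omega>. \<bar>X \<omega>\<bar>"] by simp
  then show ?thesis using B by (intro real_le_rsqrt) linarith
qed

lemma prob_gt_le_expectation:
  assumes "integrable M (\<lambda>\<omega>. \<bar>X \<omega>\<bar> :: real)" and [measurable]: "random_variable borel X" and "e > 0"
  shows "prob {\<omega> \<in> space M. \<bar>X \<omega>\<bar> > e} \<le> expectation (\<lambda>\<omega>. \<bar>X \<omega>\<bar>) / e"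
proof -
  have "prob {\<omega> \<in> space M. \<bar>X \<omega>\<bar> > e} \<le> prob {\<omega> \<in> space M. \<bar>X \<omega>\<bar> \<ge> e}"
    by (intro finite_measure_mono) auto
  also have "\<dots> \<le> expectation (\<lambda>\<omega>. \<bar>X \<omega>\<bar>) / e"
    using integral_Markov_inequality_measure[OF assms(1), of "{}" e] assms(3) by simp
  finally show ?thesis .
qed

lemma tendsto_in_prob_of_L1:
  assumes meas: "\<And>n. random_variable borel (X n)"
    and int: "\<forall>\<^sub>F n in sequentially. integrable M (X n)"
    and lim: "(\<lambda>n. expectation (\<lambda>\<omega>. \<bar>X n \<omega> - l\<bar>)) \<longlonglongrightarrow> 0"
  shows "tendsto_in_prob M X l"
  unfolding tendsto_in_prob_def
proof (intro allI impI)
  fix e :: real assume "e > 0"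
  have "\<forall>\<^sub>F n in sequentially. prob {\<omega> \<in> space M. \<bar>X n \<omega> - l\<bar> > e}
      \<le> expectation (\<lambda>\<omega>. \<bar>X n \<omega> - l\<bar>) / e"
    using int by eventually_elim
      (rule prob_gt_le_expectation, use meas \<open>e > 0\<close> in auto)
  moreover have "(\<lambda>n. expectation (\<lambda>\<omega>. \<bar>X n \<omega> - l\<bar>) / e) \<longlonglongrightarrow> 0"
    using tendsto_divide[OF lim tendsto_const[of e]] \<open>e > 0\<close> by simp
  ultimately show "(\<lambda>n. prob {\<omega> \<in> space M. \<bar>X n \<omega> - l\<bar> > e}) \<longlonglongrightarrow> 0"
    using Lim_null_comparison[of "\<lambda>n. prob {\<omega> \<in> space M. \<bar>X n \<omega> - l\<bar> > e}"
        "\<lambda>n. expectation (\<lambda>\<omega>. \<bar>X n \<omega> - l\<bar>) / e" sequentially] by simp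
qed

text \<open>Convergence to a centred normal law is pointwise convergence of characteristic functions,
  by the continuity theorem of Levy.\<close>

lemma tendsto_in_distr_normal_iff_char:
  assumes meas: "\<And>n. random_variable borel (X n)" and "v > 0"
  shows "tendsto_in_distr M X (normal_law 0 v) \<longleftrightarrow>
    (\<forall>s. (\<lambda>n. expectation (\<lambda>\<omega>. iexp (s * X n \<omega>))) \<longlonglongrightarrow> of_real (exp (- (s\<^sup>2 * v / 2))))"
proof -
  have rd: "real_distribution (distr M borel (X n))" for n
    by (rule real_distribution_distr) (rule meas)
  have ch: "char (distr M borel (X n)) s = expectation (\<lambda>\<omega>. iexp (s * X n \<omega>))" for n s
    unfolding char_def by (subst integral_distr) (use meas in auto)
  show ?thesis
    unfolding tendsto_in_distr_def ch[symmetric] char_normal_law[OF \<open>v > 0\<close>, symmetric]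
    using levy_continuity1[of "\<lambda>n. distr M borel (X n)", OF rd real_distribution_normal_law[OF \<open>v > 0\<close>]]
      levy_continuity[of "\<lambda>n. distr M borel (X n)", OF rd real_distribution_normal_law[OF \<open>v > 0\<close>]]
    by blast
qed

lemma norm_iexp_diff_le: "cmod (iexp x - iexp y) \<le> \<bar>x - y\<bar>"
proof -
  have "\<i> * complex_of_real x = \<i> * complex_of_real y + \<i> * complex_of_real (x - y)"
    by (simp add: algebra_simps)
  then have "iexp x = iexp y * iexp (x - y)"
    by (simp only: exp_add)
  then have "iexp x - iexp y = iexp y * (iexp (x - y) - 1)"
    by (simp add: algebra_simps)
  then have "cmod (iexp x - iexp y) = cmod (iexp (x - y) - 1)"
    by (simp add: norm_mult)
  also have "\<dots> \<le> \<bar>x - y\<bar>" using iexp_approx1[of "x - y" 0] by simp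
  finally show ?thesis .
qed

text \<open>Slutsky's lemma for a limit law that is centred normal.  It is read off from characteristic
  functions: off an event of small probability the two exponents are close.\<close>

lemma tendsto_in_distr_normal_perturb:
  assumes lim: "tendsto_in_distr M X (normal_law 0 v)" and "v > 0"
    and X[measurable]: "\<And>n. random_variable borel (X n)" and Y[measurable]: "\<And>n. random_variable borel (Y n)"
    and close: "tendsto_in_prob M (\<lambda>n \<omega>. Y n \<omega> - X n \<omega>) 0"
  shows "tendsto_in_distr M Y (normal_law 0 v)"
  unfolding tendsto_in_distr_normal_iff_char[OF Y \<open>v > 0\<close>]
proof
  fix s :: real
  let ?D = "\<lambda>n. expectation (\<lambda>\<omega>. iexp (s * Y n \<omega>)) - expectation (\<lambda>\<omega>. iexp (s * X n \<omega>))"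
  have bound: "cmod (?D n) \<le> \<bar>s\<bar> * e + 2 * prob {\<omega> \<in> space M. \<bar>Y n \<omega> - X n \<omega> - 0\<bar> > e}"
    if "e > 0" for e n
  proof -
    let ?A = "{\<omega> \<in> space M. \<bar>Y n \<omega> - X n \<omega> - 0\<bar> > e}"
    have "?D n = expectation (\<lambda>\<omega>. iexp (s * Y n \<omega>) - iexp (s * X n \<omega>))"
      by (subst Bochner_Integration.integral_diff) (auto intro!: integrable_iexp)
    also have "cmod \<dots> \<le> expectation (\<lambda>\<omega>. cmod (iexp (s * Y n \<omega>) - iexp (s * X n \<omega>)))"
      by (rule integral_norm_bound)
    also have "\<dots> \<le> expectation (\<lambda>\<omega>. \<bar>s\<bar> * e + 2 * indicator ?A \<omega>)"
    proof (rule integral_mono)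
      show "integrable M (\<lambda>\<omega>. cmod (iexp (s * Y n \<omega>) - iexp (s * X n \<omega>)))"
        by (intro integrable_norm Bochner_Integration.integrable_diff integrable_iexp) auto
      show "integrable M (\<lambda>\<omega>. \<bar>s\<bar> * e + 2 * indicator ?A \<omega> :: real)"
        by (simp add: integrable_real_indicator less_top[symmetric])
      fix \<omega> assume w: "\<omega> \<in> space M"
      show "cmod (iexp (s * Y n \<omega>) - iexp (s * X n \<omega>)) \<le> \<bar>s\<bar> * e + 2 * indicator ?A \<omega>"
      proof (cases "\<omega> \<in> ?A")
        case True
        have "cmod (iexp (s * Y n \<omega>) - iexp (s * X n \<omega>)) \<le> 2"
          using norm_triangle_ineq4[of "iexp (s * Y n \<omega>)" "iexp (s * X n \<omega>)"] by simp
        moreover have "0 \<le> \<bar>s\<bar> * e" using that by simp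
        ultimately show ?thesis using True by simp
      next
        case False
        have "cmod (iexp (s * Y n \<omega>) - iexp (s * X n \<omega>)) \<le> \<bar>s * Y n \<omega> - s * X n \<omega>\<bar>"
          by (rule norm_iexp_diff_le)
        also have "\<dots> = \<bar>s\<bar> * \<bar>Y n \<omega> - X n \<omega>\<bar>" by (simp add: abs_mult flip: right_diff_distrib)
        also have "\<dots> \<le> \<bar>s\<bar> * e" using False w by (intro mult_left_mono) auto
        finally show ?thesis using False by simp
      qed
    qed
    also have "\<dots> = \<bar>s\<bar> * e + 2 * prob ?A"
      by (subst Bochner_Integration.integral_add)
        (simp_all add: integrable_real_indicator less_top[symmetric] prob_space)
    finally show ?thesis .
  qed
  have "?D \<longlonglongrightarrow> 0"
  proof (rule LIMSEQ_I)
    fix r :: real assume "r > 0"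
    define e where "e = r / (2 * (\<bar>s\<bar> + 1))"
    have e: "e > 0" "\<bar>s\<bar> * e < r / 2" using \<open>r > 0\<close> by (auto simp: e_def field_simps add_pos_nonneg)
    have "(\<lambda>n. prob {\<omega> \<in> space M. \<bar>Y n \<omega> - X n \<omega> - 0\<bar> > e}) \<longlonglongrightarrow> 0"
      using close e(1) by (simp add: tendsto_in_prob_def)
    from order_tendstoD(2)[OF this, of "r / 4"] \<open>r > 0\<close>
    obtain N where N: "\<And>n. n \<ge> N \<Longrightarrow> prob {\<omega> \<in> space M. \<bar>Y n \<omega> - X n \<omega> - 0\<bar> > e} < r / 4"
      by (auto simp: eventually_sequentially)
    have "cmod (?D n - 0) < r" if "n \<ge> N" for n
      using bound[OF e(1), of n] N[OF that] e(2) by simp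
    then show "\<exists>N. \<forall>n\<ge>N. norm (?D n - 0) < r" by blast
  qed
  moreover have "(\<lambda>n. expectation (\<lambda>\<omega>. iexp (s * X n \<omega>))) \<longlonglongrightarrow> of_real (exp (- (s\<^sup>2 * v / 2)))"
    using lim tendsto_in_distr_normal_iff_char[of X, OF X \<open>v > 0\<close>] by blast
  ultimately have "(\<lambda>n. ?D n + expectation (\<lambda>\<omega>. iexp (s * X n \<omega>)))
      \<longlonglongrightarrow> 0 + of_real (exp (- (s\<^sup>2 * v / 2)))"
    by (rule tendsto_add)
  then show "(\<lambda>n. expectation (\<lambda>\<omega>. iexp (s * Y n \<omega>))) \<longlonglongrightarrow> of_real (exp (- (s\<^sup>2 * v / 2)))"
    by simp
qed

lemma tendsto_in_distr_normal_scale: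
  assumes lim: "tendsto_in_distr M X (normal_law 0 v)" and "v > 0" "a \<noteq> 0"
    and X[measurable]: "\<And>n. random_variable borel (X n)"
  shows "tendsto_in_distr M (\<lambda>n \<omega>. a * X n \<omega>) (normal_law 0 (a\<^sup>2 * v))"
proof (subst tendsto_in_distr_normal_iff_char)
  show "0 < a\<^sup>2 * v" using assms by simp
  show "\<forall>s. (\<lambda>n. expectation (\<lambda>\<omega>. iexp (s * (a * X n \<omega>))))
      \<longlonglongrightarrow> of_real (exp (- (s\<^sup>2 * (a\<^sup>2 * v) / 2)))"
  proof
    fix s
    have "(\<lambda>n. expectation (\<lambda>\<omega>. iexp ((s * a) * X n \<omega>)))
        \<longlonglongrightarrow> of_real (exp (- ((s * a)\<^sup>2 * v / 2)))"
      using lim tendsto_in_distr_normal_iff_char[of X, OF X \<open>v > 0\<close>] by blast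
    then show "(\<lambda>n. expectation (\<lambda>\<omega>. iexp (s * (a * X n \<omega>))))
        \<longlonglongrightarrow> of_real (exp (- (s\<^sup>2 * (a\<^sup>2 * v) / 2)))"
      by (simp add: mult_ac power_mult_distrib)
  qed
qed simp

end

section \<open>Sums of innovations with predictable coefficients\<close>

text \<open>A martingale setting at a fixed horizon \<open>N\<close>: each innovation \<open>e t\<close> is independent of the past \<open>F (t - 1)\<close>,
  and sums \<open>\<Sum> b t * g (e t)\<close> are considered whose coefficients \<open>b t\<close> are known before time \<open>t\<close>.  Independence,
  rather than mere orthogonality to the past, makes conditional expectations given \<open>F (t - 1)\<close> into
  integrals over the law of \<open>e t\<close>.\<close>

locale innovation_filtration = prob_space M
  for M :: "'a measure" +
  fixes N :: nat and F :: "nat \<Rightarrow> 'a measure" and e :: "nat \<Rightarrow> 'a \<Rightarrow> real"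
  assumes subalgebra_F: "\<And>t. t \<le> N \<Longrightarrow> subalgebra M (F t)"
    and F_mono: "\<And>s t. s \<le> t \<Longrightarrow> t \<le> N \<Longrightarrow> sets (F s) \<subseteq> sets (F t)"
    and e_adapted: "\<And>t. 1 \<le> t \<Longrightarrow> t \<le> N \<Longrightarrow> e t \<in> borel_measurable (F t)"
    and e_indep_past: "\<And>t. 1 \<le> t \<Longrightarrow> t \<le> N \<Longrightarrow>
      indep_set (sets (F (t - 1))) (sets (vimage_algebra (space M) (e t) borel))"
begin

lemma space_F: "t \<le> N \<Longrightarrow> space (F t) = space M"
  using subalgebra_F by (simp add: subalgebra_def)

lemma measurable_F_mono: "f \<in> measurable (F s) S \<Longrightarrow> s \<le> t \<Longrightarrow> t \<le> N \<Longrightarrow> f \<in> measurable (F t) S"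
  using F_mono[of s t] space_F[of s] space_F[of t] by (auto simp: measurable_def)

lemma measurable_F_M: "f \<in> measurable (F t) S \<Longrightarrow> t \<le> N \<Longrightarrow> f \<in> measurable M S"
  using measurable_from_subalg[OF subalgebra_F] by blast

text \<open>The two members of an \<^const>\<open>prob_space.indep_var\<close> pair take values in one type; composing with
  \<open>g\<close> allows \<open>e t\<close> to be embedded into the type of \<open>X\<close>.\<close>

lemma indep_var_past_innovation:
  assumes t: "1 \<le> t" "t \<le> N" and X: "X \<in> measurable (F (t - 1)) S" and g: "g \<in> measurable borel T"
  shows "indep_var S X T (\<lambda>\<omega>. g (e t \<omega>))"
proof -
  have rX: "random_variable S X" using measurable_F_M[OF X] t by simp
  have re: "random_variable borel (e t)" using measurable_F_M[OF e_adapted[OF t]] t by simp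
  have rg: "random_variable T (\<lambda>\<omega>. g (e t \<omega>))" using measurable_compose[OF re g] .
  have sp: "space (F (t - 1)) = space M" using space_F[of "t - 1"] t by simp
  have X_sets: "sigma_sets (space M) {X -` A \<inter> space M |A. A \<in> sets S} \<subseteq> sets (F (t - 1))"
  proof -
    have "{X -` A \<inter> space M |A. A \<in> sets S} \<subseteq> sets (F (t - 1))"
      using measurable_sets[OF X] unfolding sp by blast
    from sets.sigma_sets_subset[OF this] show ?thesis unfolding sp .
  qed
  let ?V = "vimage_algebra (space M) (e t) borel"
  have "(\<lambda>\<omega>. g (e t \<omega>)) \<in> measurable ?V T"
    using measurable_compose[OF measurable_vimage_algebra1 g, of "e t" "space M"] by simp
  then have g_sets: "sigma_sets (space M) {(\<lambda>\<omega>. g (e t \<omega>)) -` A \<inter> space M |A. A \<in> sets T} \<subseteq> sets ?V"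
  proof -
    assume m: "(\<lambda>\<omega>. g (e t \<omega>)) \<in> measurable ?V T"
    have "{(\<lambda>\<omega>. g (e t \<omega>)) -` A \<inter> space M |A. A \<in> sets T} \<subseteq> sets ?V"
      using measurable_sets[OF m] by auto
    from sets.sigma_sets_subset[OF this] show ?thesis by simp
  qed
  show ?thesis
    unfolding indep_var_eq
  proof (intro conjI rX rg)
    show "indep_set (sigma_sets (space M) {X -` A \<inter> space M |A. A \<in> sets S})
        (sigma_sets (space M) {(\<lambda>\<omega>. g (e t \<omega>)) -` A \<inter> space M |A. A \<in> sets T})"
      using e_indep_past[OF t] X_sets g_sets unfolding indep_sets2_eq by blast
  qed
qed

lemma
  fixes X :: "'a \<Rightarrow> real" and g :: "real \<Rightarrow> real"
  assumes t: "1 \<le> t" "t \<le> N" and X: "X \<in> borel_measurable (F (t - 1))" "integrable M X"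
    and g: "g \<in> borel_measurable borel" "integrable M (\<lambda>\<omega>. g (e t \<omega>))"
  shows integrable_past_innovation: "integrable M (\<lambda>\<omega>. X \<omega> * g (e t \<omega>))"
    and expectation_past_innovation:
      "expectation (\<lambda>\<omega>. X \<omega> * g (e t \<omega>)) = expectation X * expectation (\<lambda>\<omega>. g (e t \<omega>))"
proof -
  note * = indep_var_past_innovation[OF t X(1) g(1)]
  show "integrable M (\<lambda>\<omega>. X \<omega> * g (e t \<omega>))"
    by (rule indep_var_integrable[OF * X(2) g(2)])
  show "expectation (\<lambda>\<omega>. X \<omega> * g (e t \<omega>)) = expectation X * expectation (\<lambda>\<omega>. g (e t \<omega>))"
    by (rule indep_var_lebesgue_integral[OF * X(2) g(2)])
qed

text \<open>Integrating out the last innovation: given the past, the coefficient \<open>b\<close> of \<open>e t\<close> is a constant.\<close>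

lemma expectation_iexp_innovation:
  fixes H :: "'a \<Rightarrow> complex" and b :: "'a \<Rightarrow> real"
  assumes t: "1 \<le> t" "t \<le> N"
    and H: "H \<in> borel_measurable (F (t - 1))" and H_bound: "\<And>\<omega>. \<omega> \<in> space M \<Longrightarrow> cmod (H \<omega>) \<le> B"
    and b: "b \<in> borel_measurable (F (t - 1))"
  shows "expectation (\<lambda>\<omega>. H \<omega> * iexp (b \<omega> * e t \<omega>))
       = expectation (\<lambda>\<omega>. H \<omega> * char (distr M borel (e t)) (b \<omega>))"
proof -
  \<comment> \<open>Both members of the independent pair must have one type, so \<open>e t\<close> is carried as \<open>(0, e t)\<close>.\<close>
  let ?B = "borel \<Otimes>\<^sub>M borel :: (complex \<times> real) measure"
  let ?P = "distr M ?B (\<lambda>\<omega>. (H \<omega>, b \<omega>))" and ?Q = "distr M ?B (\<lambda>\<omega>. (0, e t \<omega>))"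
  let ?\<psi> = "char (distr M borel (e t))"
  have HbF: "(\<lambda>\<omega>. (H \<omega>, b \<omega>)) \<in> F (t - 1) \<rightarrow>\<^sub>M ?B"
    using H b by (rule measurable_Pair)
  have Hb[measurable]: "random_variable ?B (\<lambda>\<omega>. (H \<omega>, b \<omega>))"
    using measurable_F_M[OF HbF] t by simp
  have H'[measurable]: "random_variable borel H" and b'[measurable]: "random_variable borel b"
    using measurable_F_M[OF H] measurable_F_M[OF b] t by simp_all
  have e[measurable]: "random_variable borel (e t)"
    using measurable_F_M[OF e_adapted[OF t]] t by simp
  interpret P: prob_space ?P by (rule prob_space_distr) simp
  interpret Q: prob_space ?Q by (rule prob_space_distr) simp
  interpret E: real_distribution "distr M borel (e t)" by (rule real_distribution_distr) simp
  interpret PQ: pair_prob_space ?P ?Q ..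
  have prod: "?P \<Otimes>\<^sub>M ?Q = distr M (?B \<Otimes>\<^sub>M ?B) (\<lambda>\<omega>. ((H \<omega>, b \<omega>), (0, e t \<omega>)))"
    using indep_var_past_innovation[OF t HbF, of "\<lambda>x. (0, x)" ?B] unfolding indep_var_distribution_eq by simp
  let ?f = "\<lambda>z. fst (fst z) * iexp (snd (fst z) * snd (snd z)) :: complex"
  have meas_f[measurable]: "?f \<in> borel_measurable (?B \<Otimes>\<^sub>M ?B)"
    by measurable
  have meas_char[measurable]: "?\<psi> \<in> borel_measurable borel" by (rule E.char_measurable)
  have int: "integrable (?P \<Otimes>\<^sub>M ?Q) ?f"
    unfolding prod
  proof (subst integrable_distr_eq)
    show "integrable M (\<lambda>\<omega>. ?f ((H \<omega>, b \<omega>), (0, e t \<omega>)))"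
      by (rule integrable_const_bound[of _ B]) (auto simp: norm_mult H_bound)
  qed auto
  have "expectation (\<lambda>\<omega>. H \<omega> * iexp (b \<omega> * e t \<omega>)) = integral\<^sup>L (?P \<Otimes>\<^sub>M ?Q) ?f"
    unfolding prod by (subst integral_distr) auto
  also have "\<dots> = (\<integral>p. \<integral>x. ?f (p, x) \<partial>?Q \<partial>?P)"
    using PQ.integral_fst'[OF int] by simp
  also have "\<dots> = (\<integral>p. fst p * ?\<psi> (snd p) \<partial>?P)"
  proof -
    have "(\<integral>x. ?f (p, x) \<partial>?Q) = fst p * ?\<psi> (snd p)" for p
      unfolding char_def by (subst (1 2) integral_distr) auto
    then show ?thesis by (rule Bochner_Integration.integral_cong[OF refl])
  qed
  also have "\<dots> = expectation (\<lambda>\<omega>. H \<omega> * ?\<psi> (b \<omega>))"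
    by (subst integral_distr) auto
  finally show ?thesis .
qed

text \<open>Martingale differences are orthogonal, so the variances add up.\<close>

lemma
  fixes b :: "nat \<Rightarrow> 'a \<Rightarrow> real" and g :: "real \<Rightarrow> real"
  assumes g: "g \<in> borel_measurable borel"
    and g2: "\<And>t. 1 \<le> t \<Longrightarrow> t \<le> N \<Longrightarrow> integrable M (\<lambda>\<omega>. (g (e t \<omega>))\<^sup>2)"
    and g_mean: "\<And>t. 1 \<le> t \<Longrightarrow> t \<le> N \<Longrightarrow> expectation (\<lambda>\<omega>. g (e t \<omega>)) = 0"
    and g_var: "\<And>t. 1 \<le> t \<Longrightarrow> t \<le> N \<Longrightarrow> expectation (\<lambda>\<omega>. (g (e t \<omega>))\<^sup>2) \<le> K"
    and b: "\<And>t. 1 \<le> t \<Longrightarrow> t \<le> N \<Longrightarrow> b t \<in> borel_measurable (F (t - 1))"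
    and b2: "\<And>t. 1 \<le> t \<Longrightarrow> t \<le> N \<Longrightarrow> integrable M (\<lambda>\<omega>. (b t \<omega>)\<^sup>2)"
    and n: "n \<le> N"
  shows martingale_sum_adapted: "(\<lambda>\<omega>. \<Sum>t=1..n. b t \<omega> * g (e t \<omega>)) \<in> borel_measurable (F n)"
    and martingale_sum_square_integrable: "integrable M (\<lambda>\<omega>. (\<Sum>t=1..n. b t \<omega> * g (e t \<omega>))\<^sup>2)"
    and martingale_sum_square_le:
      "expectation (\<lambda>\<omega>. (\<Sum>t=1..n. b t \<omega> * g (e t \<omega>))\<^sup>2) \<le> K * (\<Sum>t=1..n. expectation (\<lambda>\<omega>. (b t \<omega>)\<^sup>2))"
  using n
proof (induction n)
  case 0
  { case 1 show ?case by simp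
  next case 2 show ?case by simp
  next case 3 show ?case by simp }
next
  case (Suc n)
  let ?S = "\<lambda>n \<omega>. \<Sum>t=1..n. b t \<omega> * g (e t \<omega>)" and ?t = "Suc n"
  have ad: "?S (Suc n) \<in> borel_measurable (F (Suc n))" if "Suc n \<le> N"
  proof -
    have [measurable]: "g \<in> borel_measurable borel" by (rule g)
    have [measurable]: "?S n \<in> borel_measurable (F (Suc n))" "b (Suc n) \<in> borel_measurable (F (Suc n))"
      "e (Suc n) \<in> borel_measurable (F (Suc n))"
      using Suc(1) measurable_F_mono[of _ n _ "Suc n"] b[of "Suc n"] e_adapted[of "Suc n"] that by simp_all
    have "(\<lambda>\<omega>. ?S n \<omega> + b (Suc n) \<omega> * g (e (Suc n) \<omega>)) \<in> borel_measurable (F (Suc n))"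
      by measurable
    then show ?thesis by simp
  qed
  have main: "integrable M (\<lambda>\<omega>. (?S (Suc n) \<omega>)\<^sup>2) \<and>
      expectation (\<lambda>\<omega>. (?S (Suc n) \<omega>)\<^sup>2) \<le> K * (\<Sum>t=1..Suc n. expectation (\<lambda>\<omega>. (b t \<omega>)\<^sup>2))" if le: "Suc n \<le> N"
  proof -
    have t: "1 \<le> ?t" "?t \<le> N" using le by auto
    have S: "?S n \<in> borel_measurable (F n)" and S2: "integrable M (\<lambda>\<omega>. (?S n \<omega>)\<^sup>2)"
      and SB: "expectation (\<lambda>\<omega>. (?S n \<omega>)\<^sup>2) \<le> K * (\<Sum>t=1..n. expectation (\<lambda>\<omega>. (b t \<omega>)\<^sup>2))"
      using Suc le by auto
    have bF: "b ?t \<in> borel_measurable (F n)" using b[OF t] by simp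
    have [measurable]: "random_variable borel (?S n)" "random_variable borel (b ?t)" "random_variable borel (e ?t)"
      "g \<in> borel_measurable borel"
      using measurable_F_M[OF S] measurable_F_M[OF bF] measurable_F_M[OF e_adapted[OF t]] g le by simp_all
    have gi: "integrable M (\<lambda>\<omega>. g (e ?t \<omega>))"
      by (rule square_integrable_imp_integrable) (use g2[OF t] in auto)
    have Sb: "integrable M (\<lambda>\<omega>. 2 * (?S n \<omega> * b ?t \<omega>))"
    proof (rule Bochner_Integration.integrable_bound)
      show "integrable M (\<lambda>\<omega>. (?S n \<omega>)\<^sup>2 + (b ?t \<omega>)\<^sup>2)" using S2 b2[OF t] by simp
      show "AE \<omega> in M. norm (2 * (?S n \<omega> * b ?t \<omega>)) \<le> norm ((?S n \<omega>)\<^sup>2 + (b ?t \<omega>)\<^sup>2)"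
      proof (rule AE_I2)
        fix \<omega>
        have "0 \<le> (\<bar>?S n \<omega>\<bar> - \<bar>b ?t \<omega>\<bar>)\<^sup>2" by simp
        then show "norm (2 * (?S n \<omega> * b ?t \<omega>)) \<le> norm ((?S n \<omega>)\<^sup>2 + (b ?t \<omega>)\<^sup>2)"
          by (simp add: power2_diff abs_mult)
      qed
      show "random_variable borel (\<lambda>\<omega>. 2 * (?S n \<omega> * b ?t \<omega>))" by measurable
    qed
    have SbF: "(\<lambda>\<omega>. 2 * (?S n \<omega> * b ?t \<omega>)) \<in> borel_measurable (F (?t - 1))"
      using S bF by simp
    have b2F: "(\<lambda>\<omega>. (b ?t \<omega>)\<^sup>2) \<in> borel_measurable (F (?t - 1))"
      using bF by simp
    have eq: "(?S (Suc n) \<omega>)\<^sup>2 = (?S n \<omega>)\<^sup>2 + 2 * (?S n \<omega> * b ?t \<omega>) * g (e ?t \<omega>) + (b ?t \<omega>)\<^sup>2 * (g (e ?t \<omega>))\<^sup>2" for \<omega>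
      by (simp add: power2_eq_square algebra_simps)
    note cross = integrable_past_innovation[OF t SbF Sb g gi] expectation_past_innovation[OF t SbF Sb g gi]
    have g2m: "(\<lambda>x. (g x)\<^sup>2) \<in> borel_measurable borel" by simp
    note diag = integrable_past_innovation[OF t b2F b2[OF t] g2m g2[OF t]]
      expectation_past_innovation[OF t b2F b2[OF t] g2m g2[OF t]]
    have "expectation (\<lambda>\<omega>. (?S (Suc n) \<omega>)\<^sup>2)
        = expectation (\<lambda>\<omega>. (?S n \<omega>)\<^sup>2) + expectation (\<lambda>\<omega>. (b ?t \<omega>)\<^sup>2) * expectation (\<lambda>\<omega>. (g (e ?t \<omega>))\<^sup>2)"
      unfolding eq using S2 cross diag g_mean[OF t] by simp
    also have "\<dots> \<le> K * (\<Sum>t=1..n. expectation (\<lambda>\<omega>. (b t \<omega>)\<^sup>2)) + expectation (\<lambda>\<omega>. (b ?t \<omega>)\<^sup>2) * K"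
      using SB g_var[OF t] by (intro add_mono mult_left_mono) auto
    finally have "expectation (\<lambda>\<omega>. (?S (Suc n) \<omega>)\<^sup>2) \<le> K * (\<Sum>t=1..Suc n. expectation (\<lambda>\<omega>. (b t \<omega>)\<^sup>2))" by (simp add: algebra_simps)
    moreover have "integrable M (\<lambda>\<omega>. (?S (Suc n) \<omega>)\<^sup>2)"
      unfolding eq using S2 cross diag by simp
    ultimately show ?thesis by simp
  qed
  { case 1 then show ?case by (rule ad)
  next case 2 then show ?case using main by blast
  next case 3 then show ?case using main by blast }
qed

end

section \<open>A quantitative central limit theorem\<close>

context prob_space
begin

text \<open>Both the characteristic function and \<open>exp (- (x\<^sup>2 / 2))\<close> are \<open>1 - x\<^sup>2 / 2\<close> up to third order.  The factor
  \<open>exp (x\<^sup>2 / 2)\<close> is the form in which this enters the compensated exponential of a martingale.\<close>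

lemma char_normalised_bound:
  assumes X[measurable]: "random_variable borel X" and X2: "integrable M (\<lambda>\<omega>. (X \<omega>)\<^sup>2)"
    and X3: "integrable M (\<lambda>\<omega>. \<bar>X \<omega>\<bar> ^ 3)"
    and mean: "expectation X = 0" and var: "expectation (\<lambda>\<omega>. (X \<omega>)\<^sup>2) = 1"
    and K: "expectation (\<lambda>\<omega>. \<bar>X \<omega>\<bar> ^ 3) \<le> K" and x: "\<bar>x\<bar> \<le> \<beta>"
  shows "cmod (of_real (exp (x\<^sup>2 / 2)) * char (distr M borel X) x - 1)
       \<le> exp (\<beta>\<^sup>2 / 2) * (K / 6 + \<beta> / 8) * \<bar>x\<bar> ^ 3"
proof -
  let ?\<psi> = "char (distr M borel X) x"
  have x2: "x\<^sup>2 = \<bar>x\<bar> * \<bar>x\<bar>" by (simp add: power2_eq_square)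
  have X1: "integrable M X" by (rule square_integrable_imp_integrable[OF X X2])
  have "cmod (?\<psi> - of_real (1 - x\<^sup>2 / 2)) = cmod (?\<psi> - (1 - x\<^sup>2 * 1 / 2))" by simp
  also have "\<dots> \<le> x\<^sup>2 / 6 * expectation (\<lambda>\<omega>. min (6 * (X \<omega>)\<^sup>2) (\<bar>x\<bar> * \<bar>X \<omega>\<bar> ^ 3))"
    using char_approx3'[OF X X1 X2 mean, of 1 "distr M borel X" x] mean var by simp
  also have "expectation (\<lambda>\<omega>. min (6 * (X \<omega>)\<^sup>2) (\<bar>x\<bar> * \<bar>X \<omega>\<bar> ^ 3)) \<le> expectation (\<lambda>\<omega>. \<bar>x\<bar> * \<bar>X \<omega>\<bar> ^ 3)"
    by (rule integral_mono_AE) (use X2 X3 in auto)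
  also have "\<dots> \<le> \<bar>x\<bar> * K" using K by (simp add: mult_left_mono)
  finally have "cmod (?\<psi> - of_real (1 - x\<^sup>2 / 2)) \<le> x\<^sup>2 / 6 * (\<bar>x\<bar> * K)"
    by (simp add: mult_left_mono)
  then have 1: "cmod (?\<psi> - of_real (1 - x\<^sup>2 / 2)) \<le> K / 6 * \<bar>x\<bar> ^ 3"
  proof -
    assume "cmod (?\<psi> - of_real (1 - x\<^sup>2 / 2)) \<le> x\<^sup>2 / 6 * (\<bar>x\<bar> * K)"
    also have "x\<^sup>2 / 6 * (\<bar>x\<bar> * K) = K / 6 * \<bar>x\<bar> ^ 3" unfolding x2 power3_eq_cube by simp
    finally show ?thesis .
  qed
  have "\<bar>1 - x\<^sup>2 / 2 - exp (- (x\<^sup>2 / 2))\<bar> \<le> (x\<^sup>2 / 2)\<^sup>2 / 2"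
  proof -
    have lo: "1 - z \<le> exp (- z)" for z :: real using exp_ge_add_one_self[of "- z"] by simp
    have hi: "exp (- z) \<le> 1 - z + z\<^sup>2 / 2" if "z \<ge> 0" for z :: real
    proof -
      let ?g = "\<lambda>z. 1 - z + z\<^sup>2 / 2 - exp (- z) :: real"
      have "?g 0 \<le> ?g z"
      proof (rule DERIV_nonneg_imp_nondecreasing[OF that])
        fix y :: real assume "0 \<le> y" "y \<le> z"
        have "DERIV ?g y :> - 1 + y + exp (- y)"
          by (auto intro!: derivative_eq_intros)
        moreover have "0 \<le> - 1 + y + exp (- y)" using lo[of y] by simp
        ultimately show "\<exists>d. DERIV ?g y :> d \<and> 0 \<le> d" by blast
      qed
      then show ?thesis by simp
    qed
    show ?thesis using lo[of "x\<^sup>2 / 2"] hi[of "x\<^sup>2 / 2"] by simp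
  qed
  also have "(x\<^sup>2 / 2)\<^sup>2 / 2 = \<bar>x\<bar> / 8 * \<bar>x\<bar> ^ 3"
    unfolding x2 power3_eq_cube power2_eq_square by simp
  also have "\<dots> \<le> \<beta> / 8 * \<bar>x\<bar> ^ 3" using x by (intro mult_right_mono) auto
  finally have 2: "cmod (of_real (1 - x\<^sup>2 / 2) - of_real (exp (- (x\<^sup>2 / 2)))) \<le> \<beta> / 8 * \<bar>x\<bar> ^ 3"
    by (simp only: norm_of_real flip: of_real_diff)
  have "of_real (exp (x\<^sup>2 / 2)) * of_real (exp (- (x\<^sup>2 / 2))) = (1 :: complex)"
    by (simp only: flip: of_real_mult exp_add) simp
  then have "of_real (exp (x\<^sup>2 / 2)) * ?\<psi> - 1 = of_real (exp (x\<^sup>2 / 2)) * (?\<psi> - of_real (exp (- (x\<^sup>2 / 2))))"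
    by (simp only: right_diff_distrib)
  then have "cmod (of_real (exp (x\<^sup>2 / 2)) * ?\<psi> - 1) = exp (x\<^sup>2 / 2) * cmod (?\<psi> - of_real (exp (- (x\<^sup>2 / 2))))"
    by (simp only: norm_mult norm_of_real) simp
  also have "cmod (?\<psi> - of_real (exp (- (x\<^sup>2 / 2)))) \<le> (K / 6 + \<beta> / 8) * \<bar>x\<bar> ^ 3"
    using norm_triangle_mono[OF 1 2] by (simp only: diff_add_cancel add_diff_eq distrib_right)
  also have "exp (x\<^sup>2 / 2) * ((K / 6 + \<beta> / 8) * \<bar>x\<bar> ^ 3) \<le> exp (\<beta>\<^sup>2 / 2) * ((K / 6 + \<beta> / 8) * \<bar>x\<bar> ^ 3)"
  proof (intro mult_right_mono)
    have "x\<^sup>2 \<le> \<beta>\<^sup>2" using power_mono[OF x, of 2] by simp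
    then show "exp (x\<^sup>2 / 2) \<le> exp (\<beta>\<^sup>2 / 2)" by simp
    have "0 \<le> K" using order_trans[OF Bochner_Integration.integral_nonneg K] by simp
    then show "0 \<le> (K / 6 + \<beta> / 8) * \<bar>x\<bar> ^ 3" using x by simp
  qed
  finally show ?thesis by (simp add: mult_ac)
qed

end

text \<open>The truncation keeps a coefficient as long as the predictable sum of squares, itself
  included, has not exceeded \<open>v\<close>.  It is again predictable, and its sum of squares is bounded.\<close>

definition truncate_coeff :: "real \<Rightarrow> (nat \<Rightarrow> 'a \<Rightarrow> real) \<Rightarrow> nat \<Rightarrow> 'a \<Rightarrow> real" where
  "truncate_coeff v b t \<omega> = (if (\<Sum>i=1..t. (b i \<omega>)\<^sup>2) \<le> v then b t \<omega> else 0)"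

lemma truncate_coeff_sum_le:
  assumes "v \<ge> 0"
  shows "(\<Sum>i=1..n. (truncate_coeff v b i \<omega>)\<^sup>2) \<le> v"
    and "(\<Sum>i=1..n. (b i \<omega>)\<^sup>2) \<le> v \<Longrightarrow> (\<Sum>i=1..n. (truncate_coeff v b i \<omega>)\<^sup>2) = (\<Sum>i=1..n. (b i \<omega>)\<^sup>2)"
proof -
  have "(\<Sum>i=1..n. (truncate_coeff v b i \<omega>)\<^sup>2) \<le> v \<and>
    ((\<Sum>i=1..n. (b i \<omega>)\<^sup>2) \<le> v \<longrightarrow> (\<Sum>i=1..n. (truncate_coeff v b i \<omega>)\<^sup>2) = (\<Sum>i=1..n. (b i \<omega>)\<^sup>2))"
  proof (induction n)
    case (Suc n)
    show ?case
    proof (cases "(\<Sum>i=1..Suc n. (b i \<omega>)\<^sup>2) \<le> v")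
      case True
      moreover have "(\<Sum>i=1..n. (b i \<omega>)\<^sup>2) \<le> (\<Sum>i=1..Suc n. (b i \<omega>)\<^sup>2)" by simp
      ultimately have "(\<Sum>i=1..n. (b i \<omega>)\<^sup>2) \<le> v" by linarith
      moreover have "truncate_coeff v b (Suc n) \<omega> = b (Suc n) \<omega>"
        using True by (simp only: truncate_coeff_def if_True)
      ultimately show ?thesis using Suc True by simp
    next
      case False
      then have "truncate_coeff v b (Suc n) \<omega> = 0"
        by (simp only: truncate_coeff_def if_False)
      then show ?thesis using Suc False by simp
    qed
  qed (use assms in simp)
  then show "(\<Sum>i=1..n. (truncate_coeff v b i \<omega>)\<^sup>2) \<le> v"
    and "(\<Sum>i=1..n. (b i \<omega>)\<^sup>2) \<le> v \<Longrightarrow> (\<Sum>i=1..n. (truncate_coeff v b i \<omega>)\<^sup>2) = (\<Sum>i=1..n. (b i \<omega>)\<^sup>2)"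
    by blast+
qed

lemma truncate_coeff_eq:
  assumes "(\<Sum>i=1..n. (b i \<omega>)\<^sup>2) \<le> v" "t \<le> n"
  shows "truncate_coeff v b t \<omega> = b t \<omega>"
proof -
  have "(\<Sum>i=1..t. (b i \<omega>)\<^sup>2) \<le> (\<Sum>i=1..n. (b i \<omega>)\<^sup>2)"
    using assms(2) by (intro sum_mono2) auto
  then show ?thesis using assms(1) by (simp add: truncate_coeff_def)
qed

lemma abs_truncate_coeff_le: "\<bar>truncate_coeff v b t \<omega>\<bar> \<le> \<bar>b t \<omega>\<bar>"
  by (simp add: truncate_coeff_def)

text \<open>The factor \<open>exp (s\<^sup>2 (w + 1))\<close> bounds the compensated exponential when the sum of squares is at most
  \<open>w + 1\<close>; the summands come from the one-step error, the truncation and the compensator, in this order.\<close>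

definition clt_const :: "real \<Rightarrow> real \<Rightarrow> real \<Rightarrow> real" where
  "clt_const s w K = exp (s\<^sup>2 * (w + 1)) * ((K / 6 + \<bar>s\<bar> * sqrt (w + 1) / 8) * \<bar>s\<bar> ^ 3 + 2 + s\<^sup>2 / 2)"

lemma abs_exp_minus_one_le: "\<bar>exp x - 1\<bar> \<le> \<bar>x\<bar> * exp \<bar>x :: real\<bar>"
proof (cases "0 \<le> x")
  case True
  have "exp x * (1 - x) \<le> exp x * exp (- x)"
    using exp_ge_add_one_self[of "- x"] by (intro mult_left_mono) auto
  then show ?thesis using True by (simp add: algebra_simps flip: exp_add)
next
  case False
  have "1 + x \<le> exp x" "exp x \<le> 1" using False by auto
  then have "\<bar>exp x - 1\<bar> \<le> \<bar>x\<bar> * 1" using False by linarith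
  also have "\<dots> \<le> \<bar>x\<bar> * exp \<bar>x\<bar>" by (intro mult_left_mono) auto
  finally show ?thesis .
qed

context innovation_filtration
begin

text \<open>If the compensated exponential \<open>T n = iexp (s S n) * exp (s\<^sup>2 V n / 2)\<close> were a martingale, its
  expectation would be \<open>1\<close>.  Integrating out the newest innovation replaces \<open>iexp (s b e)\<close> by the characteristic
  function at \<open>s b\<close>, so that one step changes the expectation only by the third-order error.  The bound
  \<open>V \<le> v\<close> keeps \<open>T\<close> bounded.\<close>

lemma martingale_exponential_bound:
  fixes b :: "nat \<Rightarrow> 'a \<Rightarrow> real"
  defines "S \<equiv> \<lambda>n \<omega>. \<Sum>t=1..n. b t \<omega> * e t \<omega>" and "V \<equiv> \<lambda>n \<omega>. \<Sum>t=1..n. (b t \<omega>)\<^sup>2"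
  assumes e2: "\<And>t. 1 \<le> t \<Longrightarrow> t \<le> N \<Longrightarrow> integrable M (\<lambda>\<omega>. (e t \<omega>)\<^sup>2)"
    and e3: "\<And>t. 1 \<le> t \<Longrightarrow> t \<le> N \<Longrightarrow> integrable M (\<lambda>\<omega>. \<bar>e t \<omega>\<bar> ^ 3)"
    and mean: "\<And>t. 1 \<le> t \<Longrightarrow> t \<le> N \<Longrightarrow> expectation (e t) = 0"
    and var: "\<And>t. 1 \<le> t \<Longrightarrow> t \<le> N \<Longrightarrow> expectation (\<lambda>\<omega>. (e t \<omega>)\<^sup>2) = 1"
    and K: "\<And>t. 1 \<le> t \<Longrightarrow> t \<le> N \<Longrightarrow> expectation (\<lambda>\<omega>. \<bar>e t \<omega>\<bar> ^ 3) \<le> K"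
    and b: "\<And>t. 1 \<le> t \<Longrightarrow> t \<le> N \<Longrightarrow> b t \<in> borel_measurable (F (t - 1))"
    and b3: "\<And>t. 1 \<le> t \<Longrightarrow> t \<le> N \<Longrightarrow> integrable M (\<lambda>\<omega>. \<bar>b t \<omega>\<bar> ^ 3)"
    and v: "v \<ge> 0" and Vv: "\<And>n \<omega>. V n \<omega> \<le> v"
    and n: "n \<le> N"
  shows "cmod (expectation (\<lambda>\<omega>. iexp (s * S n \<omega>) * of_real (exp (s\<^sup>2 / 2 * V n \<omega>))) - 1)
     \<le> exp (s\<^sup>2 * v) * ((K / 6 + \<bar>s\<bar> * sqrt v / 8) * \<bar>s\<bar> ^ 3) * (\<Sum>t=1..n. expectation (\<lambda>\<omega>. \<bar>b t \<omega>\<bar> ^ 3))"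
  using n
proof (induction n)
  case 0
  show ?case by (simp add: S_def V_def prob_space)
next
  case (Suc n)
  define T where "T = (\<lambda>n \<omega>. iexp (s * S n \<omega>) * of_real (exp (s\<^sup>2 / 2 * V n \<omega>)))"
  define G where "G = (\<lambda>\<omega>. iexp (s * S n \<omega>) * of_real (exp (s\<^sup>2 / 2 * V (Suc n) \<omega>)))"
  define C where "C = exp (s\<^sup>2 * v / 2) * (K / 6 + \<bar>s\<bar> * sqrt v / 8) * \<bar>s\<bar> ^ 3"
  let ?t = "Suc n" and ?\<psi> = "char (distr M borel (e (Suc n)))"
  have t: "1 \<le> ?t" "?t \<le> N" using Suc.prems by auto
  have [measurable]: "b i \<in> borel_measurable (F n)" if "i \<in> {1..Suc n}" for i
    using measurable_F_mono[OF b[of i], of n] that t by auto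
  have [measurable]: "e i \<in> borel_measurable (F n)" if "i \<in> {1..n}" for i
    using measurable_F_mono[OF e_adapted[of i], of n] that t by auto
  have SF[measurable]: "S n \<in> borel_measurable (F n)" unfolding S_def by (rule borel_measurable_sum) auto
  have VF[measurable]: "V n \<in> borel_measurable (F n)" unfolding V_def by (rule borel_measurable_sum) auto
  have V'F[measurable]: "V (Suc n) \<in> borel_measurable (F n)" unfolding V_def by (rule borel_measurable_sum) auto
  have bF: "b ?t \<in> borel_measurable (F n)" using b[OF t] by simp
  have GF: "G \<in> borel_measurable (F (?t - 1))" unfolding G_def by simp
  have TF: "T n \<in> borel_measurable (F n)" unfolding T_def by simp
  have [measurable]: "random_variable borel G" "random_variable borel (T n)" "random_variable borel (b ?t)"
      "random_variable borel (e ?t)"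
    using measurable_F_M[OF GF] measurable_F_M[OF TF] measurable_F_M[OF bF] measurable_F_M[OF e_adapted[OF t]] t
    by simp_all
  interpret E: real_distribution "distr M borel (e ?t)" by (rule real_distribution_distr) simp
  have exp_bound: "exp (s\<^sup>2 / 2 * V m \<omega>) \<le> exp (s\<^sup>2 * v / 2)" for m \<omega>
    using mult_left_mono[OF Vv[of m \<omega>], of "s\<^sup>2"] by simp
  have G_bound: "cmod (G \<omega>) \<le> exp (s\<^sup>2 * v / 2)" for \<omega>
    unfolding G_def norm_mult using exp_bound[of "Suc n" \<omega>] by (simp add: norm_mult)
  have T_bound: "cmod (T n \<omega>) \<le> exp (s\<^sup>2 * v / 2)" for \<omega>
    unfolding T_def norm_mult using exp_bound[of n \<omega>] by (simp add: norm_mult)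
  have T_Suc: "T (Suc n) \<omega> = G \<omega> * iexp ((s * b ?t \<omega>) * e ?t \<omega>)" for \<omega>
  proof -
    have "iexp (s * S (Suc n) \<omega>) = iexp (s * S n \<omega>) * iexp ((s * b ?t \<omega>) * e ?t \<omega>)"
      unfolding exp_add[symmetric] by (simp add: S_def algebra_simps)
    then show ?thesis by (simp add: T_def G_def)
  qed
  have G_eq: "G \<omega> = T n \<omega> * of_real (exp ((s * b ?t \<omega>)\<^sup>2 / 2))" for \<omega>
  proof -
    have "exp (s\<^sup>2 / 2 * V (Suc n) \<omega>) = exp (s\<^sup>2 / 2 * V n \<omega>) * exp ((s * b ?t \<omega>)\<^sup>2 / 2)"
      unfolding exp_add[symmetric] by (simp add: V_def algebra_simps power_mult_distrib)
    then show ?thesis by (simp add: T_def G_def)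
  qed
  have int_G: "integrable M (\<lambda>\<omega>. G \<omega> * ?\<psi> (s * b ?t \<omega>))"
  proof (rule integrable_const_bound[of _ "exp (s\<^sup>2 * v / 2) * 1"])
    show "AE \<omega> in M. cmod (G \<omega> * ?\<psi> (s * b ?t \<omega>)) \<le> exp (s\<^sup>2 * v / 2) * 1"
      unfolding norm_mult by (intro AE_I2 mult_mono G_bound E.cmod_char_le_1) auto
    show "random_variable borel (\<lambda>\<omega>. G \<omega> * ?\<psi> (s * b ?t \<omega>))" by measurable
  qed
  have int_T: "integrable M (T n)"
    by (rule integrable_const_bound[of _ "exp (s\<^sup>2 * v / 2)"]) (use T_bound in auto)
  have "expectation (T (Suc n)) - expectation (T n)
      = expectation (\<lambda>\<omega>. G \<omega> * ?\<psi> (s * b ?t \<omega>)) - expectation (T n)"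
  proof -
    have "expectation (T (Suc n)) = expectation (\<lambda>\<omega>. G \<omega> * iexp ((s * b ?t \<omega>) * e ?t \<omega>))"
      by (rule Bochner_Integration.integral_cong[OF refl]) (rule T_Suc)
    also have "\<dots> = expectation (\<lambda>\<omega>. G \<omega> * ?\<psi> (s * b ?t \<omega>))"
      by (rule expectation_iexp_innovation[OF t GF]) (use G_bound bF in auto)
    finally show ?thesis by simp
  qed
  also have "\<dots> = expectation (\<lambda>\<omega>. G \<omega> * ?\<psi> (s * b ?t \<omega>) - T n \<omega>)"
    using int_G int_T by simp
  also have "cmod \<dots> \<le> expectation (\<lambda>\<omega>. cmod (G \<omega> * ?\<psi> (s * b ?t \<omega>) - T n \<omega>))"
    by (rule integral_norm_bound)
  also have "\<dots> \<le> expectation (\<lambda>\<omega>. exp (s\<^sup>2 * v / 2) * C * \<bar>b ?t \<omega>\<bar> ^ 3)"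
  proof (rule integral_mono)
    show "integrable M (\<lambda>\<omega>. cmod (G \<omega> * ?\<psi> (s * b ?t \<omega>) - T n \<omega>))" using int_G int_T by simp
    show "integrable M (\<lambda>\<omega>. exp (s\<^sup>2 * v / 2) * C * \<bar>b ?t \<omega>\<bar> ^ 3)" using b3[OF t] by simp
    fix \<omega>
    let ?x = "s * b ?t \<omega>"
    have "(b ?t \<omega>)\<^sup>2 \<le> V ?t \<omega>" unfolding V_def by (rule member_le_sum) auto
    then have "(b ?t \<omega>)\<^sup>2 \<le> v" using Vv[of ?t \<omega>] by simp
    then have "\<bar>b ?t \<omega>\<bar> \<le> sqrt v" by (simp add: real_le_rsqrt)
    then have x: "\<bar>?x\<bar> \<le> \<bar>s\<bar> * sqrt v" by (simp add: abs_mult mult_left_mono)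
    have "G \<omega> * ?\<psi> ?x - T n \<omega> = T n \<omega> * (of_real (exp (?x\<^sup>2 / 2)) * ?\<psi> ?x - 1)"
      unfolding G_eq by (simp add: algebra_simps)
    then have "cmod (G \<omega> * ?\<psi> ?x - T n \<omega>) = cmod (T n \<omega>) * cmod (of_real (exp (?x\<^sup>2 / 2)) * ?\<psi> ?x - 1)"
      by (simp only: norm_mult)
    also have "\<dots> \<le> exp (s\<^sup>2 * v / 2) * (exp ((\<bar>s\<bar> * sqrt v)\<^sup>2 / 2) * (K / 6 + \<bar>s\<bar> * sqrt v / 8) * \<bar>?x\<bar> ^ 3)"
      by (intro mult_mono T_bound char_normalised_bound e2 e3 mean var K t x) auto
    also have "\<dots> = exp (s\<^sup>2 * v / 2) * C * \<bar>b ?t \<omega>\<bar> ^ 3"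
      using v by (simp add: C_def power_mult_distrib abs_mult)
    finally show "cmod (G \<omega> * ?\<psi> ?x - T n \<omega>) \<le> exp (s\<^sup>2 * v / 2) * C * \<bar>b ?t \<omega>\<bar> ^ 3" .
  qed
  also have "\<dots> = exp (s\<^sup>2 * v) * ((K / 6 + \<bar>s\<bar> * sqrt v / 8) * \<bar>s\<bar> ^ 3) * expectation (\<lambda>\<omega>. \<bar>b ?t \<omega>\<bar> ^ 3)"
  proof -
    have "exp (s\<^sup>2 * v) = exp (s\<^sup>2 * v / 2) * exp (s\<^sup>2 * v / 2)" unfolding exp_add[symmetric] by simp
    then show ?thesis by (simp add: C_def)
  qed
  finally have "cmod (expectation (T (Suc n)) - expectation (T n))
    \<le> exp (s\<^sup>2 * v) * ((K / 6 + \<bar>s\<bar> * sqrt v / 8) * \<bar>s\<bar> ^ 3) * expectation (\<lambda>\<omega>. \<bar>b ?t \<omega>\<bar> ^ 3)" .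
  moreover have "cmod (expectation (T n) - 1)
    \<le> exp (s\<^sup>2 * v) * ((K / 6 + \<bar>s\<bar> * sqrt v / 8) * \<bar>s\<bar> ^ 3) * (\<Sum>t=1..n. expectation (\<lambda>\<omega>. \<bar>b t \<omega>\<bar> ^ 3))"
    using Suc unfolding T_def by simp
  ultimately have "cmod (expectation (T (Suc n)) - 1)
    \<le> exp (s\<^sup>2 * v) * ((K / 6 + \<bar>s\<bar> * sqrt v / 8) * \<bar>s\<bar> ^ 3) * expectation (\<lambda>\<omega>. \<bar>b ?t \<omega>\<bar> ^ 3)
    + exp (s\<^sup>2 * v) * ((K / 6 + \<bar>s\<bar> * sqrt v / 8) * \<bar>s\<bar> ^ 3) * (\<Sum>t=1..n. expectation (\<lambda>\<omega>. \<bar>b t \<omega>\<bar> ^ 3))"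
    using norm_triangle_mono by fastforce
  then show ?case unfolding T_def by (simp add: algebra_simps)
qed

text \<open>The truncated sum differs from the original one only where the sum of squares exceeds
  \<open>w + 1\<close>, an event on which the sum of squares is at distance more than \<open>1\<close> from \<open>w\<close>; elsewhere the
  exponential compensator \<open>exp (s\<^sup>2 V / 2)\<close> is compared with the constant \<open>exp (s\<^sup>2 w / 2)\<close>.\<close>

theorem martingale_clt_bound:
  fixes b :: "nat \<Rightarrow> 'a \<Rightarrow> real"
  assumes e2: "\<And>t. 1 \<le> t \<Longrightarrow> t \<le> N \<Longrightarrow> integrable M (\<lambda>\<omega>. (e t \<omega>)\<^sup>2)"
    and e3: "\<And>t. 1 \<le> t \<Longrightarrow> t \<le> N \<Longrightarrow> integrable M (\<lambda>\<omega>. \<bar>e t \<omega>\<bar> ^ 3)"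
    and mean: "\<And>t. 1 \<le> t \<Longrightarrow> t \<le> N \<Longrightarrow> expectation (e t) = 0"
    and var: "\<And>t. 1 \<le> t \<Longrightarrow> t \<le> N \<Longrightarrow> expectation (\<lambda>\<omega>. (e t \<omega>)\<^sup>2) = 1"
    and K: "\<And>t. 1 \<le> t \<Longrightarrow> t \<le> N \<Longrightarrow> expectation (\<lambda>\<omega>. \<bar>e t \<omega>\<bar> ^ 3) \<le> K" and K_nonneg: "0 \<le> K"
    and b: "\<And>t. 1 \<le> t \<Longrightarrow> t \<le> N \<Longrightarrow> b t \<in> borel_measurable (F (t - 1))"
    and b2: "\<And>t. 1 \<le> t \<Longrightarrow> t \<le> N \<Longrightarrow> integrable M (\<lambda>\<omega>. (b t \<omega>)\<^sup>2)"
    and b3: "\<And>t. 1 \<le> t \<Longrightarrow> t \<le> N \<Longrightarrow> integrable M (\<lambda>\<omega>. \<bar>b t \<omega>\<bar> ^ 3)"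
    and w: "w \<ge> 0"
  shows "cmod (expectation (\<lambda>\<omega>. iexp (s * (\<Sum>t=1..N. b t \<omega> * e t \<omega>))) - of_real (exp (- (s\<^sup>2 * w / 2))))
     \<le> clt_const s w K *
        ((\<Sum>t=1..N. expectation (\<lambda>\<omega>. \<bar>b t \<omega>\<bar> ^ 3)) + expectation (\<lambda>\<omega>. \<bar>(\<Sum>t=1..N. (b t \<omega>)\<^sup>2) - w\<bar>))"
proof -
  define v where "v = w + 1"
  have v: "0 \<le> v" using w by (simp add: v_def)
  define b' where "b' = truncate_coeff v b"
  define S where "S = (\<lambda>\<omega>. \<Sum>t=1..N. b t \<omega> * e t \<omega>)"
  define V where "V = (\<lambda>\<omega>. \<Sum>t=1..N. (b t \<omega>)\<^sup>2)"
  define S' where "S' = (\<lambda>\<omega>. \<Sum>t=1..N. b' t \<omega> * e t \<omega>)"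
  define V' where "V' = (\<lambda>\<omega>. \<Sum>t=1..N. (b' t \<omega>)\<^sup>2)"
  define T where "T = (\<lambda>\<omega>. iexp (s * S' \<omega>) * of_real (exp (s\<^sup>2 / 2 * V' \<omega>)))"
  define C where "C = (K / 6 + \<bar>s\<bar> * sqrt v / 8) * \<bar>s\<bar> ^ 3"
  define c where "c = exp (- (s\<^sup>2 * w / 2))"
  have c: "0 < c" "c \<le> 1" using w by (simp_all add: c_def)
  have C: "0 \<le> C" using K_nonneg v by (simp add: C_def)
  have b'F: "b' t \<in> borel_measurable (F (t - 1))" if t: "1 \<le> t" "t \<le> N" for t
  proof -
    have [measurable]: "b i \<in> borel_measurable (F (t - 1))" if "i \<in> {1..t}" for i
      using measurable_F_mono[OF b[of i], of "t - 1"] that t by auto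
    then have "(\<lambda>\<omega>. \<Sum>i=1..t. (b i \<omega>)\<^sup>2) \<in> borel_measurable (F (t - 1))"
      by (intro borel_measurable_sum) simp
    moreover have "b t \<in> borel_measurable (F (t - 1))" by (rule b[OF t])
    ultimately show ?thesis unfolding b'_def truncate_coeff_def[abs_def] by measurable
  qed
  have mb: "random_variable borel (b t)" if "1 \<le> t" "t \<le> N" for t
    using measurable_F_M[OF b[OF that]] that by simp
  have mb': "random_variable borel (b' t)" if "1 \<le> t" "t \<le> N" for t
    using measurable_F_M[OF b'F[OF that]] that by simp
  have me: "random_variable borel (e t)" if "1 \<le> t" "t \<le> N" for t
    using measurable_F_M[OF e_adapted[OF that]] that by simp
  have [measurable]: "random_variable borel S" "random_variable borel V" "random_variable borel S'" "random_variable borel V'"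
    unfolding S_def V_def S'_def V'_def using mb mb' me by (auto intro!: borel_measurable_sum)
  have b'3: "integrable M (\<lambda>\<omega>. \<bar>b' t \<omega>\<bar> ^ 3)" and b'3_le: "expectation (\<lambda>\<omega>. \<bar>b' t \<omega>\<bar> ^ 3) \<le> expectation (\<lambda>\<omega>. \<bar>b t \<omega>\<bar> ^ 3)"
    if t: "1 \<le> t" "t \<le> N" for t
  proof -
    have le: "\<bar>b' t \<omega>\<bar> ^ 3 \<le> \<bar>b t \<omega>\<bar> ^ 3" for \<omega>
      unfolding b'_def by (intro power_mono abs_truncate_coeff_le) simp
    show "integrable M (\<lambda>\<omega>. \<bar>b' t \<omega>\<bar> ^ 3)"
      by (rule Bochner_Integration.integrable_bound[OF b3[OF t]]) (use le mb'[OF t] in auto)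
    then show "expectation (\<lambda>\<omega>. \<bar>b' t \<omega>\<bar> ^ 3) \<le> expectation (\<lambda>\<omega>. \<bar>b t \<omega>\<bar> ^ 3)"
      using b3[OF t] le by (intro integral_mono) auto
  qed
  have V'_le: "V' \<omega> \<le> v" for \<omega> unfolding V'_def b'_def by (rule truncate_coeff_sum_le(1)[OF v])
  have "cmod (expectation T - 1) \<le> exp (s\<^sup>2 * v) * C * (\<Sum>t=1..N. expectation (\<lambda>\<omega>. \<bar>b' t \<omega>\<bar> ^ 3))"
    unfolding T_def S'_def V'_def C_def
    by (rule martingale_exponential_bound) (use e2 e3 mean var K b'F b'3 v truncate_coeff_sum_le(1)[OF v] in \<open>auto simp: b'_def\<close>)
  also have "\<dots> \<le> exp (s\<^sup>2 * v) * C * (\<Sum>t=1..N. expectation (\<lambda>\<omega>. \<bar>b t \<omega>\<bar> ^ 3))"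
    using C b'3_le by (intro mult_left_mono sum_mono) auto
  finally have ET: "cmod (expectation T - 1) \<le> exp (s\<^sup>2 * v) * C * (\<Sum>t=1..N. expectation (\<lambda>\<omega>. \<bar>b t \<omega>\<bar> ^ 3))" .
  have T_bound: "c * cmod (T \<omega>) \<le> exp (s\<^sup>2 * v)" for \<omega>
  proof -
    have "s\<^sup>2 * V' \<omega> \<le> s\<^sup>2 * v" "0 \<le> s\<^sup>2 * v" "0 \<le> s\<^sup>2 * w"
      using V'_le[of \<omega>] v w by (auto intro: mult_left_mono)
    then have "exp (- (s\<^sup>2 * w / 2)) * exp (s\<^sup>2 / 2 * V' \<omega>) \<le> exp (s\<^sup>2 * v)"
      unfolding exp_add[symmetric] by simp
    then show ?thesis by (simp add: T_def c_def norm_mult)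
  qed
  have pointwise: "cmod (iexp (s * S \<omega>) - of_real c * T \<omega>) \<le> exp (s\<^sup>2 * v) * (2 + s\<^sup>2 / 2) * \<bar>V \<omega> - w\<bar>" for \<omega>
  proof (cases "V \<omega> \<le> v")
    case True
    have "b' t \<omega> = b t \<omega>" if "t \<le> N" for t
      unfolding b'_def by (rule truncate_coeff_eq[OF _ that]) (use True in \<open>simp add: V_def\<close>)
    then have eq: "S' \<omega> = S \<omega>" "V' \<omega> = V \<omega>" by (simp_all add: S_def S'_def V_def V'_def)
    let ?a = "s\<^sup>2 / 2 * (V \<omega> - w)"
    have "c * exp (s\<^sup>2 / 2 * V \<omega>) = exp ?a"
      unfolding c_def exp_add[symmetric] by (simp add: algebra_simps)
    then have "of_real c * T \<omega> = iexp (s * S \<omega>) * of_real (exp ?a)"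
      unfolding T_def eq by (simp add: mult_ac flip: of_real_mult)
    then have "iexp (s * S \<omega>) - of_real c * T \<omega> = iexp (s * S \<omega>) * of_real (1 - exp ?a)"
      by (simp add: algebra_simps)
    then have "cmod (iexp (s * S \<omega>) - of_real c * T \<omega>) = \<bar>1 - exp ?a\<bar>"
      by (simp only: norm_mult norm_exp_i_times norm_of_real) simp
    also have "\<dots> \<le> \<bar>?a\<bar> * exp \<bar>?a\<bar>"
      using abs_exp_minus_one_le[of ?a] by (simp only: abs_minus_commute)
    also have "\<dots> \<le> \<bar>?a\<bar> * exp (s\<^sup>2 * v)"
    proof -
      have "0 \<le> V \<omega>" unfolding V_def by (intro sum_nonneg) simp
      then have "\<bar>V \<omega> - w\<bar> \<le> v" using True w by (simp add: v_def)
      then have "s\<^sup>2 / 2 * \<bar>V \<omega> - w\<bar> \<le> s\<^sup>2 * v" by (intro mult_mono) auto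
      then show ?thesis by (intro mult_left_mono) (auto simp: abs_mult)
    qed
    also have "\<dots> = exp (s\<^sup>2 * v) * (s\<^sup>2 / 2) * \<bar>V \<omega> - w\<bar>" by (simp add: abs_mult)
    also have "\<dots> \<le> exp (s\<^sup>2 * v) * (2 + s\<^sup>2 / 2) * \<bar>V \<omega> - w\<bar>"
      by (intro mult_right_mono mult_left_mono) auto
    finally show ?thesis .
  next
    case False
    then have far: "1 \<le> \<bar>V \<omega> - w\<bar>" by (simp add: v_def)
    have "cmod (iexp (s * S \<omega>) - of_real c * T \<omega>) \<le> cmod (iexp (s * S \<omega>)) + cmod (of_real c * T \<omega>)"
      by (rule norm_triangle_ineq4)
    also have "\<dots> = 1 + c * cmod (T \<omega>)" using c by (simp add: norm_mult)
    also have "\<dots> \<le> exp (s\<^sup>2 * v) * 2"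
    proof -
      have "1 \<le> exp (s\<^sup>2 * v)" using v by simp
      then show ?thesis using T_bound[of \<omega>] by linarith
    qed
    also have "\<dots> \<le> exp (s\<^sup>2 * v) * (2 + s\<^sup>2 / 2) * 1" by simp
    also have "\<dots> \<le> exp (s\<^sup>2 * v) * (2 + s\<^sup>2 / 2) * \<bar>V \<omega> - w\<bar>"
      using far by (intro mult_left_mono) (auto intro: add_nonneg_nonneg)
    finally show ?thesis .
  qed
  have int_S: "integrable M (\<lambda>\<omega>. iexp (s * S \<omega>))" by (rule integrable_iexp) auto
  have int_T: "integrable M (\<lambda>\<omega>. of_real c * T \<omega>)"
    by (rule integrable_const_bound[of _ "exp (s\<^sup>2 * v)"])
      (use T_bound c in \<open>auto simp: norm_mult T_def\<close>)
  have int_T1: "integrable M T"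
    using integrable_mult_right[OF int_T, of "of_real (1 / c)"] c by (simp add: mult.assoc[symmetric] flip: of_real_mult)
  have int_V: "integrable M V" unfolding V_def using b2 by (intro Bochner_Integration.integrable_sum) auto
  have "expectation (\<lambda>\<omega>. iexp (s * S \<omega>)) - of_real c
      = expectation (\<lambda>\<omega>. iexp (s * S \<omega>) - of_real c * T \<omega>) + of_real c * (expectation T - 1)"
    using int_S int_T int_T1 by (simp add: algebra_simps)
  also have "cmod \<dots> \<le> cmod (expectation (\<lambda>\<omega>. iexp (s * S \<omega>) - of_real c * T \<omega>)) + cmod (of_real c * (expectation T - 1))"
    by (rule norm_triangle_ineq)
  also have "\<dots> \<le> exp (s\<^sup>2 * v) * (2 + s\<^sup>2 / 2) * expectation (\<lambda>\<omega>. \<bar>V \<omega> - w\<bar>)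
      + exp (s\<^sup>2 * v) * C * (\<Sum>t=1..N. expectation (\<lambda>\<omega>. \<bar>b t \<omega>\<bar> ^ 3))"
  proof (intro add_mono)
    have "cmod (expectation (\<lambda>\<omega>. iexp (s * S \<omega>) - of_real c * T \<omega>))
        \<le> expectation (\<lambda>\<omega>. cmod (iexp (s * S \<omega>) - of_real c * T \<omega>))"
      by (rule integral_norm_bound)
    also have "\<dots> \<le> expectation (\<lambda>\<omega>. exp (s\<^sup>2 * v) * (2 + s\<^sup>2 / 2) * \<bar>V \<omega> - w\<bar>)"
      using int_S int_T int_V pointwise by (intro integral_mono) auto
    finally show "cmod (expectation (\<lambda>\<omega>. iexp (s * S \<omega>) - of_real c * T \<omega>))
        \<le> exp (s\<^sup>2 * v) * (2 + s\<^sup>2 / 2) * expectation (\<lambda>\<omega>. \<bar>V \<omega> - w\<bar>)" by simp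
    have "cmod (of_real c * (expectation T - 1)) = c * cmod (expectation T - 1)"
      using c by (simp add: norm_mult)
    also have "\<dots> \<le> 1 * cmod (expectation T - 1)" using c by (intro mult_right_mono) auto
    finally show "cmod (of_real c * (expectation T - 1)) \<le> exp (s\<^sup>2 * v) * C * (\<Sum>t=1..N. expectation (\<lambda>\<omega>. \<bar>b t \<omega>\<bar> ^ 3))"
      using ET by simp
  qed
  also have "\<dots> \<le> exp (s\<^sup>2 * v) * (C + 2 + s\<^sup>2 / 2) * expectation (\<lambda>\<omega>. \<bar>V \<omega> - w\<bar>)
      + exp (s\<^sup>2 * v) * (C + 2 + s\<^sup>2 / 2) * (\<Sum>t=1..N. expectation (\<lambda>\<omega>. \<bar>b t \<omega>\<bar> ^ 3))"
    using C by (intro add_mono mult_right_mono mult_left_mono sum_nonneg) auto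
  also have "\<dots> = clt_const s w K * ((\<Sum>t=1..N. expectation (\<lambda>\<omega>. \<bar>b t \<omega>\<bar> ^ 3)) + expectation (\<lambda>\<omega>. \<bar>V \<omega> - w\<bar>))"
    by (simp add: clt_const_def v_def C_def distrib_left)
  finally show ?thesis by (simp add: S_def V_def c_def)
qed

end

section \<open>Filtering a weakly dependent sequence\<close>

lemma (in prob_space) integrable_mult_of_squares:
  fixes X Y :: "'a \<Rightarrow> real"
  assumes [measurable]: "random_variable borel X" "random_variable borel Y"
    and "integrable M (\<lambda>\<omega>. (X \<omega>)\<^sup>2)" "integrable M (\<lambda>\<omega>. (Y \<omega>)\<^sup>2)"
  shows "integrable M (\<lambda>\<omega>. X \<omega> * Y \<omega>)"
proof (rule Bochner_Integration.integrable_bound)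
  show "integrable M (\<lambda>\<omega>. (X \<omega>)\<^sup>2 + (Y \<omega>)\<^sup>2)" using assms by simp
  have "\<bar>x * y\<bar> \<le> x\<^sup>2 + y\<^sup>2" for x y :: real
  proof -
    have "2 * \<bar>x\<bar> * \<bar>y\<bar> \<le> x\<^sup>2 + y\<^sup>2" "0 \<le> \<bar>x\<bar> * \<bar>y\<bar>"
      using sum_squares_bound[of "\<bar>x\<bar>" "\<bar>y\<bar>"] by simp_all
    then show ?thesis unfolding abs_mult by linarith
  qed
  then show "AE \<omega> in M. norm (X \<omega> * Y \<omega>) \<le> norm ((X \<omega>)\<^sup>2 + (Y \<omega>)\<^sup>2)" by simp
qed measurable

text \<open>Exponential smoothing of a sequence; with \<open>\<theta> = 1\<close> it is the sequence of partial sums.\<close>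

definition exp_filter :: "real \<Rightarrow> (nat \<Rightarrow> 'a \<Rightarrow> real) \<Rightarrow> nat \<Rightarrow> 'a \<Rightarrow> real" where
  "exp_filter \<theta> D t \<omega> = (\<Sum>i=1..t. \<theta> ^ (t - i) * D i \<omega>)"

lemma exp_filter_0: "exp_filter \<theta> D 0 \<omega> = 0"
  by (simp add: exp_filter_def)

lemma exp_filter_Suc: "exp_filter \<theta> D (Suc t) \<omega> = \<theta> * exp_filter \<theta> D t \<omega> + D (Suc t) \<omega>"
proof -
  have "(\<Sum>i=1..t. \<theta> ^ (Suc t - i) * D i \<omega>) = (\<Sum>i=1..t. \<theta> * (\<theta> ^ (t - i) * D i \<omega>))"
    by (rule sum.cong) (auto simp: Suc_diff_le)
  then show ?thesis by (simp add: exp_filter_def sum_distrib_left)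
qed

text \<open>Squaring the recursion \<open>A (t + 1) = \<theta> A t + D (t + 1)\<close> bounds the second moment of the filter
  by a recursion with the same factor, since \<open>D (t + 1)\<close> is nearly orthogonal to \<open>A t\<close>.\<close>

lemma (in prob_space)
  assumes D: "\<And>t. 1 \<le> t \<Longrightarrow> t \<le> N \<Longrightarrow> random_variable borel (D t)"
    and D2: "\<And>t. 1 \<le> t \<Longrightarrow> t \<le> N \<Longrightarrow> integrable M (\<lambda>\<omega>. (D t \<omega> :: real)\<^sup>2)"
    and cov: "\<And>s t. 1 \<le> s \<Longrightarrow> s \<le> t \<Longrightarrow> t \<le> N \<Longrightarrow> \<bar>expectation (\<lambda>\<omega>. D s \<omega> * D t \<omega>)\<bar> \<le> C * q ^ (t - s)"
    and q: "0 \<le> q" "q < 1" and \<theta>: "0 \<le> \<theta>" "\<theta> \<le> 1" and C: "0 \<le> C"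
    and t: "t \<le> N"
  shows exp_filter_measurable: "random_variable borel (exp_filter \<theta> D t)"
    and exp_filter_square_integrable: "integrable M (\<lambda>\<omega>. (exp_filter \<theta> D t \<omega>)\<^sup>2)"
    and exp_filter_square_le: "expectation (\<lambda>\<omega>. (exp_filter \<theta> D t \<omega>)\<^sup>2) \<le> 3 * C / (1 - q) * (\<Sum>i<t. \<theta> ^ i)"
proof -
  let ?A = "exp_filter \<theta> D"
  have meas: "random_variable borel (?A t)" if "t \<le> N" for t
    unfolding exp_filter_def[abs_def] using D that by (auto intro!: borel_measurable_sum)
  have sq: "integrable M (\<lambda>\<omega>. (?A t \<omega>)\<^sup>2)" if "t \<le> N" for t
  proof -
    have "integrable M (\<lambda>\<omega>. \<Sum>i=1..t. \<Sum>j=1..t. \<theta> ^ (t - i) * \<theta> ^ (t - j) * (D i \<omega> * D j \<omega>))"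
      using D D2 that by (intro Bochner_Integration.integrable_sum integrable_mult_right integrable_mult_of_squares) auto
    then show ?thesis
      by (simp add: exp_filter_def power2_eq_square sum_product mult_ac)
  qed
  have past: "\<bar>expectation (\<lambda>\<omega>. ?A t \<omega> * D (Suc t) \<omega>)\<bar> \<le> C / (1 - q)" if "Suc t \<le> N" for t
  proof -
    have DD: "integrable M (\<lambda>\<omega>. D i \<omega> * D (Suc t) \<omega>)" if "i \<in> {1..t}" for i
      using D D2 that \<open>Suc t \<le> N\<close> by (intro integrable_mult_of_squares) auto
    have "expectation (\<lambda>\<omega>. ?A t \<omega> * D (Suc t) \<omega>) = expectation (\<lambda>\<omega>. \<Sum>i=1..t. \<theta> ^ (t - i) * (D i \<omega> * D (Suc t) \<omega>))"
      by (simp only: exp_filter_def sum_distrib_right mult.assoc)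
    also have "\<dots> = (\<Sum>i=1..t. \<theta> ^ (t - i) * expectation (\<lambda>\<omega>. D i \<omega> * D (Suc t) \<omega>))"
      using DD by (subst Bochner_Integration.integral_sum) auto
    also have "\<bar>\<dots>\<bar> \<le> (\<Sum>i=1..t. \<bar>\<theta> ^ (t - i) * expectation (\<lambda>\<omega>. D i \<omega> * D (Suc t) \<omega>)\<bar>)"
      by (rule sum_abs)
    also have "\<dots> \<le> (\<Sum>i=1..t. 1 * (C * q ^ (Suc t - i)))"
    proof (rule sum_mono)
      fix i assume i: "i \<in> {1..t}"
      show "\<bar>\<theta> ^ (t - i) * expectation (\<lambda>\<omega>. D i \<omega> * D (Suc t) \<omega>)\<bar> \<le> 1 * (C * q ^ (Suc t - i))"
        unfolding abs_mult using i \<theta> that cov[of i "Suc t"]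
        by (intro mult_mono) (auto intro: power_le_one)
    qed
    also have "\<dots> = C * (\<Sum>i=1..t. q ^ (Suc t - i))" by (simp add: sum_distrib_left)
    also have "(\<Sum>i=1..t. q ^ (Suc t - i)) = (\<Sum>i=1..t. q ^ i)"
      by (rule sum.reindex_bij_witness[of _ "\<lambda>i. Suc t - i" "\<lambda>i. Suc t - i"]) auto
    also have "\<dots> \<le> (\<Sum>i<Suc t. q ^ i)" using q by (intro sum_mono2) auto
    also have "\<dots> = (1 - q ^ Suc t) / (1 - q)" using q by (subst sum_gp_strict) auto
    also have "\<dots> \<le> 1 / (1 - q)" using q by (intro divide_right_mono) auto
    finally show ?thesis using C by (simp add: mult_left_mono)
  qed
  have diag: "expectation (\<lambda>\<omega>. (D t \<omega>)\<^sup>2) \<le> C / (1 - q)" if "1 \<le> t" "t \<le> N" for t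
  proof -
    have "expectation (\<lambda>\<omega>. (D t \<omega>)\<^sup>2) \<le> C" using cov[of t t] that by (simp add: power2_eq_square)
    also have "C \<le> C / (1 - q)" using q C by (simp add: field_simps mult_left_le)
    finally show ?thesis .
  qed
  have "expectation (\<lambda>\<omega>. (?A t \<omega>)\<^sup>2) \<le> 3 * C / (1 - q) * (\<Sum>i<t. \<theta> ^ i)" if "t \<le> N" for t
    using that
  proof (induction t)
    case 0
    show ?case by (simp add: exp_filter_0)
  next
    case (Suc t)
    have "expectation (\<lambda>\<omega>. (?A (Suc t) \<omega>)\<^sup>2)
        = expectation (\<lambda>\<omega>. \<theta>\<^sup>2 * (?A t \<omega>)\<^sup>2 + 2 * \<theta> * (?A t \<omega> * D (Suc t) \<omega>) + (D (Suc t) \<omega>)\<^sup>2)"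
      by (simp add: exp_filter_Suc power2_eq_square algebra_simps)
    also have "\<dots> = \<theta>\<^sup>2 * expectation (\<lambda>\<omega>. (?A t \<omega>)\<^sup>2) + 2 * \<theta> * expectation (\<lambda>\<omega>. ?A t \<omega> * D (Suc t) \<omega>)
        + expectation (\<lambda>\<omega>. (D (Suc t) \<omega>)\<^sup>2)"
      using Suc.prems sq[of t] D2[of "Suc t"] integrable_mult_of_squares[OF meas[of t] D[of "Suc t"]] by simp
    also have "\<dots> \<le> \<theta> * (3 * C / (1 - q) * (\<Sum>i<t. \<theta> ^ i)) + 2 * 1 * (C / (1 - q)) + C / (1 - q)"
    proof (intro add_mono)
      have "\<theta>\<^sup>2 * expectation (\<lambda>\<omega>. (?A t \<omega>)\<^sup>2) \<le> \<theta> * expectation (\<lambda>\<omega>. (?A t \<omega>)\<^sup>2)"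
        using \<theta> by (intro mult_right_mono) (auto simp: power2_eq_square mult_left_le)
      also have "\<dots> \<le> \<theta> * (3 * C / (1 - q) * (\<Sum>i<t. \<theta> ^ i))"
        using Suc \<theta> by (intro mult_left_mono) auto
      finally show "\<theta>\<^sup>2 * expectation (\<lambda>\<omega>. (?A t \<omega>)\<^sup>2) \<le> \<theta> * (3 * C / (1 - q) * (\<Sum>i<t. \<theta> ^ i))" .
      have "2 * \<theta> * expectation (\<lambda>\<omega>. ?A t \<omega> * D (Suc t) \<omega>) \<le> 2 * \<theta> * (C / (1 - q))"
        using past[OF Suc.prems] \<theta> by (intro mult_left_mono) auto
      also have "\<dots> \<le> 2 * 1 * (C / (1 - q))"
        using \<theta> C q by (intro mult_right_mono mult_left_mono) auto
      finally show "2 * \<theta> * expectation (\<lambda>\<omega>. ?A t \<omega> * D (Suc t) \<omega>) \<le> 2 * 1 * (C / (1 - q))" .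
    qed (use diag Suc.prems in auto)
    also have "\<dots> = 3 * C / (1 - q) * (1 + \<theta> * (\<Sum>i<t. \<theta> ^ i))"
      by (simp add: algebra_simps add_divide_distrib)
    also have "1 + \<theta> * (\<Sum>i<t. \<theta> ^ i) = (\<Sum>i<Suc t. \<theta> ^ i)"
      unfolding sum.lessThan_Suc_shift by (simp add: sum_distrib_left)
    finally show ?case .
  qed
  with meas sq t show "random_variable borel (?A t)" "integrable M (\<lambda>\<omega>. (?A t \<omega>)\<^sup>2)"
    "expectation (\<lambda>\<omega>. (?A t \<omega>)\<^sup>2) \<le> 3 * C / (1 - q) * (\<Sum>i<t. \<theta> ^ i)"
    by auto
qed

section \<open>The information structure of the model\<close>

lemma sets_vimage_algebra_subset:
  assumes "f \<in> measurable A B" and "space A = \<Omega>"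
  shows "sets (vimage_algebra \<Omega> f B) \<subseteq> sets A"
proof -
  have "{f -` X \<inter> \<Omega> |X. X \<in> sets B} \<subseteq> sets A"
    using measurable_sets[OF assms(1)] assms(2) by auto
  from sets.sigma_sets_subset[OF this] show ?thesis
    by (simp add: sets_vimage_algebra assms(2))
qed

lemma (in prob_space) indep_var_prob_inter:
  assumes "indep_var S X T Y" "a \<in> sets (vimage_algebra (space M) X S)" "b \<in> sets (vimage_algebra (space M) Y T)"
  shows "prob (a \<inter> b) = prob a * prob b"
  using assms unfolding indep_var_eq indep_sets2_eq sets_vimage_algebra by blast

context ar_stochastic_volatility
begin

lemma eps_measurable: "1 \<le> t \<Longrightarrow> random_variable borel (eps t)"
  using eps_indep unfolding indep_vars_def by simp

lemma eta_measurable: "1 \<le> t \<Longrightarrow> random_variable borel (eta t)"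
  using eta_indep unfolding indep_vars_def by simp

text \<open>The past up to time \<open>t\<close> contains the whole sequence \<open>eta\<close>: given that sequence, the
  volatilities are constants, and the only randomness left comes from the innovations \<open>eps\<close>.\<close>

definition past_generator :: "nat \<Rightarrow> nat \<Rightarrow> 'a set set" where
  "past_generator n t = {a \<inter> b \<inter> c | a b c.
      a \<in> sets (vimage_algebra (space M) (y n 0) borel) \<and>
      b \<in> sets (vimage_algebra (space M) (\<lambda>\<omega>. \<lambda>s\<in>{1..t}. eps s \<omega>) (Pi\<^sub>M {1..t} (\<lambda>_. borel))) \<and>
      c \<in> sets (vimage_algebra (space M) (\<lambda>\<omega>. \<lambda>s\<in>{1..}. eta s \<omega>) (Pi\<^sub>M {1..} (\<lambda>_. borel)))}"

definition past :: "nat \<Rightarrow> nat \<Rightarrow> 'a measure" where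
  "past n t = sigma (space M) (past_generator n t)"

lemma past_generator_subset: "past_generator n t \<subseteq> Pow (space M)"
  unfolding past_generator_def using sets.sets_into_space by fastforce

lemma space_past [simp]: "space (past n t) = space M"
  by (simp add: past_def space_measure_of[OF past_generator_subset])

lemma sets_past: "sets (past n t) = sigma_sets (space M) (past_generator n t)"
  by (simp add: past_def past_generator_subset)

lemma Int_stable_past_generator: "Int_stable (past_generator n t)"
proof (rule Int_stableI)
  fix x x' assume "x \<in> past_generator n t" "x' \<in> past_generator n t"
  then obtain a b c a' b' c' where *: "x = a \<inter> b \<inter> c" "x' = a' \<inter> b' \<inter> c'"
    "a \<in> sets (vimage_algebra (space M) (y n 0) borel)" "a' \<in> sets (vimage_algebra (space M) (y n 0) borel)"
    "b \<in> sets (vimage_algebra (space M) (\<lambda>\<omega>. \<lambda>s\<in>{1..t}. eps s \<omega>) (Pi\<^sub>M {1..t} (\<lambda>_. borel)))"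
    "b' \<in> sets (vimage_algebra (space M) (\<lambda>\<omega>. \<lambda>s\<in>{1..t}. eps s \<omega>) (Pi\<^sub>M {1..t} (\<lambda>_. borel)))"
    "c \<in> sets (vimage_algebra (space M) (\<lambda>\<omega>. \<lambda>s\<in>{1..}. eta s \<omega>) (Pi\<^sub>M {1..} (\<lambda>_. borel)))"
    "c' \<in> sets (vimage_algebra (space M) (\<lambda>\<omega>. \<lambda>s\<in>{1..}. eta s \<omega>) (Pi\<^sub>M {1..} (\<lambda>_. borel)))"
    unfolding past_generator_def by blast
  have "x \<inter> x' = (a \<inter> a') \<inter> (b \<inter> b') \<inter> (c \<inter> c')" using * by auto
  moreover have "a \<inter> a' \<in> sets (vimage_algebra (space M) (y n 0) borel)"
    "b \<inter> b' \<in> sets (vimage_algebra (space M) (\<lambda>\<omega>. \<lambda>s\<in>{1..t}. eps s \<omega>) (Pi\<^sub>M {1..t} (\<lambda>_. borel)))"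
    "c \<inter> c' \<in> sets (vimage_algebra (space M) (\<lambda>\<omega>. \<lambda>s\<in>{1..}. eta s \<omega>) (Pi\<^sub>M {1..} (\<lambda>_. borel)))"
    using * by (blast intro: sets.Int)+
  ultimately show "x \<inter> x' \<in> past_generator n t" unfolding past_generator_def by blast
qed

text \<open>The next innovation is split off from the past by the three independence assumptions in turn:
  first the initial value from all innovations, then \<open>eps\<close> from \<open>eta\<close>, then \<open>eps (t + 1)\<close> from \<open>eps 1\<close> to \<open>eps t\<close>.\<close>

lemma
  assumes a: "a \<in> sets (vimage_algebra (space M) (y n 0) borel)"
    and b: "b \<in> sets (vimage_algebra (space M) (\<lambda>\<omega>. \<lambda>s\<in>{1..t}. eps s \<omega>) (Pi\<^sub>M {1..t} (\<lambda>_. borel)))"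
    and c: "c \<in> sets (vimage_algebra (space M) (\<lambda>\<omega>. \<lambda>s\<in>{1..}. eta s \<omega>) (Pi\<^sub>M {1..} (\<lambda>_. borel)))"
    and e: "e \<in> sets (vimage_algebra (space M) (eps (Suc t)) borel)" and n: "1 \<le> n"
  shows prob_past_generator_events: "a \<inter> b \<inter> c \<in> events" "e \<in> events"
    and prob_past_generator_inter: "prob ((a \<inter> b \<inter> c) \<inter> e) = prob (a \<inter> b \<inter> c) * prob e"
proof -
  let ?V = "\<lambda>f S. vimage_algebra (space M) f S"
  let ?all = "?V (\<lambda>\<omega>. \<lambda>t\<in>{1..}. (eps t \<omega>, eta t \<omega>)) (Pi\<^sub>M {1..} (\<lambda>_. borel \<Otimes>\<^sub>M borel))"
  let ?eps = "?V (\<lambda>\<omega>. \<lambda>t\<in>{1..}. eps t \<omega>) (Pi\<^sub>M {1..} (\<lambda>_. borel))"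
  have all_seq: "(\<lambda>\<omega>. \<lambda>t\<in>{1..}. (eps t \<omega>, eta t \<omega>)) \<in> measurable ?all (Pi\<^sub>M {1..} (\<lambda>_. borel \<Otimes>\<^sub>M borel))"
    using eps_measurable eta_measurable by (intro measurable_vimage_algebra1) (auto simp: space_PiM space_pair_measure)
  have pair: "(\<lambda>\<omega>. (eps s \<omega>, eta s \<omega>)) \<in> measurable ?all (borel \<Otimes>\<^sub>M borel)" if "1 \<le> s" for s
    using measurable_compose[OF all_seq measurable_component_singleton[of s "{1..}"]] that by simp
  have eps_all: "eps s \<in> borel_measurable ?all" and eta_all: "eta s \<in> borel_measurable ?all" if "1 \<le> s" for s
    using measurable_compose[OF pair[OF that] measurable_fst] measurable_compose[OF pair[OF that] measurable_snd] by simp_all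
  have eps_seq: "(\<lambda>\<omega>. \<lambda>t\<in>{1..}. eps t \<omega>) \<in> measurable ?eps (Pi\<^sub>M {1..} (\<lambda>_. borel))"
    by (intro measurable_vimage_algebra1) (auto simp: space_PiM)
  have eps_eps: "eps s \<in> borel_measurable ?eps" if "1 \<le> s" for s
    using measurable_compose[OF eps_seq measurable_component_singleton[of s "{1..}"]] that by simp
  have b_all: "b \<in> sets ?all"
    using b sets_vimage_algebra_subset[of "\<lambda>\<omega>. \<lambda>s\<in>{1..t}. eps s \<omega>" ?all "Pi\<^sub>M {1..t} (\<lambda>_. borel)" "space M"]
      measurable_restrict[of "{1..t}" eps ?all "\<lambda>_. borel"] eps_all by auto
  have c_all: "c \<in> sets ?all"
    using c sets_vimage_algebra_subset[of "\<lambda>\<omega>. \<lambda>s\<in>{1..}. eta s \<omega>" ?all "Pi\<^sub>M {1..} (\<lambda>_. borel)" "space M"]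
      measurable_restrict[of "{1..}" eta ?all "\<lambda>_. borel"] eta_all by auto
  have e_all: "e \<in> sets ?all"
    using e sets_vimage_algebra_subset[OF eps_all[of "Suc t"]] by auto
  have b_eps: "b \<in> sets ?eps"
    using b sets_vimage_algebra_subset[of "\<lambda>\<omega>. \<lambda>s\<in>{1..t}. eps s \<omega>" ?eps "Pi\<^sub>M {1..t} (\<lambda>_. borel)" "space M"]
      measurable_restrict[of "{1..t}" eps ?eps "\<lambda>_. borel"] eps_eps by auto
  have e_eps: "e \<in> sets ?eps"
    using e sets_vimage_algebra_subset[OF eps_eps[of "Suc t"]] by auto
  have y0_all: "prob (a \<inter> z) = prob a * prob z" if "z \<in> sets ?all" for z
    using indep_setD[OF y0_indep[OF n] a that] .
  have all_events: "sets ?all \<subseteq> events" and "sets (?V (y n 0) borel) \<subseteq> events"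
    using y0_indep[OF n] unfolding indep_sets2_eq by blast+
  then show "a \<inter> b \<inter> c \<in> events" "e \<in> events" using a b_all c_all e_all by auto
  have "b \<inter> e \<in> sets ?eps" using b_eps e_eps by blast
  then have eps_eta: "prob ((b \<inter> e) \<inter> c) = prob (b \<inter> e) * prob c" "prob (b \<inter> c) = prob b * prob c"
    using indep_var_prob_inter[OF eps_eta_indep _ c] b_eps by auto
  have "prob (b \<inter> e) = prob b * prob e"
  proof (rule indep_var_prob_inter[OF indep_var_restrict[OF eps_indep, of "{1..t}" "{Suc t}"]])
    let ?S = "?V (\<lambda>\<omega>. \<lambda>s\<in>{Suc t}. eps s \<omega>) (Pi\<^sub>M {Suc t} (\<lambda>_. borel))"
    have "(\<lambda>\<omega>. \<lambda>s\<in>{Suc t}. eps s \<omega>) \<in> measurable ?S (Pi\<^sub>M {Suc t} (\<lambda>_. borel))"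
      by (intro measurable_vimage_algebra1) (auto simp: space_PiM)
    from measurable_compose[OF this measurable_component_singleton[of "Suc t" "{Suc t}"]]
    have "eps (Suc t) \<in> borel_measurable ?S" by simp
    from sets_vimage_algebra_subset[OF this] show "e \<in> sets ?S" using e by auto
  qed (use b in auto)
  moreover have "(a \<inter> b \<inter> c) \<inter> e = a \<inter> ((b \<inter> e) \<inter> c)" "a \<inter> b \<inter> c = a \<inter> (b \<inter> c)" by auto
  moreover have "(b \<inter> e) \<inter> c \<in> sets ?all" "b \<inter> c \<in> sets ?all" using b_all c_all e_all by auto
  ultimately show "prob ((a \<inter> b \<inter> c) \<inter> e) = prob (a \<inter> b \<inter> c) * prob e"
    using y0_all eps_eta by simp
qed

lemma past_generatorI:
  assumes "a \<in> sets (vimage_algebra (space M) (y n 0) borel)"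
    and "b \<in> sets (vimage_algebra (space M) (\<lambda>\<omega>. \<lambda>s\<in>{1..t}. eps s \<omega>) (Pi\<^sub>M {1..t} (\<lambda>_. borel)))"
    and "c \<in> sets (vimage_algebra (space M) (\<lambda>\<omega>. \<lambda>s\<in>{1..}. eta s \<omega>) (Pi\<^sub>M {1..} (\<lambda>_. borel)))"
  shows "a \<inter> b \<inter> c \<in> past_generator n t"
  using assms unfolding past_generator_def by blast

lemma top_in_vimage: "space M \<in> sets (vimage_algebra (space M) f S)"
  using sets.top[of "vimage_algebra (space M) f S"] by simp

lemma subset_of_in_vimage: "a \<in> sets (vimage_algebra (space M) f S) \<Longrightarrow> a \<subseteq> space M"
  using sets.sets_into_space[of a "vimage_algebra (space M) f S"] by simp

lemma in_past_y0:
  assumes "a \<in> sets (vimage_algebra (space M) (y n 0) borel)"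
  shows "a \<in> sets (past n t)"
proof -
  have "a \<inter> space M \<inter> space M \<in> past_generator n t"
    by (rule past_generatorI[OF assms top_in_vimage top_in_vimage])
  then show ?thesis
    unfolding sets_past using subset_of_in_vimage[OF assms] by (auto simp: Int_absorb2 intro: sigma_sets.Basic)
qed

lemma in_past_eps:
  assumes "b \<in> sets (vimage_algebra (space M) (\<lambda>\<omega>. \<lambda>s\<in>{1..t}. eps s \<omega>) (Pi\<^sub>M {1..t} (\<lambda>_. borel)))"
  shows "b \<in> sets (past n t)"
proof -
  have "space M \<inter> b \<inter> space M \<in> past_generator n t"
    by (rule past_generatorI[OF top_in_vimage assms top_in_vimage])
  then show ?thesis
    unfolding sets_past using subset_of_in_vimage[OF assms] by (auto simp: Int_absorb1 Int_absorb2 intro: sigma_sets.Basic)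
qed

lemma in_past_eta:
  assumes "c \<in> sets (vimage_algebra (space M) (\<lambda>\<omega>. \<lambda>s\<in>{1..}. eta s \<omega>) (Pi\<^sub>M {1..} (\<lambda>_. borel)))"
  shows "c \<in> sets (past n t)"
proof -
  have "space M \<inter> space M \<inter> c \<in> past_generator n t"
    by (rule past_generatorI[OF top_in_vimage top_in_vimage assms])
  then show ?thesis
    unfolding sets_past using subset_of_in_vimage[OF assms] by (auto simp: Int_absorb1 intro: sigma_sets.Basic)
qed

lemma y0_past: "y n 0 \<in> borel_measurable (past n t)"
proof (rule measurableI)
  fix A :: "real set" assume "A \<in> sets borel"
  then show "y n 0 -` A \<inter> space (past n t) \<in> sets (past n t)"
    by (intro in_past_y0) (simp add: in_vimage_algebra)
qed simp

lemma eps_past: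
  assumes "1 \<le> s" "s \<le> t"
  shows "eps s \<in> borel_measurable (past n t)"
proof -
  have "(\<lambda>\<omega>. \<lambda>s\<in>{1..t}. eps s \<omega>) \<in> measurable (past n t) (Pi\<^sub>M {1..t} (\<lambda>_. borel))"
  proof (rule measurableI)
    fix A assume "A \<in> sets (Pi\<^sub>M {1..t} (\<lambda>_. borel :: real measure))"
    then show "(\<lambda>\<omega>. \<lambda>s\<in>{1..t}. eps s \<omega>) -` A \<inter> space (past n t) \<in> sets (past n t)"
      unfolding space_past by (intro in_past_eps in_vimage_algebra)
  qed (simp add: space_PiM)
  from measurable_compose[OF this measurable_component_singleton[of s "{1..t}"]] show ?thesis
    using assms by simp
qed

lemma eta_past:
  assumes "1 \<le> s"
  shows "eta s \<in> borel_measurable (past n t)"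
proof -
  have "(\<lambda>\<omega>. \<lambda>s\<in>{1..}. eta s \<omega>) \<in> measurable (past n t) (Pi\<^sub>M {1..} (\<lambda>_. borel))"
  proof (rule measurableI)
    fix A assume "A \<in> sets (Pi\<^sub>M {1..} (\<lambda>_. borel :: real measure) :: (nat \<Rightarrow> real) measure)"
    then show "(\<lambda>\<omega>. \<lambda>s\<in>{1..}. eta s \<omega>) -` A \<inter> space (past n t) \<in> sets (past n t)"
      unfolding space_past by (intro in_past_eta in_vimage_algebra)
  qed (simp add: space_PiM)
  from measurable_compose[OF this measurable_component_singleton[of s "{1..}"]] show ?thesis
    using assms by simp
qed

text \<open>The generator is closed under intersection, so independence extends to the generated sigma-algebra.\<close>

lemma past_indep:
  assumes "1 \<le> n"
  shows "indep_set (sets (past n t)) (sets (vimage_algebra (space M) (eps (Suc t)) borel))"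
proof -
  let ?E = "vimage_algebra (space M) (eps (Suc t)) borel"
  have "indep_set (past_generator n t) (sets ?E)"
    unfolding indep_sets2_eq
  proof (intro conjI ballI subsetI)
    fix x assume "x \<in> past_generator n t"
    then obtain a b c where x: "x = a \<inter> b \<inter> c" and
      abc: "a \<in> sets (vimage_algebra (space M) (y n 0) borel)"
      "b \<in> sets (vimage_algebra (space M) (\<lambda>\<omega>. \<lambda>s\<in>{1..t}. eps s \<omega>) (Pi\<^sub>M {1..t} (\<lambda>_. borel)))"
      "c \<in> sets (vimage_algebra (space M) (\<lambda>\<omega>. \<lambda>s\<in>{1..}. eta s \<omega>) (Pi\<^sub>M {1..} (\<lambda>_. borel)))"
      unfolding past_generator_def by blast
    show "x \<in> events" unfolding x by (rule prob_past_generator_events(1)[OF abc top_in_vimage assms])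
    fix e assume "e \<in> sets ?E"
    from prob_past_generator_inter[OF abc this assms] show "prob (x \<inter> e) = prob x * prob e"
      unfolding x .
  next
    fix e assume "e \<in> sets ?E"
    from prob_past_generator_events(2)[OF top_in_vimage top_in_vimage top_in_vimage this assms]
    show "e \<in> events" .
  qed
  then have "indep_set (sigma_sets (space M) (past_generator n t)) (sigma_sets (space M) (sets ?E))"
    by (rule indep_set_sigma_sets) (rule Int_stable_past_generator, auto simp: Int_stable_def)
  then show ?thesis
    using sets.sigma_sets_eq[of ?E] by (simp add: sets_past)
qed

lemma past_filtration:
  assumes n: "1 \<le> n"
  shows "innovation_filtration M n (past n) eps"
proof unfold_locales
  fix s t :: nat
  have eps': "eps r \<in> borel_measurable (past n t)" if "1 \<le> r" "r \<le> t" for r t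
    using eps_past that by blast
  show "subalgebra M (past n t)"
    using past_indep[OF n, of t] by (simp add: subalgebra_def indep_sets2_eq)
  show "sets (past n s) \<subseteq> sets (past n t)" if "s \<le> t"
  proof -
    have "(\<lambda>\<omega>. \<lambda>r\<in>{1..s}. eps r \<omega>) \<in> measurable (past n t) (Pi\<^sub>M {1..s} (\<lambda>_. borel))"
      using that by (intro measurable_restrict eps') auto
    from sets_vimage_algebra_subset[OF this, of "space M"]
    have b: "b \<in> sets (past n t)"
      if "b \<in> sets (vimage_algebra (space M) (\<lambda>\<omega>. \<lambda>r\<in>{1..s}. eps r \<omega>) (Pi\<^sub>M {1..s} (\<lambda>_. borel)))" for b
      using that by auto
    have "past_generator n s \<subseteq> sets (past n t)"
    proof
      fix x assume "x \<in> past_generator n s"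
      then obtain a b' c where x: "x = a \<inter> b' \<inter> c" and
        abc: "a \<in> sets (vimage_algebra (space M) (y n 0) borel)"
        "b' \<in> sets (vimage_algebra (space M) (\<lambda>\<omega>. \<lambda>r\<in>{1..s}. eps r \<omega>) (Pi\<^sub>M {1..s} (\<lambda>_. borel)))"
        "c \<in> sets (vimage_algebra (space M) (\<lambda>\<omega>. \<lambda>r\<in>{1..}. eta r \<omega>) (Pi\<^sub>M {1..} (\<lambda>_. borel)))"
        unfolding past_generator_def by blast
      show "x \<in> sets (past n t)"
        unfolding x by (intro sets.Int in_past_y0[OF abc(1)] b[OF abc(2)] in_past_eta[OF abc(3)])
    qed
    from sets.sigma_sets_subset[OF this] show ?thesis by (simp add: sets_past)
  qed
  show "eps t \<in> borel_measurable (past n t)" if "1 \<le> t" using eps' that by blast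
  show "indep_set (sets (past n (t - 1))) (sets (vimage_algebra (space M) (eps t) borel))" if "1 \<le> t"
    using past_indep[OF n, of "t - 1"] that by simp
qed

end

section \<open>Moments of the volatility\<close>

context ar_stochastic_volatility
begin

lemma
  assumes J: "finite J" "J \<subseteq> {1..}"
  shows integrable_exp_sum_eta: "integrable M (\<lambda>\<omega>. exp (\<Sum>j\<in>J. a j * eta j \<omega>))"
    and expectation_exp_sum_eta:
      "expectation (\<lambda>\<omega>. exp (\<Sum>j\<in>J. a j * eta j \<omega>)) = exp (\<alpha>\<^sup>2 * (\<Sum>j\<in>J. (a j)\<^sup>2) / 2)"
proof -
  have one: "integrable M (\<lambda>\<omega>. exp (a j * eta j \<omega>))"
    "expectation (\<lambda>\<omega>. exp (a j * eta j \<omega>)) = exp ((a j)\<^sup>2 * \<alpha>\<^sup>2 / 2)" if "j \<in> J" for j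
  proof -
    have j: "1 \<le> j" using that J by auto
    note [measurable] = eta_measurable[OF j]
    show "integrable M (\<lambda>\<omega>. exp (a j * eta j \<omega>))"
      using normal_law_mgf(1)[OF \<alpha>_pos, of "a j"] unfolding eta_normal[OF j, symmetric]
      by (subst (asm) integrable_distr_eq) auto
    show "expectation (\<lambda>\<omega>. exp (a j * eta j \<omega>)) = exp ((a j)\<^sup>2 * \<alpha>\<^sup>2 / 2)"
      using normal_law_mgf(2)[OF \<alpha>_pos, of "a j"] unfolding eta_normal[OF j, symmetric]
      by (subst (asm) integral_distr) auto
  qed
  have "indep_vars (\<lambda>_. borel) (\<lambda>j \<omega>. exp (a j * eta j \<omega>)) J"
    using indep_vars_compose2[OF indep_vars_subset[OF eta_indep J(2)], of "\<lambda>j x. exp (a j * x)" "\<lambda>_. borel"] by simp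
  note ind = J(1) this one(1)
  have eq: "exp (\<Sum>j\<in>J. a j * eta j \<omega>) = (\<Prod>j\<in>J. exp (a j * eta j \<omega>))" for \<omega>
    by (rule exp_sum[OF J(1)])
  show "integrable M (\<lambda>\<omega>. exp (\<Sum>j\<in>J. a j * eta j \<omega>))"
    unfolding eq by (rule indep_vars_integrable[OF ind])
  have "expectation (\<lambda>\<omega>. exp (\<Sum>j\<in>J. a j * eta j \<omega>)) = (\<Prod>j\<in>J. exp ((a j)\<^sup>2 * \<alpha>\<^sup>2 / 2))"
    unfolding eq by (subst indep_vars_lebesgue_integral[OF ind]) (auto simp: one)
  also have "\<dots> = exp (\<alpha>\<^sup>2 * (\<Sum>j\<in>J. (a j)\<^sup>2) / 2)"
    by (simp add: exp_sum[OF J(1), symmetric] sum_distrib_left sum_divide_distrib mult.commute)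
  finally show "expectation (\<lambda>\<omega>. exp (\<Sum>j\<in>J. a j * eta j \<omega>)) = exp (\<alpha>\<^sup>2 * (\<Sum>j\<in>J. (a j)\<^sup>2) / 2)" .
qed

definition log_vol :: "nat \<Rightarrow> nat \<Rightarrow> 'a \<Rightarrow> real" where
  "log_vol n t \<omega> = (\<Sum>j=1..t. \<phi> n ^ (t - j) * eta j \<omega>)"

lemma ln_vol_sq:
  assumes n: "1 \<le> n" and w: "\<omega> \<in> space M" and t: "t \<le> n"
  shows "ln ((vol n t \<omega>)\<^sup>2) = log_vol n t \<omega>"
  using t
proof (induction t)
  case 0
  then show ?case using vol_init[OF n w] by (simp add: log_vol_def)
next
  case (Suc t)
  have "(\<Sum>j=1..t. \<phi> n ^ (Suc t - j) * eta j \<omega>) = (\<Sum>j=1..t. \<phi> n * (\<phi> n ^ (t - j) * eta j \<omega>))"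
    by (rule sum.cong) (auto simp: Suc_diff_le)
  then show ?case
    using vol_rec[of "Suc t" n \<omega>] Suc w by (simp add: log_vol_def sum_distrib_left)
qed

lemma vol_eq:
  assumes n: "1 \<le> n" and w: "\<omega> \<in> space M" and t: "t \<le> n"
  shows "vol n t \<omega> = exp (log_vol n t \<omega> / 2)"
proof -
  have pos: "vol n t \<omega> > 0"
    using vol_pos[of t n \<omega>] vol_init[OF n w] t w by (cases "t = 0") auto
  then have "ln ((vol n t \<omega>)\<^sup>2) = 2 * ln (vol n t \<omega>)" by (simp add: ln_realpow)
  then show ?thesis using ln_vol_sq[OF assms] pos by simp
qed

lemma vol_past:
  assumes "1 \<le> n" "t \<le> n"
  shows "vol n t \<in> borel_measurable (past n s)"
proof -
  have "(\<lambda>\<omega>. exp (log_vol n t \<omega> / 2)) \<in> borel_measurable (past n s)"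
    unfolding log_vol_def using eta_past
    by (intro borel_measurable_exp[THEN measurable_compose[rotated]] borel_measurable_divide borel_measurable_sum
        borel_measurable_times) auto
  then show ?thesis
    using vol_eq[OF assms(1) _ assms(2)] by (subst measurable_cong) auto
qed

text \<open>The logarithm of \<open>vol\<^sup>2\<close> starts in \<open>0\<close>, and its variance \<open>log_var n t\<close> increases to the stationary one.\<close>

definition stat_var :: "nat \<Rightarrow> real" where
  "stat_var n = \<alpha>\<^sup>2 / (1 - (\<phi> n)\<^sup>2)"

definition log_var :: "nat \<Rightarrow> nat \<Rightarrow> real" where
  "log_var n t = (1 - \<phi> n ^ (2 * t)) * stat_var n"

definition stat_mean :: "nat \<Rightarrow> real" where
  "stat_mean n = exp (stat_var n / 2)"

text \<open>All moments of the volatility in row \<open>n\<close> are bounded by powers of this quantity.\<close>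

definition vol_scale :: "nat \<Rightarrow> real" where
  "vol_scale n = exp (stat_var n)"

lemma phi_sq_less_one: "1 \<le> n \<Longrightarrow> (\<phi> n)\<^sup>2 < 1"
  using \<phi>_abs[of n] by (simp add: abs_square_less_1)

lemma stat_var_pos: "1 \<le> n \<Longrightarrow> 0 < stat_var n"
  using phi_sq_less_one[of n] \<alpha>_pos by (simp add: stat_var_def)

lemma vol_scale_ge_one: "1 \<le> n \<Longrightarrow> 1 \<le> vol_scale n"
  using stat_var_pos[of n] by (simp add: vol_scale_def)

lemma stat_var_le_vol_scale: "stat_var n \<le> vol_scale n"
proof -
  have "1 + stat_var n \<le> exp (stat_var n)" by simp
  then show ?thesis unfolding vol_scale_def by linarith
qed

lemma stat_mean_sq: "(stat_mean n)\<^sup>2 = vol_scale n"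
  by (simp add: stat_mean_def vol_scale_def power2_eq_square flip: exp_add)

lemma stat_mean_ge_one: "1 \<le> n \<Longrightarrow> 1 \<le> stat_mean n"
  using stat_var_pos[of n] by (simp add: stat_mean_def)

lemma phi_even_power_bounds:
  assumes "1 \<le> n"
  shows "0 \<le> \<phi> n ^ (2 * t)" "\<phi> n ^ (2 * t) \<le> 1"
  using phi_sq_less_one[OF assms] power_le_one[of "(\<phi> n)\<^sup>2" t] by (simp_all add: power_mult)

lemma log_var_bounds:
  assumes "1 \<le> n"
  shows "0 \<le> log_var n t" "log_var n t \<le> stat_var n"
  using stat_var_pos[OF assms] phi_even_power_bounds[OF assms, of t]
  by (auto simp: log_var_def mult_left_le_one_le)

lemma log_var_eq_sum:
  assumes "1 \<le> n"
  shows "\<alpha>\<^sup>2 * (\<Sum>j=1..t. (\<phi> n ^ (t - j))\<^sup>2) = log_var n t"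
proof (induction t)
  case 0
  show ?case by (simp add: log_var_def)
next
  case (Suc t)
  have "(\<Sum>j=1..t. (\<phi> n ^ (Suc t - j))\<^sup>2) = (\<Sum>j=1..t. (\<phi> n)\<^sup>2 * (\<phi> n ^ (t - j))\<^sup>2)"
    by (rule sum.cong) (auto simp: Suc_diff_le power_mult_distrib)
  then have "\<alpha>\<^sup>2 * (\<Sum>j=1..Suc t. (\<phi> n ^ (Suc t - j))\<^sup>2) = (\<phi> n)\<^sup>2 * log_var n t + \<alpha>\<^sup>2"
    using Suc by (simp add: sum_distrib_left[symmetric] algebra_simps)
  also have "\<dots> = (\<phi> n)\<^sup>2 * log_var n t + (1 - (\<phi> n)\<^sup>2) * stat_var n"
    using phi_sq_less_one[OF assms] by (simp add: stat_var_def)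
  also have "\<dots> = log_var n (Suc t)"
    by (simp add: log_var_def algebra_simps power2_eq_square)
  finally show ?case .
qed

text \<open>The logarithm of \<open>vol\<^sup>2\<close> is a weighted sum of the \<open>eta\<close>, hence normal with variance \<open>log_var\<close>.\<close>

lemma
  assumes n: "1 \<le> n" and t: "t \<le> n"
  shows integrable_vol_power: "integrable M (\<lambda>\<omega>. (vol n t \<omega>) ^ p)"
    and expectation_vol_power: "expectation (\<lambda>\<omega>. (vol n t \<omega>) ^ p) = exp ((real p)\<^sup>2 / 8 * log_var n t)"
proof -
  have eq: "(vol n t \<omega>) ^ p = exp (\<Sum>j=1..t. (real p / 2 * \<phi> n ^ (t - j)) * eta j \<omega>)" if "\<omega> \<in> space M" for \<omega>
    unfolding vol_eq[OF n that t] exp_of_nat_mult[symmetric]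
    by (simp add: log_vol_def sum_distrib_left sum_divide_distrib mult_ac)
  have cong: "integrable M (\<lambda>\<omega>. (vol n t \<omega>) ^ p) = integrable M (\<lambda>\<omega>. exp (\<Sum>j=1..t. (real p / 2 * \<phi> n ^ (t - j)) * eta j \<omega>))"
    "expectation (\<lambda>\<omega>. (vol n t \<omega>) ^ p) = expectation (\<lambda>\<omega>. exp (\<Sum>j=1..t. (real p / 2 * \<phi> n ^ (t - j)) * eta j \<omega>))"
    by (rule Bochner_Integration.integrable_cong[OF refl], rule eq, assumption)
      (rule Bochner_Integration.integral_cong[OF refl], rule eq, assumption)
  show "integrable M (\<lambda>\<omega>. (vol n t \<omega>) ^ p)"
    unfolding cong by (rule integrable_exp_sum_eta) auto
  have "expectation (\<lambda>\<omega>. (vol n t \<omega>) ^ p) = exp (\<alpha>\<^sup>2 * (\<Sum>j=1..t. (real p / 2 * \<phi> n ^ (t - j))\<^sup>2) / 2)"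
    unfolding cong by (rule expectation_exp_sum_eta) auto
  also have "\<alpha>\<^sup>2 * (\<Sum>j=1..t. (real p / 2 * \<phi> n ^ (t - j))\<^sup>2) = (real p / 2)\<^sup>2 * (\<alpha>\<^sup>2 * (\<Sum>j=1..t. (\<phi> n ^ (t - j))\<^sup>2))"
    by (simp only: power_mult_distrib sum_distrib_left mult_ac)
  also have "\<dots> / 2 = (real p)\<^sup>2 / 8 * log_var n t"
    unfolding log_var_eq_sum[OF n] by (simp add: power_divide)
  finally show "expectation (\<lambda>\<omega>. (vol n t \<omega>) ^ p) = exp ((real p)\<^sup>2 / 8 * log_var n t)" .
qed

lemma expectation_vol_power_le:
  assumes n: "1 \<le> n" and t: "t \<le> n" and m: "(real p)\<^sup>2 \<le> 8 * real m"
  shows "expectation (\<lambda>\<omega>. (vol n t \<omega>) ^ p) \<le> vol_scale n ^ m"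
proof -
  have "(real p)\<^sup>2 / 8 * log_var n t \<le> real m * stat_var n"
    using log_var_bounds[OF n, of t] m by (intro mult_mono) auto
  then show ?thesis
    unfolding expectation_vol_power[OF n t] vol_scale_def exp_of_nat_mult[symmetric] by simp
qed

lemma expectation_vol_sq:
  assumes n: "1 \<le> n" and t: "t \<le> n"
  shows "expectation (\<lambda>\<omega>. (vol n t \<omega>)\<^sup>2) = exp (log_var n t / 2)"
  using expectation_vol_power[OF assms, of 2] by simp

lemma expectation_vol_sq_mult:
  assumes n: "1 \<le> n" and t: "s \<le> t" "t \<le> n"
  shows "integrable M (\<lambda>\<omega>. (vol n s \<omega>)\<^sup>2 * (vol n t \<omega>)\<^sup>2)"
    and "expectation (\<lambda>\<omega>. (vol n s \<omega>)\<^sup>2 * (vol n t \<omega>)\<^sup>2)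
       = exp (log_var n s / 2) * exp (log_var n t / 2) * exp (\<phi> n ^ (t - s) * log_var n s)"
proof -
  let ?a = "\<lambda>j. \<phi> n ^ (t - j) + (if j \<le> s then \<phi> n ^ (s - j) else 0)"
  have split: "(\<Sum>j=1..t. if j \<le> s then f j else 0) = (\<Sum>j=1..s. f j)" for f :: "nat \<Rightarrow> real"
  proof -
    have "{1..t} \<inter> {j. j \<le> s} = {1..s}" using t by auto
    then show ?thesis by (simp add: sum.If_cases)
  qed
  have eq: "(vol n s \<omega>)\<^sup>2 * (vol n t \<omega>)\<^sup>2 = exp (\<Sum>j=1..t. ?a j * eta j \<omega>)" if "\<omega> \<in> space M" for \<omega>
  proof -
    have "(\<Sum>j=1..t. ?a j * eta j \<omega>) = log_vol n t \<omega> + (\<Sum>j=1..t. if j \<le> s then \<phi> n ^ (s - j) * eta j \<omega> else 0)"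
      unfolding log_vol_def sum.distrib[symmetric] by (rule sum.cong) (auto simp: algebra_simps)
    also have "\<dots> = log_vol n t \<omega> + log_vol n s \<omega>" unfolding split log_vol_def ..
    finally have "exp (\<Sum>j=1..t. ?a j * eta j \<omega>) = exp (log_vol n t \<omega>) * exp (log_vol n s \<omega>)"
      by (simp only: exp_add)
    moreover have "(vol n r \<omega>)\<^sup>2 = exp (log_vol n r \<omega>)" if "r \<le> n" for r
      using vol_eq[OF n \<open>\<omega> \<in> space M\<close> that] by (simp flip: exp_double)
    ultimately show ?thesis using t by simp
  qed
  have cong: "integrable M (\<lambda>\<omega>. (vol n s \<omega>)\<^sup>2 * (vol n t \<omega>)\<^sup>2) = integrable M (\<lambda>\<omega>. exp (\<Sum>j=1..t. ?a j * eta j \<omega>))"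
    "expectation (\<lambda>\<omega>. (vol n s \<omega>)\<^sup>2 * (vol n t \<omega>)\<^sup>2) = expectation (\<lambda>\<omega>. exp (\<Sum>j=1..t. ?a j * eta j \<omega>))"
    by (rule Bochner_Integration.integrable_cong[OF refl], rule eq, assumption)
      (rule Bochner_Integration.integral_cong[OF refl], rule eq, assumption)
  show "integrable M (\<lambda>\<omega>. (vol n s \<omega>)\<^sup>2 * (vol n t \<omega>)\<^sup>2)"
    unfolding cong by (rule integrable_exp_sum_eta) auto
  have "(\<Sum>j=1..t. (?a j)\<^sup>2) = (\<Sum>j=1..t. (\<phi> n ^ (t - j))\<^sup>2)
      + (\<Sum>j=1..t. if j \<le> s then (2 * \<phi> n ^ (t - s) + 1) * (\<phi> n ^ (s - j))\<^sup>2 else 0)"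
    unfolding sum.distrib[symmetric]
  proof (rule sum.cong)
    fix j assume "j \<in> {1..t}"
    show "(?a j)\<^sup>2 = (\<phi> n ^ (t - j))\<^sup>2 + (if j \<le> s then (2 * \<phi> n ^ (t - s) + 1) * (\<phi> n ^ (s - j))\<^sup>2 else 0)"
    proof (cases "j \<le> s")
      case True
      then have "\<phi> n ^ (t - j) = \<phi> n ^ (t - s) * \<phi> n ^ (s - j)"
        using t by (simp flip: power_add)
      then show ?thesis using True by (simp add: power2_eq_square algebra_simps)
    qed simp
  qed simp
  also have "\<dots> = (\<Sum>j=1..t. (\<phi> n ^ (t - j))\<^sup>2) + (2 * \<phi> n ^ (t - s) + 1) * (\<Sum>j=1..s. (\<phi> n ^ (s - j))\<^sup>2)"
    unfolding split by (simp only: sum_distrib_left)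
  finally have "\<alpha>\<^sup>2 * (\<Sum>j=1..t. (?a j)\<^sup>2) = log_var n t + (2 * \<phi> n ^ (t - s) + 1) * log_var n s"
    unfolding log_var_eq_sum[OF n, symmetric] by (simp only: distrib_left mult.left_commute)
  then have "expectation (\<lambda>\<omega>. (vol n s \<omega>)\<^sup>2 * (vol n t \<omega>)\<^sup>2)
      = exp ((log_var n t + (2 * \<phi> n ^ (t - s) + 1) * log_var n s) / 2)"
    unfolding cong by (subst expectation_exp_sum_eta) auto
  also have "\<dots> = exp (log_var n s / 2) * exp (log_var n t / 2) * exp (\<phi> n ^ (t - s) * log_var n s)"
    unfolding exp_add[symmetric] by (simp add: algebra_simps add_divide_distrib)
  finally show "expectation (\<lambda>\<omega>. (vol n s \<omega>)\<^sup>2 * (vol n t \<omega>)\<^sup>2)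
       = exp (log_var n s / 2) * exp (log_var n t / 2) * exp (\<phi> n ^ (t - s) * log_var n s)" .
qed

text \<open>Centring at the stationary mean rather than at the mean at time \<open>t\<close> makes the deviations comparable
  with a constant; the small bias that this leaves is covered by the covariance bound below.\<close>

definition vol_dev :: "nat \<Rightarrow> nat \<Rightarrow> 'a \<Rightarrow> real" where
  "vol_dev n t \<omega> = (vol n t \<omega>)\<^sup>2 - stat_mean n"

lemma stat_mean_minus_mean:
  assumes n: "1 \<le> n"
  shows "0 \<le> stat_mean n - exp (log_var n t / 2)"
    and "stat_mean n - exp (log_var n t / 2) \<le> stat_mean n * stat_var n * (\<phi> n)^(2 * t)"
    and "stat_mean n - exp (log_var n t / 2) \<le> stat_mean n"
proof -
  let ?x = "\<phi> n ^ (2 * t) * stat_var n / 2"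
  have "exp (log_var n t / 2) = stat_mean n * exp (- ?x)"
    unfolding stat_mean_def exp_add[symmetric] by (simp add: log_var_def algebra_simps diff_divide_distrib)
  then have eq: "stat_mean n - exp (log_var n t / 2) = stat_mean n * (1 - exp (- ?x))" by (simp add: algebra_simps)
  have x: "0 \<le> ?x" using phi_even_power_bounds[OF n, of t] stat_var_pos[OF n] by simp
  have m: "0 \<le> stat_mean n" by (simp add: stat_mean_def)
  have "0 \<le> 1 - exp (- ?x)" "1 - exp (- ?x) \<le> 1" using x by auto
  moreover have "1 - exp (- ?x) \<le> stat_var n * \<phi> n ^ (2 * t)"
  proof -
    have "1 - ?x \<le> exp (- ?x)" using exp_ge_add_one_self[of "- ?x"] by linarith
    moreover have "?x \<le> stat_var n * \<phi> n ^ (2 * t)" using x by (simp add: mult.commute)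
    ultimately show ?thesis by linarith
  qed
  ultimately show "0 \<le> stat_mean n - exp (log_var n t / 2)"
    "stat_mean n - exp (log_var n t / 2) \<le> stat_mean n"
    "stat_mean n - exp (log_var n t / 2) \<le> stat_mean n * stat_var n * (\<phi> n)^(2 * t)"
    unfolding eq using m by (auto intro: mult_left_le mult_left_mono simp: mult.assoc)
qed

text \<open>The expectation splits into a covariance and a product of biases.  The covariance of two lognormal
  variables is governed by \<open>exp x - 1\<close>, where \<open>x = \<phi>\<^bsup>t-s\<^esup> log_var n s\<close> is the covariance of their logarithms,
  and the bias at time \<open>t\<close> is of order \<open>\<phi>\<^bsup>2t\<^esup>\<close>; both decay like \<open>\<bar>\<phi>\<bar>\<^bsup>t-s\<^esup>\<close>.\<close>

lemma vol_dev_covariance: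
  assumes n: "1 \<le> n" and t: "s \<le> t" "t \<le> n"
  shows "\<bar>expectation (\<lambda>\<omega>. vol_dev n s \<omega> * vol_dev n t \<omega>)\<bar> \<le> 2 * vol_scale n ^ 3 * \<bar>\<phi> n\<bar> ^ (t - s)"
proof -
  let ?e = "\<lambda>t. exp (log_var n t / 2)" and ?\<mu> = "stat_mean n" and ?q = "\<bar>\<phi> n\<bar> ^ (t - s)" and ?R = "vol_scale n"
  let ?x = "\<phi> n ^ (t - s) * log_var n s"
  note int = expectation_vol_sq_mult(1)[OF assms] integrable_vol_power[OF n, of s 2] integrable_vol_power[OF n t(2), of 2]
  note ev = expectation_vol_sq_mult(2)[OF assms] expectation_vol_sq[OF n, of s] expectation_vol_sq[OF n t(2)]
  have q: "0 \<le> ?q" "?q \<le> 1" using \<phi>_abs[OF n] by (auto intro: power_le_one)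
  have gR: "stat_var n \<le> ?R" by (rule stat_var_le_vol_scale)
  have R: "1 \<le> ?R" by (rule vol_scale_ge_one[OF n])
  have "expectation (\<lambda>\<omega>. vol_dev n s \<omega> * vol_dev n t \<omega>)
      = expectation (\<lambda>\<omega>. (vol n s \<omega>)\<^sup>2 * (vol n t \<omega>)\<^sup>2 - ?\<mu> * (vol n s \<omega>)\<^sup>2 - ?\<mu> * (vol n t \<omega>)\<^sup>2 + ?\<mu> * ?\<mu>)"
    by (simp add: vol_dev_def algebra_simps)
  also have "\<dots> = ?e s * ?e t * exp ?x - ?\<mu> * ?e s - ?\<mu> * ?e t + ?\<mu> * ?\<mu>"
    using int ev t by (simp add: prob_space)
  also have "\<dots> = ?e s * ?e t * (exp ?x - 1) + (?\<mu> - ?e s) * (?\<mu> - ?e t)"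
    by (simp add: algebra_simps)
  also have "\<bar>\<dots>\<bar> \<le> ?R ^ 3 * ?q + ?R ^ 3 * ?q"
  proof (rule order_trans[OF abs_triangle_ineq add_mono])
    have le: "\<bar>?x\<bar> \<le> ?q * stat_var n" "\<bar>?x\<bar> \<le> stat_var n"
    proof -
      have "\<bar>?x\<bar> = ?q * log_var n s" using log_var_bounds[OF n, of s] by (simp add: abs_mult power_abs)
      moreover have "?q * log_var n s \<le> ?q * stat_var n" using q log_var_bounds[OF n, of s] by (intro mult_left_mono) auto
      moreover have "?q * stat_var n \<le> 1 * stat_var n" using q stat_var_pos[OF n] by (intro mult_right_mono) auto
      ultimately show "\<bar>?x\<bar> \<le> ?q * stat_var n" "\<bar>?x\<bar> \<le> stat_var n" by linarith+
    qed
    have "\<bar>exp ?x - 1\<bar> \<le> \<bar>?x\<bar> * exp \<bar>?x\<bar>" by (rule abs_exp_minus_one_le)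
    also have "\<dots> \<le> (?q * ?R) * ?R"
    proof (intro mult_mono)
      show "\<bar>?x\<bar> \<le> ?q * ?R" using le(1) mult_left_mono[OF gR q(1)] by linarith
      show "exp \<bar>?x\<bar> \<le> ?R" using le(2) by (simp add: vol_scale_def)
    qed (use q R in auto)
    finally have 1: "\<bar>exp ?x - 1\<bar> \<le> ?q * ?R * ?R" .
    have "?e s * ?e t \<le> ?\<mu> * ?\<mu>"
      using log_var_bounds[OF n, of s] log_var_bounds[OF n, of t] by (intro mult_mono) (auto simp: stat_mean_def)
    then have 2: "?e s * ?e t \<le> ?R" using stat_mean_sq[of n] by (simp add: power2_eq_square)
    have "\<bar>?e s * ?e t * (exp ?x - 1)\<bar> \<le> ?R * (?q * ?R * ?R)"
      unfolding abs_mult using 1 2 R by (intro mult_mono) auto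
    then show "\<bar>?e s * ?e t * (exp ?x - 1)\<bar> \<le> ?R ^ 3 * ?q" by (simp add: power3_eq_cube mult_ac)
    have "\<phi> n ^ (2 * t) = \<bar>\<phi> n\<bar> ^ (2 * t)" by (simp add: power_even_abs)
    also have "\<dots> \<le> ?q" using \<phi>_abs[OF n] t by (intro power_decreasing) auto
    finally have phiq: "\<phi> n ^ (2 * t) \<le> ?q" .
    have "(?\<mu> - ?e s) * (?\<mu> - ?e t) \<le> ?\<mu> * (?\<mu> * stat_var n * \<phi> n ^ (2 * t))"
      using stat_mean_minus_mean[OF n, of s] stat_mean_minus_mean[OF n, of t] by (intro mult_mono) (auto simp: stat_mean_def)
    also have "\<dots> = ?R * stat_var n * \<phi> n ^ (2 * t)" using stat_mean_sq[of n] by (simp add: power2_eq_square mult_ac)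
    also have "\<dots> \<le> ?R * ?R * ?q"
      using gR R phiq stat_var_pos[OF n] phi_even_power_bounds[OF n, of t] by (intro mult_mono) auto
    also have "\<dots> \<le> ?R * ?R * ?R * ?q"
      using R q by (intro mult_right_mono) (auto simp: mult_le_cancel_left1)
    finally show "\<bar>(?\<mu> - ?e s) * (?\<mu> - ?e t)\<bar> \<le> ?R ^ 3 * ?q"
      using stat_mean_minus_mean(1)[OF n] by (simp add: power3_eq_cube abs_mult)
  qed
  finally show ?thesis by (simp add: mult_ac)
qed

text \<open>The correlation length of the volatility is itself at most a multiple of \<open>vol_scale\<close>, so that
  one quantity controls both the moments and the memory of the volatility.\<close>

lemma inverse_one_minus_phi_le:
  assumes n: "1 \<le> n"
  shows "1 / (1 - \<bar>\<phi> n\<bar>) \<le> 2 / \<alpha>\<^sup>2 * vol_scale n"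
proof -
  have gR: "stat_var n \<le> vol_scale n" by (rule stat_var_le_vol_scale)
  have q: "0 < 1 - \<bar>\<phi> n\<bar>" using \<phi>_abs[OF n] by simp
  have "(1 - \<bar>\<phi> n\<bar>) * (1 + \<bar>\<phi> n\<bar>) = 1 - (\<phi> n)\<^sup>2" by (simp add: algebra_simps power2_eq_square)
  moreover have "(1 - \<bar>\<phi> n\<bar>) * (1 + \<bar>\<phi> n\<bar>) \<le> (1 - \<bar>\<phi> n\<bar>) * 2" using q \<phi>_abs[OF n] by (intro mult_left_mono) auto
  ultimately have "1 - (\<phi> n)\<^sup>2 \<le> 2 * (1 - \<bar>\<phi> n\<bar>)" by simp
  then have "1 / (1 - \<bar>\<phi> n\<bar>) \<le> 2 / (1 - (\<phi> n)\<^sup>2)"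
    using q phi_sq_less_one[OF n] by (simp add: field_simps)
  also have "\<dots> = 2 / \<alpha>\<^sup>2 * stat_var n" using \<alpha>_pos by (simp add: stat_var_def)
  also have "\<dots> \<le> 2 / \<alpha>\<^sup>2 * vol_scale n" using gR by (intro mult_left_mono) auto
  finally show ?thesis .
qed

lemma
  assumes n: "1 \<le> n" and t: "t \<le> n" and \<theta>: "0 \<le> \<theta>" "\<theta> \<le> 1"
  shows vol_filter_measurable: "random_variable borel (exp_filter \<theta> (vol_dev n) t)"
    and vol_filter_square_integrable: "integrable M (\<lambda>\<omega>. (exp_filter \<theta> (vol_dev n) t \<omega>)\<^sup>2)"
    and vol_filter_square_le: "expectation (\<lambda>\<omega>. (exp_filter \<theta> (vol_dev n) t \<omega>)\<^sup>2)
       \<le> 12 / \<alpha>\<^sup>2 * vol_scale n ^ 4 * (\<Sum>i<t. \<theta> ^ i)"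
proof -
  interpret innovation_filtration M n "past n" eps by (rule past_filtration[OF n])
  have m: "random_variable borel (vol n t)" if "t \<le> n" for t
    using measurable_F_M[OF vol_past[OF n that, of 0]] by simp
  have D: "random_variable borel (vol_dev n t)" if "t \<le> n" for t
    unfolding vol_dev_def using m[OF that] by simp
  have D2: "integrable M (\<lambda>\<omega>. (vol_dev n t \<omega>)\<^sup>2)" if "t \<le> n" for t
    using integrable_vol_power[OF n that, of 4] integrable_vol_power[OF n that, of 2]
    by (simp add: vol_dev_def power2_diff flip: power_mult)
  note F = exp_filter_measurable[of n "vol_dev n" "2 * vol_scale n ^ 3" "\<bar>\<phi> n\<bar>" \<theta> t]
    exp_filter_square_integrable[of n "vol_dev n" "2 * vol_scale n ^ 3" "\<bar>\<phi> n\<bar>" \<theta> t]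
    exp_filter_square_le[of n "vol_dev n" "2 * vol_scale n ^ 3" "\<bar>\<phi> n\<bar>" \<theta> t]
  have C: "0 \<le> 2 * vol_scale n ^ 3" using vol_scale_ge_one[OF n] by simp
  show "random_variable borel (exp_filter \<theta> (vol_dev n) t)"
    by (rule F(1)) (use D D2 vol_dev_covariance[OF n] C \<phi>_abs[OF n] t \<theta> in auto)
  show "integrable M (\<lambda>\<omega>. (exp_filter \<theta> (vol_dev n) t \<omega>)\<^sup>2)"
    by (rule F(2)) (use D D2 vol_dev_covariance[OF n] C \<phi>_abs[OF n] t \<theta> in auto)
  have "expectation (\<lambda>\<omega>. (exp_filter \<theta> (vol_dev n) t \<omega>)\<^sup>2)
      \<le> 3 * (2 * vol_scale n ^ 3) / (1 - \<bar>\<phi> n\<bar>) * (\<Sum>i<t. \<theta> ^ i)"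
    by (rule F(3)) (use D D2 vol_dev_covariance[OF n] C \<phi>_abs[OF n] t \<theta> in auto)
  also have "3 * (2 * vol_scale n ^ 3) / (1 - \<bar>\<phi> n\<bar>) = 6 * vol_scale n ^ 3 * (1 / (1 - \<bar>\<phi> n\<bar>))" by simp
  also have "\<dots> * (\<Sum>i<t. \<theta> ^ i) \<le> 6 * vol_scale n ^ 3 * (2 / \<alpha>\<^sup>2 * vol_scale n) * (\<Sum>i<t. \<theta> ^ i)"
    using inverse_one_minus_phi_le[OF n] vol_scale_ge_one[OF n] \<theta> by (intro mult_right_mono mult_left_mono sum_nonneg) auto
  also have "\<dots> = 12 / \<alpha>\<^sup>2 * vol_scale n ^ 4 * (\<Sum>i<t. \<theta> ^ i)" by (simp add: eval_nat_numeral)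
  finally show "expectation (\<lambda>\<omega>. (exp_filter \<theta> (vol_dev n) t \<omega>)\<^sup>2)
       \<le> 12 / \<alpha>\<^sup>2 * vol_scale n ^ 4 * (\<Sum>i<t. \<theta> ^ i)" .
qed

text \<open>The biases \<open>\<phi>\<^bsup>2t\<^esup>\<close> of the means are summable, so averaging over \<open>n\<close> of them leaves an error of order \<open>1 / n\<close>.\<close>

lemma
  assumes n: "1 \<le> n"
  shows mean_vol_ge_one: "1 \<le> mean_vol M vol n"
    and mean_vol_le: "mean_vol M vol n \<le> stat_mean n"
    and stat_mean_minus_mean_vol_le: "stat_mean n - mean_vol M vol n \<le> 2 / \<alpha>\<^sup>2 * vol_scale n ^ 3 / real n"
proof -
  let ?e = "\<lambda>t. exp (log_var n t / 2)" and ?\<mu> = "stat_mean n" and ?R = "vol_scale n"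
  have m: "mean_vol M vol n = (1 / real n) * (\<Sum>t=1..n. ?e t)"
    unfolding mean_vol_def using expectation_vol_sq[OF n] by simp
  have "(\<Sum>t=1..n. 1) \<le> (\<Sum>t=1..n. ?e t)" using log_var_bounds[OF n] by (intro sum_mono) auto
  then show "1 \<le> mean_vol M vol n" using n by (simp add: m field_simps)
  have "(\<Sum>t=1..n. ?e t) \<le> (\<Sum>t=1..n. ?\<mu>)" using stat_mean_minus_mean(1)[OF n] by (intro sum_mono) auto
  then show "mean_vol M vol n \<le> stat_mean n" using n by (simp add: m field_simps)
  have gR: "stat_var n \<le> ?R" by (rule stat_var_le_vol_scale)
  have R: "1 \<le> ?R" by (rule vol_scale_ge_one[OF n])
  have mu: "?\<mu> \<le> ?R" using stat_mean_ge_one[OF n] stat_mean_sq[of n] by (simp add: power2_eq_square mult_le_cancel_left1 flip: stat_mean_sq)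
  have "stat_mean n - mean_vol M vol n = (1 / real n) * (\<Sum>t=1..n. ?\<mu> - ?e t)"
    using n by (simp add: m sum_subtractf field_simps)
  also have "(\<Sum>t=1..n. ?\<mu> - ?e t) \<le> (\<Sum>t=1..n. ?R * ?R * \<bar>\<phi> n\<bar> ^ t)"
  proof (rule sum_mono)
    fix t assume "t \<in> {1..n}"
    have "\<phi> n ^ (2 * t) = \<bar>\<phi> n\<bar> ^ (2 * t)" by (simp add: power_even_abs)
    also have "\<dots> \<le> \<bar>\<phi> n\<bar> ^ t" using \<phi>_abs[OF n] by (intro power_decreasing) auto
    finally have "?\<mu> * stat_var n * \<phi> n ^ (2 * t) \<le> ?R * ?R * \<bar>\<phi> n\<bar> ^ t"
      using gR mu R stat_var_pos[OF n] stat_mean_ge_one[OF n] phi_even_power_bounds[OF n, of t] by (intro mult_mono) auto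
    then show "?\<mu> - ?e t \<le> ?R * ?R * \<bar>\<phi> n\<bar> ^ t" using stat_mean_minus_mean(2)[OF n, of t] by linarith
  qed
  also have "\<dots> = ?R * ?R * (\<Sum>t=1..n. \<bar>\<phi> n\<bar> ^ t)" by (simp only: sum_distrib_left)
  also have "(\<Sum>t=1..n. \<bar>\<phi> n\<bar> ^ t) \<le> 2 / \<alpha>\<^sup>2 * ?R"
  proof -
    have "(\<Sum>t=1..n. \<bar>\<phi> n\<bar> ^ t) \<le> (\<Sum>t<Suc n. \<bar>\<phi> n\<bar> ^ t)" by (intro sum_mono2) auto
    also have "\<dots> = (1 - \<bar>\<phi> n\<bar> ^ Suc n) / (1 - \<bar>\<phi> n\<bar>)" using \<phi>_abs[OF n] by (subst sum_gp_strict) auto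
    also have "\<dots> \<le> 1 / (1 - \<bar>\<phi> n\<bar>)" using \<phi>_abs[OF n] by (intro divide_right_mono) auto
    finally show ?thesis using inverse_one_minus_phi_le[OF n] by linarith
  qed
  also have "1 / real n * (?R * ?R * (2 / \<alpha>\<^sup>2 * ?R)) = 2 / \<alpha>\<^sup>2 * ?R ^ 3 / real n"
    by (simp add: power3_eq_cube mult_ac)
  finally show "stat_mean n - mean_vol M vol n \<le> 2 / \<alpha>\<^sup>2 * ?R ^ 3 / real n"
    using R by (simp add: mult_left_mono divide_right_mono)
qed

end

section \<open>Moments of the autoregression\<close>

text \<open>The odd term \<open>4 a b\<^sup>3\<close> is absorbed by the even ones.  The only odd term that remains is linear in \<open>b\<close>,
  and it vanishes in expectation when \<open>b\<close> is a centred innovation.\<close>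

lemma power4_add_le: "(a + b) ^ 4 \<le> a ^ 4 + 4 * (a ^ 3 * b) + 8 * (a\<^sup>2 * b\<^sup>2) + 3 * b ^ 4" for a b :: real
proof -
  have "a ^ 4 + 4 * (a ^ 3 * b) + 8 * (a\<^sup>2 * b\<^sup>2) + 3 * b ^ 4 - (a + b) ^ 4 = 2 * (b * (a - b))\<^sup>2"
    by (simp add: eval_nat_numeral algebra_simps)
  moreover have "0 \<le> 2 * (b * (a - b))\<^sup>2" by simp
  ultimately show ?thesis by linarith
qed

lemma abs_cube_mult_le: "\<bar>a ^ 3 * b\<bar> \<le> a ^ 4 + b ^ 4" for a b :: real
proof -
  have *: "x ^ 3 * y \<le> x ^ 4 + y ^ 4" if "0 \<le> x" "0 \<le> y" for x y :: real
  proof (cases "y \<le> x")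
    case True
    then have "x ^ 3 * y \<le> x ^ 3 * x" using that by (intro mult_left_mono) auto
    also have "\<dots> \<le> x ^ 4 + y ^ 4" using that by (simp add: eval_nat_numeral)
    finally show ?thesis .
  next
    case False
    then have "x ^ 3 * y \<le> y ^ 3 * y" using that by (intro mult_right_mono power_mono) auto
    also have "\<dots> \<le> x ^ 4 + y ^ 4" using that by (simp add: eval_nat_numeral)
    finally show ?thesis .
  qed
  have "\<bar>a ^ 3 * b\<bar> = \<bar>a\<bar> ^ 3 * \<bar>b\<bar>" by (simp add: abs_mult power_abs)
  also have "\<dots> \<le> \<bar>a\<bar> ^ 4 + \<bar>b\<bar> ^ 4" by (rule *) auto
  also have "\<dots> = a ^ 4 + b ^ 4" by (simp add: power_even_abs)
  finally show ?thesis .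
qed

lemma abs_cube_le: "\<bar>a\<bar> ^ 3 \<le> a\<^sup>2 + a ^ 4" for a :: real
proof -
  have "0 \<le> (\<bar>a\<bar> * (\<bar>a\<bar> - 1))\<^sup>2" by simp
  also have "\<dots> = \<bar>a\<bar> ^ 4 - 2 * \<bar>a\<bar> ^ 3 + \<bar>a\<bar>\<^sup>2" by (simp add: eval_nat_numeral algebra_simps)
  finally have "2 * \<bar>a\<bar> ^ 3 \<le> a ^ 4 + a\<^sup>2" by (simp add: power_even_abs)
  then show ?thesis using zero_le_power[of "\<bar>a\<bar>" 3] by linarith
qed

text \<open>Young's inequality with a weight that is chosen to balance two moments of different size.\<close>

lemma (in prob_space)
  fixes X Y :: "'a \<Rightarrow> real"
  assumes [measurable]: "random_variable borel X" "random_variable borel Y"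
    and X: "integrable M (\<lambda>\<omega>. (X \<omega>)\<^sup>2)" and Y: "integrable M (\<lambda>\<omega>. (Y \<omega>)\<^sup>2)"
    and A: "expectation (\<lambda>\<omega>. (X \<omega>)\<^sup>2) \<le> A" and B: "expectation (\<lambda>\<omega>. (Y \<omega>)\<^sup>2) \<le> B" and "l > 0"
  shows expectation_abs_mult_le: "expectation (\<lambda>\<omega>. \<bar>X \<omega> * Y \<omega>\<bar>) \<le> l * A + B / l"
proof -
  have young: "\<bar>x * y\<bar> \<le> l * x\<^sup>2 + y\<^sup>2 / l" for x y :: real
  proof -
    have "0 \<le> (l * \<bar>x\<bar> - \<bar>y\<bar>)\<^sup>2 / l" using \<open>l > 0\<close> by simp
    also have "\<dots> = l * x\<^sup>2 + y\<^sup>2 / l - 2 * \<bar>x * y\<bar>"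
      using \<open>l > 0\<close> by (simp add: power2_diff power_mult_distrib abs_mult field_simps power2_eq_square)
    finally have "2 * \<bar>x * y\<bar> \<le> l * x\<^sup>2 + y\<^sup>2 / l" by linarith
    then show ?thesis using abs_ge_zero[of "x * y"] by linarith
  qed
  have "expectation (\<lambda>\<omega>. \<bar>X \<omega> * Y \<omega>\<bar>) \<le> expectation (\<lambda>\<omega>. l * (X \<omega>)\<^sup>2 + (Y \<omega>)\<^sup>2 / l)"
    using X Y integrable_mult_of_squares[OF assms(1-4)] young by (intro integral_mono) auto
  also have "\<dots> = l * expectation (\<lambda>\<omega>. (X \<omega>)\<^sup>2) + expectation (\<lambda>\<omega>. (Y \<omega>)\<^sup>2) / l"
    using X Y by simp
  also have "\<dots> \<le> l * A + B / l"
    using A B \<open>l > 0\<close> by (intro add_mono mult_left_mono divide_right_mono) auto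
  finally show ?thesis .
qed

context ar_stochastic_volatility
begin

definition eps_fourth_moment :: real where
  "eps_fourth_moment = expectation (\<lambda>\<omega>. (eps 1 \<omega>) ^ 4)"

lemma expectation_eps_fourth:
  assumes "1 \<le> t"
  shows "expectation (\<lambda>\<omega>. (eps t \<omega>) ^ 4) = eps_fourth_moment"
proof -
  have "expectation (\<lambda>\<omega>. (eps s \<omega>) ^ 4) = integral\<^sup>L (distr M borel (eps s)) (\<lambda>x. x ^ 4)" if "1 \<le> s" for s
    using eps_measurable[OF that] by (subst integral_distr) auto
  then show ?thesis using assms eps_ident[OF assms] by (simp add: eps_fourth_moment_def)
qed

lemma eps_fourth_moment_nonneg: "0 \<le> eps_fourth_moment"
  by (simp add: eps_fourth_moment_def)

lemma integrable_eps_sq: "1 \<le> t \<Longrightarrow> integrable M (\<lambda>\<omega>. (eps t \<omega>)\<^sup>2)"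
  using square_integrable_imp_integrable[of "\<lambda>\<omega>. (eps t \<omega>)\<^sup>2"] eps_measurable[of t] eps_fourth[of t]
  by (simp flip: power_mult)

lemma integrable_eps: "1 \<le> t \<Longrightarrow> integrable M (eps t)"
  using square_integrable_imp_integrable eps_measurable integrable_eps_sq by blast

lemma
  assumes t: "1 \<le> t"
  shows integrable_eps_cube: "integrable M (\<lambda>\<omega>. \<bar>eps t \<omega>\<bar> ^ 3)"
    and expectation_eps_cube_le: "expectation (\<lambda>\<omega>. \<bar>eps t \<omega>\<bar> ^ 3) \<le> 1 + eps_fourth_moment"
proof -
  have int: "integrable M (\<lambda>\<omega>. (eps t \<omega>)\<^sup>2 + (eps t \<omega>) ^ 4)"
    using integrable_eps_sq[OF t] eps_fourth[OF t] by simp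
  note [measurable] = eps_measurable[OF t]
  show i3: "integrable M (\<lambda>\<omega>. \<bar>eps t \<omega>\<bar> ^ 3)"
    by (rule Bochner_Integration.integrable_bound[OF int])
      (auto intro!: AE_I2 order_trans[OF abs_cube_le] simp: power_abs)
  have "expectation (\<lambda>\<omega>. \<bar>eps t \<omega>\<bar> ^ 3) \<le> expectation (\<lambda>\<omega>. (eps t \<omega>)\<^sup>2 + (eps t \<omega>) ^ 4)"
    by (rule integral_mono[OF i3 int]) (rule abs_cube_le)
  also have "\<dots> = 1 + eps_fourth_moment"
    using integrable_eps_sq[OF t] eps_fourth[OF t] eps_var[OF t] expectation_eps_fourth[OF t] by simp
  finally show "expectation (\<lambda>\<omega>. \<bar>eps t \<omega>\<bar> ^ 3) \<le> 1 + eps_fourth_moment" .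
qed

text \<open>The constants in the bounds for a single row.  None of them depends on the row.\<close>

definition fourth_const :: "real \<Rightarrow> real" where
  "fourth_const c = 1 + 256 / c\<^sup>2 + 6 * eps_fourth_moment / c"

definition quad_const :: "real \<Rightarrow> real" where
  "quad_const c = sqrt eps_fourth_moment + sqrt (12 / \<alpha>\<^sup>2) + 2 * sqrt (fourth_const c + 1) + 2 * (fourth_const c + 1)"

definition diff_const :: "real \<Rightarrow> real" where
  "diff_const c = 3 * eps_fourth_moment + 12 * (fourth_const c + 1) + 12 * c\<^sup>2 * fourth_const c"

definition cov_const :: "real \<Rightarrow> real" where
  "cov_const c = diff_const c + 2 * fourth_const c + 36 / \<alpha>\<^sup>2"

text \<open>The statistics are normalised with the stationary mean; the passage to \<^const>\<open>mean_vol\<close>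
  is made in the limit.\<close>

definition norm_sum_squares :: "nat \<Rightarrow> 'a \<Rightarrow> real" where
  "norm_sum_squares n \<omega> = (\<Sum>t=1..n. (y n (t - 1) \<omega>)\<^sup>2) / (real n * k n * stat_mean n)"

definition norm_score :: "nat \<Rightarrow> 'a \<Rightarrow> real" where
  "norm_score n \<omega> = (\<Sum>t=1..n. y n (t - 1) \<omega> * vol n t \<omega> * eps t \<omega>) / (sqrt (real n * k n) * stat_mean n)"

text \<open>A bound on the \<open>L\<^sup>1\<close> distance of the conditional variance of \<open>norm_score\<close> from \<open>1 / (2 c)\<close>: the first
  line stems from the sum of squares, the second from its correlation with the volatility.\<close>

definition cond_var_error :: "real \<Rightarrow> nat \<Rightarrow> real" where
  "cond_var_error c n =
     quad_const c / c * (sqrt (k n * vol_scale n ^ 4 / real n) + k n * vol_scale n ^ 4 / real n) + 1 / (2 * k n)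
     + cov_const c * (vol_scale n ^ 4 / root 4 (k n) + root 4 (k n) * vol_scale n ^ 4 / real n)"

lemma past_measurable:
  assumes "1 \<le> n" "f \<in> measurable (past n t) S"
  shows "random_variable S f"
proof -
  have "subalgebra M (past n t)"
    using past_indep[OF assms(1), of t] by (simp add: subalgebra_def indep_sets2_eq)
  then show ?thesis using measurable_from_subalg assms(2) by blast
qed

lemma y_Suc:
  "1 \<le> n \<Longrightarrow> Suc t \<le> n \<Longrightarrow> \<omega> \<in> space M \<Longrightarrow>
    y n (Suc t) \<omega> = \<rho> n * y n t \<omega> + vol n (Suc t) \<omega> * eps (Suc t) \<omega>"
  using y_rec[of "Suc t" n \<omega>] u_eq[of "Suc t" n \<omega>] by simp

lemma y_past:
  assumes n: "1 \<le> n"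
  shows "t \<le> n \<Longrightarrow> y n t \<in> borel_measurable (past n t)"
proof (induction t)
  case 0
  show ?case by (rule y0_past)
next
  case (Suc t)
  interpret innovation_filtration M n "past n" eps by (rule past_filtration[OF n])
  have [measurable]: "y n t \<in> borel_measurable (past n (Suc t))"
    using measurable_F_mono[of "y n t" t borel "Suc t"] Suc by simp
  note [measurable] = vol_past[OF n Suc.prems] eps_past[of "Suc t" "Suc t" n, simplified]
  have "(\<lambda>\<omega>. \<rho> n * y n t \<omega> + vol n (Suc t) \<omega> * eps (Suc t) \<omega>) \<in> borel_measurable (past n (Suc t))" by measurable
  then show ?case using y_Suc[OF n Suc.prems] by (subst measurable_cong) auto
qed

lemma norm_sum_squares_measurable: "random_variable borel (norm_sum_squares n)"
proof (cases "1 \<le> n")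
  case True
  show ?thesis
    unfolding norm_sum_squares_def[abs_def] using past_measurable[OF True y_past[OF True]]
    by (intro borel_measurable_divide borel_measurable_sum borel_measurable_power) auto
qed (simp add: norm_sum_squares_def[abs_def])

lemma norm_score_measurable: "random_variable borel (norm_score n)"
proof (cases "1 \<le> n")
  case True
  show ?thesis
    unfolding norm_score_def[abs_def]
    using past_measurable[OF True y_past[OF True]] past_measurable[OF True vol_past[OF True]] eps_measurable
    by (intro borel_measurable_divide borel_measurable_sum borel_measurable_times) auto
qed (simp add: norm_score_def[abs_def])

end

text \<open>A fixed row of the array, so late that \<open>\<rho> n\<close> lies in \<open>[0, 1)\<close>.\<close>

locale regular_row = ar_stochastic_volatility M d \<alpha> k r \<phi> \<rho> eps eta vol u y
  for M :: "'a measure" and d \<alpha> k r \<phi> \<rho> eps eta vol u y +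
  fixes c :: real and n :: nat
  assumes c_pos: "0 < c" and n: "1 \<le> n" and k_ge_one: "1 \<le> k n" and c_le_k: "c \<le> k n"
    and rho_eq: "\<rho> n = 1 - c / k n"
    and y0_fourth: "integrable M (\<lambda>\<omega>. (y n 0 \<omega>) ^ 4)"
    and y0_fourth_le: "expectation (\<lambda>\<omega>. (y n 0 \<omega>) ^ 4) \<le> (k n)\<^sup>2"
begin

sublocale innovation_filtration M n "past n" eps
  by (rule past_filtration[OF n])

abbreviation "\<sigma> \<equiv> vol n"
abbreviation "Y \<equiv> y n"
abbreviation "R \<equiv> vol_scale n"
abbreviation "\<mu> \<equiv> stat_mean n"

lemma rho_bounds: "0 \<le> \<rho> n" "\<rho> n \<le> 1" "\<rho> n ^ 4 \<le> 1 - c / k n" "(\<rho> n)\<^sup>2 \<le> 1" "c / k n \<le> 1"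
proof -
  show "c / k n \<le> 1" using c_le_k k_ge_one by simp
  show *: "0 \<le> \<rho> n" "\<rho> n \<le> 1" using c_pos c_le_k k_ge_one by (auto simp: rho_eq field_simps)
  have "\<rho> n ^ 4 \<le> \<rho> n ^ 1" using * by (intro power_decreasing) auto
  then show "\<rho> n ^ 4 \<le> 1 - c / k n" by (simp add: rho_eq)
  show "(\<rho> n)\<^sup>2 \<le> 1" using * by (simp add: power_le_one)
qed

lemma R_ge_one: "1 \<le> R" by (rule vol_scale_ge_one[OF n])

lemma mu_ge_one: "1 \<le> \<mu>" by (rule stat_mean_ge_one[OF n])

lemmas Y_Suc = y_Suc[OF n]

lemmas Y_past = y_past[OF n]

lemma Y_measurable: "t \<le> n \<Longrightarrow> random_variable borel (Y t)"
  using measurable_F_M[OF Y_past] by blast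

lemma vol_measurable: "t \<le> n \<Longrightarrow> random_variable borel (\<sigma> t)"
  using measurable_F_M[OF vol_past[OF n, of t 0]] by simp

lemmas vol_power = integrable_vol_power[OF n]

lemma vol_fourth_le: "t \<le> n \<Longrightarrow> expectation (\<lambda>\<omega>. (\<sigma> t \<omega>) ^ 4) \<le> R\<^sup>2"
  by (rule expectation_vol_power_le[OF n]) auto

lemma fourth_const_ge_one: "1 \<le> fourth_const c"
  using c_pos eps_fourth_moment_nonneg by (simp add: fourth_const_def)

text \<open>Averaging out the innovation leaves \<open>E Y\<^sub>t\<^sup>4 \<le> \<rho>\<^sup>4 E Y\<^bsub>t-1\<^esub>\<^sup>4 + 8 E Y\<^bsub>t-1\<^esub>\<^sup>2 \<sigma>\<^sub>t\<^sup>2 + 3 K E \<sigma>\<^sub>t\<^sup>4\<close>,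
  and the mixed term costs only half of the contraction \<open>c / k\<close> after a weighted Young inequality.\<close>

lemma Y_fourth_step:
  assumes t: "Suc t \<le> n" and Y4: "integrable M (\<lambda>\<omega>. (Y t \<omega>) ^ 4)"
  shows "integrable M (\<lambda>\<omega>. (Y (Suc t) \<omega>) ^ 4)"
    and "expectation (\<lambda>\<omega>. (Y (Suc t) \<omega>) ^ 4)
      \<le> (1 - c / (2 * k n)) * expectation (\<lambda>\<omega>. (Y t \<omega>) ^ 4) + (128 * k n / c + 3 * eps_fourth_moment) * R\<^sup>2"
proof -
  let ?t = "Suc t"
  have t1: "1 \<le> ?t" "?t \<le> n" "t \<le> n" using t by auto
  have YF: "Y t \<in> borel_measurable (past n (?t - 1))" using Y_past[of t] t by simp
  have vF: "\<sigma> ?t \<in> borel_measurable (past n (?t - 1))" by (rule vol_past[OF n t])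
  note [measurable] = Y_measurable[OF t1(3)] Y_measurable[OF t1(2)] vol_measurable[OF t1(2)] eps_measurable[OF t1(1)]
  have Y22: "integrable M (\<lambda>\<omega>. ((Y t \<omega>)\<^sup>2)\<^sup>2)" "integrable M (\<lambda>\<omega>. ((\<sigma> ?t \<omega>)\<^sup>2)\<^sup>2)"
    using Y4 vol_power[OF t1(2), of 4] by (simp_all flip: power_mult)
  have i1: "integrable M (\<lambda>\<omega>. (Y t \<omega>) ^ 3 * \<sigma> ?t \<omega>)"
  proof (rule Bochner_Integration.integrable_bound)
    show "integrable M (\<lambda>\<omega>. (Y t \<omega>) ^ 4 + (\<sigma> ?t \<omega>) ^ 4)" using Y4 vol_power[OF t1(2), of 4] by simp
    show "AE \<omega> in M. norm ((Y t \<omega>) ^ 3 * \<sigma> ?t \<omega>) \<le> norm ((Y t \<omega>) ^ 4 + (\<sigma> ?t \<omega>) ^ 4)"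
      using abs_cube_mult_le by (auto intro!: AE_I2 order_trans[OF abs_cube_mult_le] simp del: abs_mult)
  qed measurable
  have i2: "integrable M (\<lambda>\<omega>. (Y t \<omega>)\<^sup>2 * (\<sigma> ?t \<omega>)\<^sup>2)"
    by (rule integrable_mult_of_squares) (use Y22 in auto)
  have m1: "(\<lambda>\<omega>. (Y t \<omega>) ^ 3 * \<sigma> ?t \<omega>) \<in> borel_measurable (past n (?t - 1))"
    and m2: "(\<lambda>\<omega>. (Y t \<omega>)\<^sup>2 * (\<sigma> ?t \<omega>)\<^sup>2) \<in> borel_measurable (past n (?t - 1))"
    and m4: "(\<lambda>\<omega>. (\<sigma> ?t \<omega>) ^ 4) \<in> borel_measurable (past n (?t - 1))"
    by (intro borel_measurable_times borel_measurable_power YF vF)+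
  have g: "(\<lambda>x :: real. x) \<in> borel_measurable borel" "(\<lambda>x :: real. x\<^sup>2) \<in> borel_measurable borel"
    "(\<lambda>x :: real. x ^ 4) \<in> borel_measurable borel" by measurable
  note e1 = integrable_past_innovation[OF t1(1,2) m1 i1 g(1) integrable_eps[OF t1(1)]]
    expectation_past_innovation[OF t1(1,2) m1 i1 g(1) integrable_eps[OF t1(1)], unfolded eps_mean[OF t1(1)] mult_zero_right]
  note e2 = integrable_past_innovation[OF t1(1,2) m2 i2 g(2) integrable_eps_sq[OF t1(1)]]
    expectation_past_innovation[OF t1(1,2) m2 i2 g(2) integrable_eps_sq[OF t1(1)], unfolded eps_var[OF t1(1)] mult_1_right]
  note e4 = integrable_past_innovation[OF t1(1,2) m4 vol_power[OF t1(2), of 4] g(3) eps_fourth[OF t1(1)]]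
    expectation_past_innovation[OF t1(1,2) m4 vol_power[OF t1(2), of 4] g(3) eps_fourth[OF t1(1)],
      unfolded expectation_eps_fourth[OF t1(1)]]
  let ?G = "\<lambda>\<omega>. \<rho> n ^ 4 * (Y t \<omega>) ^ 4 + 4 * \<rho> n ^ 3 * ((Y t \<omega>) ^ 3 * \<sigma> ?t \<omega> * eps ?t \<omega>)
      + 8 * (\<rho> n)\<^sup>2 * ((Y t \<omega>)\<^sup>2 * (\<sigma> ?t \<omega>)\<^sup>2 * (eps ?t \<omega>)\<^sup>2) + 3 * ((\<sigma> ?t \<omega>) ^ 4 * (eps ?t \<omega>) ^ 4)"
  have G: "integrable M ?G"
    by (intro Bochner_Integration.integrable_add integrable_mult_right Y4 e1(1) e2(1) e4(1))
  have le: "(Y ?t \<omega>) ^ 4 \<le> ?G \<omega>" if "\<omega> \<in> space M" for \<omega>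
    unfolding Y_Suc[OF t that] using power4_add_le[of "\<rho> n * Y t \<omega>" "\<sigma> ?t \<omega> * eps ?t \<omega>"]
    by (simp add: power_mult_distrib mult_ac)
  show i: "integrable M (\<lambda>\<omega>. (Y ?t \<omega>) ^ 4)"
    by (rule Bochner_Integration.integrable_bound[OF G]) (use le in \<open>auto intro!: AE_I2 order_trans[OF le]\<close>)
  have "expectation (\<lambda>\<omega>. (Y ?t \<omega>) ^ 4) \<le> expectation ?G"
    by (rule integral_mono[OF i G]) (rule le)
  also have "\<dots> = \<rho> n ^ 4 * expectation (\<lambda>\<omega>. (Y t \<omega>) ^ 4) + 8 * (\<rho> n)\<^sup>2 * expectation (\<lambda>\<omega>. (Y t \<omega>)\<^sup>2 * (\<sigma> ?t \<omega>)\<^sup>2)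
      + 3 * (expectation (\<lambda>\<omega>. (\<sigma> ?t \<omega>) ^ 4) * eps_fourth_moment)"
    using Y4 e1 e2 e4 by simp
  also have "\<dots> \<le> (1 - c / k n) * expectation (\<lambda>\<omega>. (Y t \<omega>) ^ 4)
      + 8 * 1 * (c / (16 * k n) * expectation (\<lambda>\<omega>. (Y t \<omega>) ^ 4) + R\<^sup>2 / (c / (16 * k n)))
      + 3 * (R\<^sup>2 * eps_fourth_moment)"
  proof (intro add_mono mult_mono mult_left_mono mult_right_mono)
    \<comment> \<open>With the factor \<open>8\<close> in front, the weight \<open>c / (16 k)\<close> costs exactly half of the contraction.\<close>
    have "expectation (\<lambda>\<omega>. (Y t \<omega>)\<^sup>2 * (\<sigma> ?t \<omega>)\<^sup>2) = expectation (\<lambda>\<omega>. \<bar>(Y t \<omega>)\<^sup>2 * (\<sigma> ?t \<omega>)\<^sup>2\<bar>)" by simp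
    also have "\<dots> \<le> c / (16 * k n) * expectation (\<lambda>\<omega>. (Y t \<omega>) ^ 4) + R\<^sup>2 / (c / (16 * k n))"
      using Y22 vol_fourth_le[OF t1(2)] c_pos k_ge_one by (intro expectation_abs_mult_le) (auto simp flip: power_mult)
    finally show "expectation (\<lambda>\<omega>. (Y t \<omega>)\<^sup>2 * (\<sigma> ?t \<omega>)\<^sup>2)
      \<le> c / (16 * k n) * expectation (\<lambda>\<omega>. (Y t \<omega>) ^ 4) + R\<^sup>2 / (c / (16 * k n))" .
  qed (use rho_bounds vol_fourth_le[OF t1(2)] eps_fourth_moment_nonneg in auto)
  also have "\<dots> = (1 - c / (2 * k n)) * expectation (\<lambda>\<omega>. (Y t \<omega>) ^ 4) + (128 * k n / c + 3 * eps_fourth_moment) * R\<^sup>2"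
    using c_pos k_ge_one by (simp add: field_simps)
  finally show "expectation (\<lambda>\<omega>. (Y ?t \<omega>) ^ 4)
      \<le> (1 - c / (2 * k n)) * expectation (\<lambda>\<omega>. (Y t \<omega>) ^ 4) + (128 * k n / c + 3 * eps_fourth_moment) * R\<^sup>2" .
qed

lemma Y_fourth:
  assumes "t \<le> n"
  shows "integrable M (\<lambda>\<omega>. (Y t \<omega>) ^ 4)" and "expectation (\<lambda>\<omega>. (Y t \<omega>) ^ 4) \<le> fourth_const c * (k n)\<^sup>2 * R\<^sup>2"
proof -
  \<comment> \<open>The recursion \<open>x \<mapsto> (1 - c / (2 k)) x + B\<close> has the fixed point \<open>2 k B / c\<close>.\<close>
  define B where "B = (128 * k n / c + 3 * eps_fourth_moment) * R\<^sup>2"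
  define X where "X = (k n)\<^sup>2 + 2 * k n / c * B"
  have k: "0 < k n" using k_ge_one by simp
  have "integrable M (\<lambda>\<omega>. (Y t \<omega>) ^ 4) \<and> expectation (\<lambda>\<omega>. (Y t \<omega>) ^ 4) \<le> X"
    using assms
  proof (induction t)
    case 0
    have "0 \<le> 2 * k n / c * B" using k c_pos eps_fourth_moment_nonneg by (simp add: B_def)
    then show ?case using y0_fourth y0_fourth_le by (simp add: X_def)
  next
    case (Suc t)
    have "expectation (\<lambda>\<omega>. (Y (Suc t) \<omega>) ^ 4) \<le> (1 - c / (2 * k n)) * expectation (\<lambda>\<omega>. (Y t \<omega>) ^ 4) + B"
      using Y_fourth_step(2)[OF Suc.prems] Suc by (simp add: B_def)
    also have "\<dots> \<le> (1 - c / (2 * k n)) * X + B"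
      using Suc c_le_k c_pos k by (intro add_right_mono mult_left_mono) (auto simp: field_simps)
    also have "\<dots> = X - c * k n / 2" using c_pos k by (simp add: X_def field_simps power2_eq_square)
    also have "\<dots> \<le> X" using c_pos k by simp
    finally show ?case using Y_fourth_step(1)[OF Suc.prems] Suc by simp
  qed
  moreover have "X \<le> fourth_const c * (k n)\<^sup>2 * R\<^sup>2"
  proof -
    have R2: "1 \<le> R\<^sup>2" using R_ge_one by simp
    have "2 * k n / c * B = 256 / c\<^sup>2 * (k n)\<^sup>2 * R\<^sup>2 + 6 * eps_fourth_moment / c * k n * R\<^sup>2"
      using c_pos by (simp add: B_def field_simps power2_eq_square)
    also have "\<dots> \<le> 256 / c\<^sup>2 * (k n)\<^sup>2 * R\<^sup>2 + 6 * eps_fourth_moment / c * (k n)\<^sup>2 * R\<^sup>2"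
      using c_pos eps_fourth_moment_nonneg k_ge_one
      by (intro add_left_mono mult_right_mono mult_left_mono) (auto simp: power2_eq_square mult_le_cancel_left1)
    finally have 1: "2 * k n / c * B \<le> 256 / c\<^sup>2 * (k n)\<^sup>2 * R\<^sup>2 + 6 * eps_fourth_moment / c * (k n)\<^sup>2 * R\<^sup>2" .
    have 2: "(k n)\<^sup>2 \<le> (k n)\<^sup>2 * R\<^sup>2" using R2 by (simp add: mult_le_cancel_left1)
    show ?thesis using 1 2 by (simp add: X_def fourth_const_def algebra_simps)
  qed
  ultimately show "integrable M (\<lambda>\<omega>. (Y t \<omega>) ^ 4)" "expectation (\<lambda>\<omega>. (Y t \<omega>) ^ 4) \<le> fourth_const c * (k n)\<^sup>2 * R\<^sup>2"
    by auto
qed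

lemma Y_sq_square_integrable: "t \<le> n \<Longrightarrow> integrable M (\<lambda>\<omega>. ((Y t \<omega>)\<^sup>2)\<^sup>2)"
  using Y_fourth(1) by (simp flip: power_mult)

text \<open>The fourth moment is of order \<open>k\<^sup>2\<close>; weighting by \<open>1 / k\<close> turns it into the order \<open>k\<close> of the second.\<close>

lemma Y_sq:
  assumes "t \<le> n"
  shows "integrable M (\<lambda>\<omega>. (Y t \<omega>)\<^sup>2)" and "expectation (\<lambda>\<omega>. (Y t \<omega>)\<^sup>2) \<le> (fourth_const c + 1) * k n * R\<^sup>2"
proof -
  note [measurable] = Y_measurable[OF assms]
  show "integrable M (\<lambda>\<omega>. (Y t \<omega>)\<^sup>2)"
    by (rule square_integrable_imp_integrable) (use Y_sq_square_integrable[OF assms] in auto)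
  have k: "0 < k n" using k_ge_one by simp
  have "expectation (\<lambda>\<omega>. (Y t \<omega>)\<^sup>2) = expectation (\<lambda>\<omega>. \<bar>(Y t \<omega>)\<^sup>2 * 1\<bar>)" by simp
  also have "\<dots> \<le> 1 / k n * (fourth_const c * (k n)\<^sup>2 * R\<^sup>2) + 1 / (1 / k n)"
    using Y_sq_square_integrable[OF assms] Y_fourth(2)[OF assms] k
    by (intro expectation_abs_mult_le) (auto simp: prob_space simp flip: power_mult)
  also have "\<dots> = fourth_const c * k n * R\<^sup>2 + k n" using k by (simp add: power2_eq_square)
  also have "\<dots> \<le> (fourth_const c + 1) * k n * R\<^sup>2"
    using R_ge_one k by (simp add: algebra_simps)
  finally show "expectation (\<lambda>\<omega>. (Y t \<omega>)\<^sup>2) \<le> (fourth_const c + 1) * k n * R\<^sup>2" .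
qed

lemma Y_vol_sq:
  assumes "s \<le> n" "t \<le> n"
  shows "integrable M (\<lambda>\<omega>. (Y s \<omega> * \<sigma> t \<omega>)\<^sup>2)"
    and "expectation (\<lambda>\<omega>. (Y s \<omega> * \<sigma> t \<omega>)\<^sup>2) \<le> (fourth_const c + 1) * k n * R\<^sup>2"
proof -
  note [measurable] = Y_measurable[OF assms(1)] vol_measurable[OF assms(2)]
  have v: "integrable M (\<lambda>\<omega>. ((\<sigma> t \<omega>)\<^sup>2)\<^sup>2)"
    using vol_power[OF assms(2), of 4] by (simp flip: power_mult)
  show "integrable M (\<lambda>\<omega>. (Y s \<omega> * \<sigma> t \<omega>)\<^sup>2)"
    unfolding power_mult_distrib
    by (rule integrable_mult_of_squares) (use v Y_sq_square_integrable[OF assms(1)] in auto)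
  have k: "0 < k n" using k_ge_one by simp
  have "expectation (\<lambda>\<omega>. (Y s \<omega> * \<sigma> t \<omega>)\<^sup>2) = expectation (\<lambda>\<omega>. \<bar>(Y s \<omega>)\<^sup>2 * (\<sigma> t \<omega>)\<^sup>2\<bar>)"
    by (simp add: power_mult_distrib)
  also have "\<dots> \<le> 1 / k n * (fourth_const c * (k n)\<^sup>2 * R\<^sup>2) + R\<^sup>2 / (1 / k n)"
    using v Y_sq_square_integrable[OF assms(1)] Y_fourth(2)[OF assms(1)] vol_fourth_le[OF assms(2)] k
    by (intro expectation_abs_mult_le) (auto simp flip: power_mult)
  also have "\<dots> = (fourth_const c + 1) * k n * R\<^sup>2" using k by (simp add: power2_eq_square algebra_simps)
  finally show "expectation (\<lambda>\<omega>. (Y s \<omega> * \<sigma> t \<omega>)\<^sup>2) \<le> (fourth_const c + 1) * k n * R\<^sup>2" .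
qed

text \<open>To bound a fourth moment of \<open>Y \<sigma>\<close> in this way would take more than four moments of \<open>Y\<close>, which need not
  exist.  The split is Young's inequality with exponents \<open>4/3\<close> and \<open>4\<close>.\<close>

lemma Y_vol_cube:
  assumes "s \<le> n" "t \<le> n"
  shows "integrable M (\<lambda>\<omega>. \<bar>Y s \<omega> * \<sigma> t \<omega>\<bar> ^ 3)"
    and "expectation (\<lambda>\<omega>. \<bar>Y s \<omega> * \<sigma> t \<omega>\<bar> ^ 3) \<le> (fourth_const c + 1) * sqrt (k n) ^ 3 * R ^ 18"
proof -
  define q where "q = sqrt (k n)"
  have q: "0 < q" "q\<^sup>2 = k n" using k_ge_one by (auto simp: q_def)
  note [measurable] = Y_measurable[OF assms(1)] vol_measurable[OF assms(2)]
  have le: "\<bar>Y s \<omega> * \<sigma> t \<omega>\<bar> ^ 3 \<le> q ^ 3 * ((Y s \<omega>) ^ 4 / (k n)\<^sup>2 + (\<sigma> t \<omega>) ^ 12)" for \<omega>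
  proof -
    have "\<bar>Y s \<omega> * \<sigma> t \<omega>\<bar> ^ 3 = q ^ 3 * \<bar>(Y s \<omega> / q) ^ 3 * (\<sigma> t \<omega>) ^ 3\<bar>"
      using q(1) by (simp add: abs_mult power_mult_distrib power_abs power_divide)
    also have "\<bar>(Y s \<omega> / q) ^ 3 * (\<sigma> t \<omega>) ^ 3\<bar> \<le> (Y s \<omega> / q) ^ 4 + ((\<sigma> t \<omega>) ^ 3) ^ 4"
      by (rule abs_cube_mult_le)
    also have "(Y s \<omega> / q) ^ 4 = (Y s \<omega>) ^ 4 / (k n)\<^sup>2"
      unfolding q(2)[symmetric] by (simp add: power_divide flip: power_mult)
    also have "((\<sigma> t \<omega>) ^ 3) ^ 4 = (\<sigma> t \<omega>) ^ 12" by (simp flip: power_mult)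
    finally show ?thesis using q(1) by (simp add: mult_left_mono)
  qed
  have int: "integrable M (\<lambda>\<omega>. q ^ 3 * ((Y s \<omega>) ^ 4 / (k n)\<^sup>2 + (\<sigma> t \<omega>) ^ 12))"
    using Y_fourth(1)[OF assms(1)] vol_power[OF assms(2), of 12] by simp
  show i: "integrable M (\<lambda>\<omega>. \<bar>Y s \<omega> * \<sigma> t \<omega>\<bar> ^ 3)"
    by (rule Bochner_Integration.integrable_bound[OF int]) (auto intro!: AE_I2 order_trans[OF le] simp: power_abs)
  have "expectation (\<lambda>\<omega>. \<bar>Y s \<omega> * \<sigma> t \<omega>\<bar> ^ 3) \<le> expectation (\<lambda>\<omega>. q ^ 3 * ((Y s \<omega>) ^ 4 / (k n)\<^sup>2 + (\<sigma> t \<omega>) ^ 12))"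
    by (rule integral_mono[OF i int]) (rule le)
  also have "\<dots> = q ^ 3 * (expectation (\<lambda>\<omega>. (Y s \<omega>) ^ 4) / (k n)\<^sup>2 + expectation (\<lambda>\<omega>. (\<sigma> t \<omega>) ^ 12))"
    using Y_fourth(1)[OF assms(1)] vol_power[OF assms(2), of 12] by simp
  also have "\<dots> \<le> q ^ 3 * (fourth_const c * R ^ 18 + R ^ 18)"
  proof (intro mult_left_mono add_mono)
    have "expectation (\<lambda>\<omega>. (Y s \<omega>) ^ 4) / (k n)\<^sup>2 \<le> fourth_const c * R\<^sup>2"
      using Y_fourth(2)[OF assms(1)] k_ge_one by (simp add: field_simps)
    also have "\<dots> \<le> fourth_const c * R ^ 18"
      using R_ge_one fourth_const_ge_one by (intro mult_left_mono power_increasing) auto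
    finally show "expectation (\<lambda>\<omega>. (Y s \<omega>) ^ 4) / (k n)\<^sup>2 \<le> fourth_const c * R ^ 18" .
    show "expectation (\<lambda>\<omega>. (\<sigma> t \<omega>) ^ 12) \<le> R ^ 18" by (rule expectation_vol_power_le[OF n assms(2)]) simp
  qed (use q in auto)
  also have "\<dots> = (fourth_const c + 1) * sqrt (k n) ^ 3 * R ^ 18" by (simp add: q_def algebra_simps)
  finally show "expectation (\<lambda>\<omega>. \<bar>Y s \<omega> * \<sigma> t \<omega>\<bar> ^ 3) \<le> (fourth_const c + 1) * sqrt (k n) ^ 3 * R ^ 18" .
qed

end

section \<open>The sums of squares in a row\<close>

context regular_row
begin

lemma innovation_sum_bound:
  assumes b: "\<And>t. 1 \<le> t \<Longrightarrow> t \<le> n \<Longrightarrow> b t \<in> borel_measurable (past n (t - 1))"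
    and b2: "\<And>t. 1 \<le> t \<Longrightarrow> t \<le> n \<Longrightarrow> integrable M (\<lambda>\<omega>. (b t \<omega>)\<^sup>2)"
  shows "integrable M (\<lambda>\<omega>. \<Sum>t=1..n. b t \<omega> * eps t \<omega>)"
    and "expectation (\<lambda>\<omega>. \<bar>\<Sum>t=1..n. b t \<omega> * eps t \<omega>\<bar>) \<le> sqrt (\<Sum>t=1..n. expectation (\<lambda>\<omega>. (b t \<omega>)\<^sup>2))"
proof -
  have g: "(\<lambda>x :: real. x) \<in> borel_measurable borel" by measurable
  note S = martingale_sum_adapted[OF g _ _ _ b b2 order_refl, of 1]
    martingale_sum_square_integrable[OF g _ _ _ b b2 order_refl, of 1]
    martingale_sum_square_le[OF g _ _ _ b b2 order_refl, of 1]
  have ad: "(\<lambda>\<omega>. \<Sum>t=1..n. b t \<omega> * eps t \<omega>) \<in> borel_measurable (past n n)"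
    by (rule S(1)) (use integrable_eps_sq eps_mean eps_var in auto)
  have m: "random_variable borel (\<lambda>\<omega>. \<Sum>t=1..n. b t \<omega> * eps t \<omega>)"
    by (rule measurable_F_M[OF ad order_refl])
  have sq: "integrable M (\<lambda>\<omega>. (\<Sum>t=1..n. b t \<omega> * eps t \<omega>)\<^sup>2)"
    by (rule S(2)) (use integrable_eps_sq eps_mean eps_var in auto)
  show "integrable M (\<lambda>\<omega>. \<Sum>t=1..n. b t \<omega> * eps t \<omega>)"
    by (rule square_integrable_imp_integrable[OF m sq])
  have "expectation (\<lambda>\<omega>. (\<Sum>t=1..n. b t \<omega> * eps t \<omega>)\<^sup>2) \<le> 1 * (\<Sum>t=1..n. expectation (\<lambda>\<omega>. (b t \<omega>)\<^sup>2))"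
    by (rule S(3)) (use integrable_eps_sq eps_mean eps_var in auto)
  then show "expectation (\<lambda>\<omega>. \<bar>\<Sum>t=1..n. b t \<omega> * eps t \<omega>\<bar>) \<le> sqrt (\<Sum>t=1..n. expectation (\<lambda>\<omega>. (b t \<omega>)\<^sup>2))"
    by (intro expectation_abs_le_sqrt m sq) simp
qed

lemma
  shows score_integrable: "integrable M (\<lambda>\<omega>. \<Sum>t=1..n. Y (t - 1) \<omega> * \<sigma> t \<omega> * eps t \<omega>)"
    and score_bound: "expectation (\<lambda>\<omega>. \<bar>\<Sum>t=1..n. Y (t - 1) \<omega> * \<sigma> t \<omega> * eps t \<omega>\<bar>)
      \<le> sqrt (real n * ((fourth_const c + 1) * k n * R\<^sup>2))"
proof -
  have m: "(\<lambda>\<omega>. Y (t - 1) \<omega> * \<sigma> t \<omega>) \<in> borel_measurable (past n (t - 1))" if "1 \<le> t" "t \<le> n" for t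
    using Y_past[of "t - 1"] vol_past[OF n, of t "t - 1"] that by (intro borel_measurable_times) auto
  have b2: "integrable M (\<lambda>\<omega>. (Y (t - 1) \<omega> * \<sigma> t \<omega>)\<^sup>2)"
    and B: "expectation (\<lambda>\<omega>. (Y (t - 1) \<omega> * \<sigma> t \<omega>)\<^sup>2) \<le> (fourth_const c + 1) * k n * R\<^sup>2" if "1 \<le> t" "t \<le> n" for t
    using Y_vol_sq[of "t - 1" t] that by simp_all
  note * = innovation_sum_bound[of "\<lambda>t \<omega>. Y (t - 1) \<omega> * \<sigma> t \<omega>", OF m b2]
  show "integrable M (\<lambda>\<omega>. \<Sum>t=1..n. Y (t - 1) \<omega> * \<sigma> t \<omega> * eps t \<omega>)"
    using *(1) by simp
  have "(\<Sum>t=1..n. expectation (\<lambda>\<omega>. (Y (t - 1) \<omega> * \<sigma> t \<omega>)\<^sup>2)) \<le> (\<Sum>t=1..n. (fourth_const c + 1) * k n * R\<^sup>2)"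
    by (rule sum_mono) (use B in auto)
  then have "sqrt (\<Sum>t=1..n. expectation (\<lambda>\<omega>. (Y (t - 1) \<omega> * \<sigma> t \<omega>)\<^sup>2)) \<le> sqrt (real n * ((fourth_const c + 1) * k n * R\<^sup>2))"
    by simp
  with *(2) show "expectation (\<lambda>\<omega>. \<bar>\<Sum>t=1..n. Y (t - 1) \<omega> * \<sigma> t \<omega> * eps t \<omega>\<bar>)
      \<le> sqrt (real n * ((fourth_const c + 1) * k n * R\<^sup>2))" by linarith
qed

lemma
  shows noise_integrable: "integrable M (\<lambda>\<omega>. \<Sum>t=1..n. (\<sigma> t \<omega>)\<^sup>2 * ((eps t \<omega>)\<^sup>2 - 1))"
    and noise_bound: "expectation (\<lambda>\<omega>. \<bar>\<Sum>t=1..n. (\<sigma> t \<omega>)\<^sup>2 * ((eps t \<omega>)\<^sup>2 - 1)\<bar>)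
      \<le> sqrt (real n * (R\<^sup>2 * eps_fourth_moment))"
proof -
  let ?g = "\<lambda>x :: real. x\<^sup>2 - 1" and ?b = "\<lambda>t \<omega>. (\<sigma> t \<omega>)\<^sup>2"
  have g: "?g \<in> borel_measurable borel" by measurable
  have b: "?b t \<in> borel_measurable (past n (t - 1))" if "1 \<le> t" "t \<le> n" for t
    using vol_past[OF n, of t "t - 1"] that by (intro borel_measurable_power) auto
  have sq: "(?g x)\<^sup>2 = x ^ 4 - 2 * x\<^sup>2 + 1" for x :: real
    by (simp add: power2_eq_square eval_nat_numeral algebra_simps)
  have g2: "integrable M (\<lambda>\<omega>. (?g (eps t \<omega>))\<^sup>2)" if "1 \<le> t" for t
    unfolding sq using integrable_eps_sq[OF that] eps_fourth[OF that] by simp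
  have gm: "expectation (\<lambda>\<omega>. ?g (eps t \<omega>)) = 0" if "1 \<le> t" for t
    using integrable_eps_sq[OF that] eps_var[OF that] by (simp add: prob_space)
  have gv: "expectation (\<lambda>\<omega>. (?g (eps t \<omega>))\<^sup>2) \<le> eps_fourth_moment" if "1 \<le> t" for t
    unfolding sq using integrable_eps_sq[OF that] eps_fourth[OF that] eps_var[OF that] expectation_eps_fourth[OF that]
    by (simp add: prob_space)
  have b2: "integrable M (\<lambda>\<omega>. (?b t \<omega>)\<^sup>2)" "expectation (\<lambda>\<omega>. (?b t \<omega>)\<^sup>2) \<le> R\<^sup>2" if "t \<le> n" for t
    using vol_power[OF that, of 4] vol_fourth_le[OF that] by (simp_all flip: power_mult)
  note S = martingale_sum_adapted[OF g g2 gm gv b b2(1) order_refl]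
    martingale_sum_square_integrable[OF g g2 gm gv b b2(1) order_refl]
    martingale_sum_square_le[OF g g2 gm gv b b2(1) order_refl]
  have m: "random_variable borel (\<lambda>\<omega>. \<Sum>t=1..n. ?b t \<omega> * ?g (eps t \<omega>))"
    by (rule measurable_F_M[OF S(1) order_refl])
  show "integrable M (\<lambda>\<omega>. \<Sum>t=1..n. ?b t \<omega> * ?g (eps t \<omega>))"
    by (rule square_integrable_imp_integrable[OF m S(2)])
  show "expectation (\<lambda>\<omega>. \<bar>\<Sum>t=1..n. ?b t \<omega> * ?g (eps t \<omega>)\<bar>) \<le> sqrt (real n * (R\<^sup>2 * eps_fourth_moment))"
  proof (rule expectation_abs_le_sqrt[OF m S(2)])
    have "(\<Sum>t=1..n. expectation (\<lambda>\<omega>. (?b t \<omega>)\<^sup>2)) \<le> (\<Sum>t=1..n. R\<^sup>2)"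
      by (rule sum_mono) (use b2(2) in auto)
    then have "eps_fourth_moment * (\<Sum>t=1..n. expectation (\<lambda>\<omega>. (?b t \<omega>)\<^sup>2)) \<le> eps_fourth_moment * (\<Sum>t=1..n. R\<^sup>2)"
      using eps_fourth_moment_nonneg by (rule mult_left_mono)
    with S(3) have "expectation (\<lambda>\<omega>. (\<Sum>t=1..n. ?b t \<omega> * ?g (eps t \<omega>))\<^sup>2) \<le> eps_fourth_moment * (\<Sum>t=1..n. R\<^sup>2)"
      by linarith
    then show "expectation (\<lambda>\<omega>. (\<Sum>t=1..n. ?b t \<omega> * ?g (eps t \<omega>))\<^sup>2) \<le> real n * (R\<^sup>2 * eps_fourth_moment)"
      by (simp add: mult_ac)
  qed
qed

lemma vol_dev_measurable: "t \<le> n \<Longrightarrow> random_variable borel (vol_dev n t)"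
  unfolding vol_dev_def[abs_def] using vol_measurable by simp

lemma vol_dev_sq_integrable: "t \<le> n \<Longrightarrow> integrable M (\<lambda>\<omega>. (vol_dev n t \<omega>)\<^sup>2)"
  using vol_power[of t 4] vol_power[of t 2] by (simp add: vol_dev_def power2_diff flip: power_mult)

lemma
  shows vol_dev_sum_integrable: "integrable M (\<lambda>\<omega>. \<Sum>t=1..n. vol_dev n t \<omega>)"
    and vol_dev_sum_bound: "expectation (\<lambda>\<omega>. \<bar>\<Sum>t=1..n. vol_dev n t \<omega>\<bar>) \<le> sqrt (12 / \<alpha>\<^sup>2 * R ^ 4 * real n)"
proof -
  have eq: "exp_filter 1 (vol_dev n) n = (\<lambda>\<omega>. \<Sum>t=1..n. vol_dev n t \<omega>)"
    by (simp add: exp_filter_def[abs_def])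
  note F = vol_filter_measurable[OF n order_refl, of 1] vol_filter_square_integrable[OF n order_refl, of 1]
    vol_filter_square_le[OF n order_refl, of 1]
  have m: "random_variable borel (\<lambda>\<omega>. \<Sum>t=1..n. vol_dev n t \<omega>)" using F(1) unfolding eq by simp
  have sq: "integrable M (\<lambda>\<omega>. (\<Sum>t=1..n. vol_dev n t \<omega>)\<^sup>2)" using F(2) unfolding eq by simp
  show "integrable M (\<lambda>\<omega>. \<Sum>t=1..n. vol_dev n t \<omega>)" by (rule square_integrable_imp_integrable[OF m sq])
  show "expectation (\<lambda>\<omega>. \<bar>\<Sum>t=1..n. vol_dev n t \<omega>\<bar>) \<le> sqrt (12 / \<alpha>\<^sup>2 * R ^ 4 * real n)"
    using F(3) unfolding eq by (intro expectation_abs_le_sqrt[OF m sq]) simp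
qed

text \<open>Summing \<open>Y\<^sub>t\<^sup>2 - \<rho>\<^sup>2 Y\<^bsub>t-1\<^esub>\<^sup>2 = u\<^sub>t\<^sup>2 + 2 \<rho> Y\<^bsub>t-1\<^esub> u\<^sub>t\<close> over time.\<close>

lemma sum_squares_identity:
  assumes w: "\<omega> \<in> space M" and m: "m \<le> n"
  shows "(1 - (\<rho> n)\<^sup>2) * (\<Sum>t=1..m. (Y (t - 1) \<omega>)\<^sup>2) - real m * \<mu>
     = (\<Sum>t=1..m. (\<sigma> t \<omega>)\<^sup>2 * ((eps t \<omega>)\<^sup>2 - 1)) + (\<Sum>t=1..m. vol_dev n t \<omega>)
     + 2 * \<rho> n * (\<Sum>t=1..m. Y (t - 1) \<omega> * \<sigma> t \<omega> * eps t \<omega>) - (Y m \<omega>)\<^sup>2 + (Y 0 \<omega>)\<^sup>2"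
  using m
proof (induction m)
  case (Suc m)
  have "(Y (Suc m) \<omega>)\<^sup>2 = (\<rho> n)\<^sup>2 * (Y m \<omega>)\<^sup>2 + 2 * \<rho> n * (Y m \<omega> * \<sigma> (Suc m) \<omega> * eps (Suc m) \<omega>)
      + (\<sigma> (Suc m) \<omega>)\<^sup>2 * (eps (Suc m) \<omega>)\<^sup>2"
    unfolding Y_Suc[OF Suc.prems w] by (simp add: power2_eq_square algebra_simps)
  note step = this
  let ?S = "\<Sum>t=1..m. (Y (t - 1) \<omega>)\<^sup>2"
  have "(1 - (\<rho> n)\<^sup>2) * (\<Sum>t=1..Suc m. (Y (t - 1) \<omega>)\<^sup>2) - real (Suc m) * \<mu>
      = ((1 - (\<rho> n)\<^sup>2) * ?S - real m * \<mu>) + ((1 - (\<rho> n)\<^sup>2) * (Y m \<omega>)\<^sup>2 - \<mu>)"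
    by (simp add: algebra_simps)
  also have "(1 - (\<rho> n)\<^sup>2) * ?S - real m * \<mu> = (\<Sum>t=1..m. (\<sigma> t \<omega>)\<^sup>2 * ((eps t \<omega>)\<^sup>2 - 1)) + (\<Sum>t=1..m. vol_dev n t \<omega>)
     + 2 * \<rho> n * (\<Sum>t=1..m. Y (t - 1) \<omega> * \<sigma> t \<omega> * eps t \<omega>) - (Y m \<omega>)\<^sup>2 + (Y 0 \<omega>)\<^sup>2"
    using Suc by simp
  finally show ?case
    using step by (simp add: vol_dev_def[of n "Suc m"] distrib_left right_diff_distrib left_diff_distrib mult.assoc)
qed simp

text \<open>In the identity for the sum of squares, the two martingales and the sum of the deviations have second moments of
  order \<open>n k\<close> or less, up to powers of \<open>vol_scale\<close>, and the boundary terms are of order \<open>k\<close>; all are small compared with \<open>n\<close>.\<close>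

lemma sum_squares_bound:
  shows "integrable M (\<lambda>\<omega>. \<Sum>t=1..n. (Y (t - 1) \<omega>)\<^sup>2)"
    and "expectation (\<lambda>\<omega>. \<bar>(1 - (\<rho> n)\<^sup>2) * (\<Sum>t=1..n. (Y (t - 1) \<omega>)\<^sup>2) - real n * \<mu>\<bar>)
     \<le> quad_const c * (sqrt (real n * (k n * R ^ 4)) + k n * R ^ 4)"
proof -
  show "integrable M (\<lambda>\<omega>. \<Sum>t=1..n. (Y (t - 1) \<omega>)\<^sup>2)"
    using Y_sq(1) by (intro Bochner_Integration.integrable_sum) auto
  let ?A = "\<lambda>\<omega>. \<Sum>t=1..n. (\<sigma> t \<omega>)\<^sup>2 * ((eps t \<omega>)\<^sup>2 - 1)" and ?B = "\<lambda>\<omega>. \<Sum>t=1..n. vol_dev n t \<omega>"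
    and ?C = "\<lambda>\<omega>. \<Sum>t=1..n. Y (t - 1) \<omega> * \<sigma> t \<omega> * eps t \<omega>"
  let ?s = "sqrt (real n * (k n * R ^ 4))"
  note int = noise_integrable vol_dev_sum_integrable score_integrable Y_sq(1)[OF order_refl] Y_sq(1)[of 0]
  have "expectation (\<lambda>\<omega>. \<bar>(1 - (\<rho> n)\<^sup>2) * (\<Sum>t=1..n. (Y (t - 1) \<omega>)\<^sup>2) - real n * \<mu>\<bar>)
      = expectation (\<lambda>\<omega>. \<bar>?A \<omega> + ?B \<omega> + 2 * \<rho> n * ?C \<omega> - (Y n \<omega>)\<^sup>2 + (Y 0 \<omega>)\<^sup>2\<bar>)"
    by (rule Bochner_Integration.integral_cong[OF refl]) (simp only: sum_squares_identity[OF _ order_refl])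
  also have "\<dots> \<le> expectation (\<lambda>\<omega>. \<bar>?A \<omega>\<bar> + \<bar>?B \<omega>\<bar> + 2 * \<bar>?C \<omega>\<bar> + (Y n \<omega>)\<^sup>2 + (Y 0 \<omega>)\<^sup>2)"
  proof (rule integral_mono)
    show "integrable M (\<lambda>\<omega>. \<bar>?A \<omega> + ?B \<omega> + 2 * \<rho> n * ?C \<omega> - (Y n \<omega>)\<^sup>2 + (Y 0 \<omega>)\<^sup>2\<bar>)"
      by (intro integrable_abs Bochner_Integration.integrable_add Bochner_Integration.integrable_diff integrable_mult_right int) simp
    show "integrable M (\<lambda>\<omega>. \<bar>?A \<omega>\<bar> + \<bar>?B \<omega>\<bar> + 2 * \<bar>?C \<omega>\<bar> + (Y n \<omega>)\<^sup>2 + (Y 0 \<omega>)\<^sup>2)"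
      by (intro integrable_abs Bochner_Integration.integrable_add integrable_mult_right int) simp
    fix \<omega>
    have "\<bar>2 * \<rho> n * ?C \<omega>\<bar> \<le> 2 * 1 * \<bar>?C \<omega>\<bar>"
      unfolding abs_mult using rho_bounds by (intro mult_right_mono) auto
    then show "\<bar>?A \<omega> + ?B \<omega> + 2 * \<rho> n * ?C \<omega> - (Y n \<omega>)\<^sup>2 + (Y 0 \<omega>)\<^sup>2\<bar>
        \<le> \<bar>?A \<omega>\<bar> + \<bar>?B \<omega>\<bar> + 2 * \<bar>?C \<omega>\<bar> + (Y n \<omega>)\<^sup>2 + (Y 0 \<omega>)\<^sup>2"
      using zero_le_power2[of "Y n \<omega>"] zero_le_power2[of "Y 0 \<omega>"] by linarith
  qed
  also have "\<dots> = expectation (\<lambda>\<omega>. \<bar>?A \<omega>\<bar>) + expectation (\<lambda>\<omega>. \<bar>?B \<omega>\<bar>) + 2 * expectation (\<lambda>\<omega>. \<bar>?C \<omega>\<bar>)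
      + expectation (\<lambda>\<omega>. (Y n \<omega>)\<^sup>2) + expectation (\<lambda>\<omega>. (Y 0 \<omega>)\<^sup>2)"
    using int integrable_abs[OF noise_integrable] integrable_abs[OF vol_dev_sum_integrable] integrable_abs[OF score_integrable]
    by simp
  also have "\<dots> \<le> sqrt eps_fourth_moment * ?s + sqrt (12 / \<alpha>\<^sup>2) * ?s + 2 * (sqrt (fourth_const c + 1) * ?s)
      + (fourth_const c + 1) * (k n * R ^ 4) + (fourth_const c + 1) * (k n * R ^ 4)"
  proof (intro add_mono)
    have R24: "R\<^sup>2 \<le> R ^ 4" using R_ge_one by (intro power_increasing) auto
    have R: "0 < R" using R_ge_one by simp
    have "R\<^sup>2 \<le> k n * R ^ 4" and R4: "R ^ 4 \<le> k n * R ^ 4"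
    proof -
      show "R ^ 4 \<le> k n * R ^ 4" using k_ge_one R by simp
      then show "R\<^sup>2 \<le> k n * R ^ 4" using R24 by simp
    qed
    then have "real n * (R\<^sup>2 * eps_fourth_moment) \<le> real n * (k n * R ^ 4 * eps_fourth_moment)"
      using eps_fourth_moment_nonneg by (intro mult_left_mono mult_right_mono) auto
    then have "real n * (R\<^sup>2 * eps_fourth_moment) \<le> eps_fourth_moment * (real n * (k n * R ^ 4))"
      by (simp only: mult_ac)
    then have "sqrt (real n * (R\<^sup>2 * eps_fourth_moment)) \<le> sqrt eps_fourth_moment * ?s"
      unfolding real_sqrt_mult[symmetric] by simp
    then show "expectation (\<lambda>\<omega>. \<bar>?A \<omega>\<bar>) \<le> sqrt eps_fourth_moment * ?s" using noise_bound by linarith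
    have "12 / \<alpha>\<^sup>2 * R ^ 4 * real n \<le> 12 / \<alpha>\<^sup>2 * (k n * R ^ 4) * real n"
      using R4 by (intro mult_right_mono mult_left_mono) auto
    then have "sqrt (12 / \<alpha>\<^sup>2 * R ^ 4 * real n) \<le> sqrt (12 / \<alpha>\<^sup>2) * ?s"
      unfolding real_sqrt_mult[symmetric] by (simp add: mult_ac)
    then show "expectation (\<lambda>\<omega>. \<bar>?B \<omega>\<bar>) \<le> sqrt (12 / \<alpha>\<^sup>2) * ?s" using vol_dev_sum_bound by linarith
    have kR: "k n * R\<^sup>2 \<le> k n * R ^ 4" using R24 k_ge_one by (intro mult_left_mono) auto
    have "(fourth_const c + 1) * real n * (k n * R\<^sup>2) \<le> (fourth_const c + 1) * real n * (k n * R ^ 4)"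
      by (rule mult_left_mono[OF kR]) (use fourth_const_ge_one in simp)
    then have "sqrt (real n * ((fourth_const c + 1) * k n * R\<^sup>2)) \<le> sqrt (fourth_const c + 1) * ?s"
      unfolding real_sqrt_mult[symmetric] by (simp add: mult_ac)
    then show "2 * expectation (\<lambda>\<omega>. \<bar>?C \<omega>\<bar>) \<le> 2 * (sqrt (fourth_const c + 1) * ?s)" using score_bound by linarith
    have "(fourth_const c + 1) * (k n * R\<^sup>2) \<le> (fourth_const c + 1) * (k n * R ^ 4)"
      by (rule mult_left_mono[OF kR]) (use fourth_const_ge_one in simp)
    then have "(fourth_const c + 1) * k n * R\<^sup>2 \<le> (fourth_const c + 1) * (k n * R ^ 4)"
      by (simp only: mult.assoc)
    then show "expectation (\<lambda>\<omega>. (Y n \<omega>)\<^sup>2) \<le> (fourth_const c + 1) * (k n * R ^ 4)"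
      "expectation (\<lambda>\<omega>. (Y 0 \<omega>)\<^sup>2) \<le> (fourth_const c + 1) * (k n * R ^ 4)"
      using Y_sq(2)[OF order_refl] Y_sq(2)[of 0] by auto
  qed
  also have "\<dots> \<le> quad_const c * (?s + k n * R ^ 4)"
  proof -
    have "0 \<le> ?s" "0 \<le> k n * R ^ 4" using k_ge_one R_ge_one by auto
    moreover have "0 \<le> sqrt eps_fourth_moment" "0 \<le> sqrt (12 / \<alpha>\<^sup>2)" "0 \<le> sqrt (fourth_const c + 1)" "0 \<le> fourth_const c + 1"
      using eps_fourth_moment_nonneg fourth_const_ge_one by auto
    ultimately have "0 \<le> (sqrt eps_fourth_moment + sqrt (12 / \<alpha>\<^sup>2) + 2 * sqrt (fourth_const c + 1)) * (k n * R ^ 4)"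
      "0 \<le> 2 * (fourth_const c + 1) * ?s" by (auto intro!: mult_nonneg_nonneg add_nonneg_nonneg)
    then show ?thesis unfolding quad_const_def by (simp add: algebra_simps)
  qed
  finally show "expectation (\<lambda>\<omega>. \<bar>(1 - (\<rho> n)\<^sup>2) * (\<Sum>t=1..n. (Y (t - 1) \<omega>)\<^sup>2) - real n * \<mu>\<bar>)
     \<le> quad_const c * (?s + k n * R ^ 4)" .
qed

lemma norm_sum_squares_integrable: "integrable M (norm_sum_squares n)"
  unfolding norm_sum_squares_def[abs_def] using sum_squares_bound(1) by simp

text \<open>Division by \<open>1 - \<rho>\<^sup>2 = a / k\<close>; the term \<open>1 / (2 k)\<close> comes from \<open>a = c (2 - c / k)\<close> not being exactly \<open>2 c\<close>.\<close>

lemma norm_sum_squares_L1: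
  "expectation (\<lambda>\<omega>. \<bar>norm_sum_squares n \<omega> - 1 / (2 * c)\<bar>)
     \<le> quad_const c / c * (sqrt (k n * R ^ 4 / real n) + k n * R ^ 4 / real n) + 1 / (2 * k n)"
proof -
  define a where "a = c * (2 - c / k n)"
  define S where "S = (\<lambda>\<omega>. (1 - (\<rho> n)\<^sup>2) * (\<Sum>t=1..n. (Y (t - 1) \<omega>)\<^sup>2) - real n * \<mu>)"
  have k: "0 < k n" and n0: "0 < real n" and mu: "0 < \<mu>" using k_ge_one n mu_ge_one by auto
  have a: "c \<le> a" "0 < a" "2 * c - a = c\<^sup>2 / k n"
    using rho_bounds(5) c_pos by (auto simp: a_def algebra_simps power2_eq_square)
      (use mult_left_mono[OF rho_bounds(5), of c] in \<open>auto simp: algebra_simps\<close>)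
  have rho: "1 - (\<rho> n)\<^sup>2 = a / k n"
    using k by (simp add: rho_eq a_def field_simps power2_eq_square)
  have "norm_sum_squares n \<omega> - 1 / a = S \<omega> / (a * (real n * \<mu>))" for \<omega>
    using k n0 mu a(2) unfolding S_def rho norm_sum_squares_def by (simp add: field_simps)
  then have eq: "norm_sum_squares n \<omega> - 1 / (2 * c) = S \<omega> / (a * (real n * \<mu>)) + (1 / a - 1 / (2 * c))" for \<omega>
    by (simp add: algebra_simps)
  have S_int: "integrable M S" unfolding S_def using sum_squares_bound(1) by simp
  have bias: "\<bar>1 / a - 1 / (2 * c)\<bar> \<le> 1 / (2 * k n)"
  proof -
    have "1 / a - 1 / (2 * c) = (2 * c - a) / (2 * c * a)" using a(2) c_pos by (simp add: field_simps)
    also have "\<dots> = c / (2 * a * k n)" unfolding a(3) using c_pos by (simp add: power2_eq_square)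
    finally have *: "1 / a - 1 / (2 * c) = c / (2 * a * k n)" .
    have "c / (2 * a * k n) = c / a * (1 / (2 * k n))" by simp
    also have "\<dots> \<le> 1 * (1 / (2 * k n))" using a(1,2) k by (intro mult_right_mono) auto
    finally have "c / (2 * a * k n) \<le> 1 / (2 * k n)" by simp
    moreover have "0 \<le> c / (2 * a * k n)" using a c_pos k by simp
    ultimately show ?thesis unfolding * by simp
  qed
  have "expectation (\<lambda>\<omega>. \<bar>norm_sum_squares n \<omega> - 1 / (2 * c)\<bar>) \<le> expectation (\<lambda>\<omega>. \<bar>S \<omega>\<bar> / (c * real n) + 1 / (2 * k n))"
  proof (rule integral_mono)
    fix \<omega>
    have "\<bar>S \<omega> / (a * (real n * \<mu>))\<bar> = \<bar>S \<omega>\<bar> / (a * (real n * \<mu>))" using a n0 mu by (simp add: abs_mult)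
    also have "\<dots> \<le> \<bar>S \<omega>\<bar> / (c * real n)"
    proof (rule divide_left_mono)
      have "c * (real n * 1) \<le> a * (real n * \<mu>)" using a c_pos n0 mu_ge_one by (intro mult_mono) auto
      then show "c * real n \<le> a * (real n * \<mu>)" by simp
    qed (use a c_pos n0 mu in auto)
    finally show "\<bar>norm_sum_squares n \<omega> - 1 / (2 * c)\<bar> \<le> \<bar>S \<omega>\<bar> / (c * real n) + 1 / (2 * k n)"
      unfolding eq using bias by linarith
  qed (use norm_sum_squares_integrable S_int in auto)
  also have "\<dots> = expectation (\<lambda>\<omega>. \<bar>S \<omega>\<bar>) / (c * real n) + 1 / (2 * k n)"
    using S_int by (simp add: prob_space)
  also have "\<dots> \<le> quad_const c * (sqrt (real n * (k n * R ^ 4)) + k n * R ^ 4) / (c * real n) + 1 / (2 * k n)"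
    using sum_squares_bound(2) c_pos n0 unfolding S_def by (intro add_right_mono divide_right_mono) auto
  also have "sqrt (real n * (k n * R ^ 4)) = real n * sqrt (k n * R ^ 4 / real n)"
  proof -
    have "real n * (k n * R ^ 4) = (real n)\<^sup>2 * (k n * R ^ 4 / real n)" using n0 by (simp add: power2_eq_square)
    then show ?thesis using n0 by (simp only: real_sqrt_mult real_sqrt_abs)
  qed
  also have "quad_const c * (real n * sqrt (k n * R ^ 4 / real n) + k n * R ^ 4) / (c * real n)
      = quad_const c / c * (sqrt (k n * R ^ 4 / real n) + k n * R ^ 4 / real n)"
    using n0 c_pos by (simp add: field_simps)
  finally show ?thesis .
qed

end

section \<open>The conditional variance and the central limit theorem in a row\<close>

context regular_row
begin

text \<open>The time constant \<open>k\<^sup>1\<^sup>/\<^sup>2 = \<kappa>\<^sup>2\<close> of the filter lies between the correlation length of the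
  volatility and that, \<open>k\<close>, of the autoregression.\<close>

definition \<kappa> :: real where "\<kappa> = root 4 (k n)"

lemma kappa: "1 \<le> \<kappa>" "\<kappa> ^ 4 = k n"
  using k_ge_one by (auto simp: \<kappa>_def)

abbreviation "filtered \<equiv> exp_filter (1 - 1 / \<kappa>\<^sup>2) (vol_dev n)"

lemma filtered:
  assumes "t \<le> n"
  shows "random_variable borel (filtered t)" and "integrable M (\<lambda>\<omega>. (filtered t \<omega>)\<^sup>2)"
    and "expectation (\<lambda>\<omega>. (filtered t \<omega>)\<^sup>2) \<le> 12 / \<alpha>\<^sup>2 * R ^ 4 * \<kappa>\<^sup>2"
proof -
  let ?\<theta> = "1 - 1 / \<kappa>\<^sup>2"
  have \<theta>: "0 \<le> ?\<theta>" "?\<theta> < 1" "?\<theta> \<le> 1" using kappa(1) by (auto simp: field_simps)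
  note F = vol_filter_measurable[OF n assms \<theta>(1,3)] vol_filter_square_integrable[OF n assms \<theta>(1,3)]
    vol_filter_square_le[OF n assms \<theta>(1,3)]
  show "random_variable borel (filtered t)" "integrable M (\<lambda>\<omega>. (filtered t \<omega>)\<^sup>2)" by (fact F(1) F(2))+
  have "(\<Sum>i<t. ?\<theta> ^ i) = (1 - ?\<theta> ^ t) / (1 - ?\<theta>)" using \<theta> by (subst sum_gp_strict) auto
  also have "\<dots> \<le> 1 / (1 - ?\<theta>)" using \<theta> by (intro divide_right_mono) auto
  also have "\<dots> = \<kappa>\<^sup>2" by simp
  finally have "12 / \<alpha>\<^sup>2 * R ^ 4 * (\<Sum>i<t. ?\<theta> ^ i) \<le> 12 / \<alpha>\<^sup>2 * R ^ 4 * \<kappa>\<^sup>2"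
    using R_ge_one by (intro mult_left_mono) auto
  then show "expectation (\<lambda>\<omega>. (filtered t \<omega>)\<^sup>2) \<le> 12 / \<alpha>\<^sup>2 * R ^ 4 * \<kappa>\<^sup>2" using F(3) by linarith
qed

lemma diff_const_nonneg: "0 \<le> diff_const c"
  using eps_fourth_moment_nonneg fourth_const_ge_one by (simp add: diff_const_def)

text \<open>In one step \<open>Y\<^sup>2\<close> moves only by the order \<open>k\<^sup>1\<^sup>/\<^sup>2\<close>, while its size is \<open>k\<close>.\<close>

lemma Y_sq_increment:
  assumes t: "Suc t \<le> n"
  shows "integrable M (\<lambda>\<omega>. ((Y t \<omega>)\<^sup>2 - (Y (Suc t) \<omega>)\<^sup>2)\<^sup>2)"
    and "expectation (\<lambda>\<omega>. ((Y t \<omega>)\<^sup>2 - (Y (Suc t) \<omega>)\<^sup>2)\<^sup>2) \<le> diff_const c * k n * R\<^sup>2"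
proof -
  let ?t = "Suc t"
  define h where "h = c / k n"
  have t1: "1 \<le> ?t" "?t \<le> n" "t \<le> n" using t by auto
  have h: "0 \<le> h" "h \<le> 1" using rho_bounds(5) c_pos k_ge_one by (auto simp: h_def)
  note [measurable] = Y_measurable[OF t1(3)] Y_measurable[OF t1(2)] vol_measurable[OF t1(2)] eps_measurable[OF t1(1)]
  have YF: "Y t \<in> borel_measurable (past n (?t - 1))" using Y_past[of t] t by simp
  have vF: "\<sigma> ?t \<in> borel_measurable (past n (?t - 1))" by (rule vol_past[OF n t])
  have m2: "(\<lambda>\<omega>. (Y t \<omega> * \<sigma> ?t \<omega>)\<^sup>2) \<in> borel_measurable (past n (?t - 1))"
    and m4: "(\<lambda>\<omega>. (\<sigma> ?t \<omega>) ^ 4) \<in> borel_measurable (past n (?t - 1))"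
    by (intro borel_measurable_times borel_measurable_power YF vF)+
  have g: "(\<lambda>x :: real. x\<^sup>2) \<in> borel_measurable borel" "(\<lambda>x :: real. x ^ 4) \<in> borel_measurable borel" by measurable
  note e2 = integrable_past_innovation[OF t1(1,2) m2 Y_vol_sq(1)[OF t1(3,2)] g(1) integrable_eps_sq[OF t1(1)]]
    expectation_past_innovation[OF t1(1,2) m2 Y_vol_sq(1)[OF t1(3,2)] g(1) integrable_eps_sq[OF t1(1)],
      unfolded eps_var[OF t1(1)] mult_1_right]
  note e4 = integrable_past_innovation[OF t1(1,2) m4 vol_power[OF t1(2), of 4] g(2) eps_fourth[OF t1(1)]]
    expectation_past_innovation[OF t1(1,2) m4 vol_power[OF t1(2), of 4] g(2) eps_fourth[OF t1(1)],
      unfolded expectation_eps_fourth[OF t1(1)]]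
  let ?G = "\<lambda>\<omega>. 3 * ((\<sigma> ?t \<omega>) ^ 4 * (eps ?t \<omega>) ^ 4) + 12 * ((Y t \<omega> * \<sigma> ?t \<omega>)\<^sup>2 * (eps ?t \<omega>)\<^sup>2)
      + 12 * h\<^sup>2 * (Y t \<omega>) ^ 4"
  have G: "integrable M ?G"
    by (intro Bochner_Integration.integrable_add integrable_mult_right e2(1) e4(1) Y_fourth(1)[OF t1(3)])
  have le: "((Y t \<omega>)\<^sup>2 - (Y ?t \<omega>)\<^sup>2)\<^sup>2 \<le> ?G \<omega>" if w: "\<omega> \<in> space M" for \<omega>
  proof -
    define v where "v = \<sigma> ?t \<omega> * eps ?t \<omega>"
    define x where "x = Y t \<omega>"
    have Y': "Y ?t \<omega> = (1 - h) * x + v" using Y_Suc[OF t w] by (simp add: rho_eq h_def x_def v_def)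
    have sq3: "(p + q + r)\<^sup>2 \<le> 3 * p\<^sup>2 + 3 * q\<^sup>2 + 3 * r\<^sup>2" for p q r :: real
    proof -
      have "3 * p\<^sup>2 + 3 * q\<^sup>2 + 3 * r\<^sup>2 - (p + q + r)\<^sup>2 = (p - q)\<^sup>2 + (q - r)\<^sup>2 + (p - r)\<^sup>2"
        by (simp add: power2_eq_square algebra_simps)
      moreover have "0 \<le> (p - q)\<^sup>2 + (q - r)\<^sup>2 + (p - r)\<^sup>2" by simp
      ultimately show ?thesis by linarith
    qed
    have eq: "x\<^sup>2 - (Y ?t \<omega>)\<^sup>2 = - v\<^sup>2 + - (2 * ((1 - h) * (x * v))) + h * (2 - h) * x\<^sup>2"
      unfolding Y' by (simp add: power2_eq_square algebra_simps)
    have "(x\<^sup>2 - (Y ?t \<omega>)\<^sup>2)\<^sup>2 \<le> 3 * (- v\<^sup>2)\<^sup>2 + 3 * (- (2 * ((1 - h) * (x * v))))\<^sup>2 + 3 * (h * (2 - h) * x\<^sup>2)\<^sup>2"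
      unfolding eq by (rule sq3)
    also have "\<dots> = 3 * v ^ 4 + 3 * (4 * (1 - h)\<^sup>2) * (x * v)\<^sup>2 + 3 * (h\<^sup>2 * (2 - h)\<^sup>2) * x ^ 4"
      by (simp add: power_mult_distrib flip: power_mult)
    also have "\<dots> \<le> 3 * v ^ 4 + 3 * (4 * 1) * (x * v)\<^sup>2 + 3 * (h\<^sup>2 * 2\<^sup>2) * x ^ 4"
    proof (intro add_mono mult_right_mono mult_left_mono order_refl)
      show "(1 - h)\<^sup>2 \<le> 1" using h by (intro power_le_one) auto
      show "(2 - h)\<^sup>2 \<le> 2\<^sup>2" using h by (intro power_mono) auto
    qed auto
    also have "\<dots> = ?G \<omega>" by (simp add: v_def x_def power_mult_distrib mult_ac)
    finally show ?thesis by (simp add: x_def)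
  qed
  show i: "integrable M (\<lambda>\<omega>. ((Y t \<omega>)\<^sup>2 - (Y ?t \<omega>)\<^sup>2)\<^sup>2)"
    by (rule Bochner_Integration.integrable_bound[OF G]) (use le in \<open>auto intro!: AE_I2 order_trans[OF le]\<close>)
  have "expectation (\<lambda>\<omega>. ((Y t \<omega>)\<^sup>2 - (Y ?t \<omega>)\<^sup>2)\<^sup>2) \<le> expectation ?G"
    by (rule integral_mono[OF i G]) (rule le)
  also have "\<dots> = 3 * (expectation (\<lambda>\<omega>. (\<sigma> ?t \<omega>) ^ 4) * eps_fourth_moment)
      + 12 * expectation (\<lambda>\<omega>. (Y t \<omega> * \<sigma> ?t \<omega>)\<^sup>2) + 12 * h\<^sup>2 * expectation (\<lambda>\<omega>. (Y t \<omega>) ^ 4)"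
    using e2 e4 Y_fourth(1)[OF t1(3)] by simp
  also have "\<dots> \<le> 3 * (R\<^sup>2 * eps_fourth_moment) + 12 * ((fourth_const c + 1) * k n * R\<^sup>2)
      + 12 * h\<^sup>2 * (fourth_const c * (k n)\<^sup>2 * R\<^sup>2)"
    using vol_fourth_le[OF t1(2)] Y_vol_sq(2)[OF t1(3,2)] Y_fourth(2)[OF t1(3)] eps_fourth_moment_nonneg
    by (intro add_mono mult_left_mono mult_right_mono) auto
  also have "12 * h\<^sup>2 * (fourth_const c * (k n)\<^sup>2 * R\<^sup>2) = 12 * c\<^sup>2 * fourth_const c * R\<^sup>2"
    using k_ge_one by (simp add: h_def power_divide)
  also have "3 * (R\<^sup>2 * eps_fourth_moment) + 12 * ((fourth_const c + 1) * k n * R\<^sup>2) + 12 * c\<^sup>2 * fourth_const c * R\<^sup>2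
      \<le> diff_const c * k n * R\<^sup>2"
  proof -
    have le: "x \<le> x * k n" if "0 \<le> x" for x using that k_ge_one by (simp add: mult_le_cancel_left1)
    have "3 * eps_fourth_moment * R\<^sup>2 \<le> 3 * eps_fourth_moment * R\<^sup>2 * k n"
      "12 * c\<^sup>2 * fourth_const c * R\<^sup>2 \<le> 12 * c\<^sup>2 * fourth_const c * R\<^sup>2 * k n"
      using eps_fourth_moment_nonneg fourth_const_ge_one by (intro le; simp)+
    then show ?thesis by (simp add: diff_const_def algebra_simps)
  qed
  finally show "expectation (\<lambda>\<omega>. ((Y t \<omega>)\<^sup>2 - (Y ?t \<omega>)\<^sup>2)\<^sup>2) \<le> diff_const c * k n * R\<^sup>2" by simp
qed

text \<open>Writing \<open>D t = A t - \<theta> A (t - 1)\<close> moves the difference operator to the weights \<open>g\<close>, which vary slowly.\<close>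

lemma filter_summation_by_parts:
  "(\<Sum>t=1..m. g (t - 1) * D t \<omega>)
   = (\<Sum>t=1..m. (g (t - 1) - g t) * exp_filter \<theta> D t \<omega>) + (1 - \<theta>) * (\<Sum>t=1..m. g t * exp_filter \<theta> D t \<omega>)
   + \<theta> * (g m * exp_filter \<theta> D m \<omega>)"
proof (induction m)
  case 0
  show ?case by (simp add: exp_filter_0)
next
  case (Suc m)
  have "g m * D (Suc m) \<omega> + \<theta> * (g m * exp_filter \<theta> D m \<omega>) = g m * exp_filter \<theta> D (Suc m) \<omega>"
    by (simp add: exp_filter_Suc algebra_simps)
  moreover have "(\<Sum>t=1..Suc m. g (t - 1) * D t \<omega>) = (\<Sum>t=1..m. g (t - 1) * D t \<omega>) + g m * D (Suc m) \<omega>"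
    by simp
  ultimately have "(\<Sum>t=1..Suc m. g (t - 1) * D t \<omega>) = (\<Sum>t=1..m. (g (t - 1) - g t) * exp_filter \<theta> D t \<omega>)
      + (1 - \<theta>) * (\<Sum>t=1..m. g t * exp_filter \<theta> D t \<omega>) + g m * exp_filter \<theta> D (Suc m) \<omega>"
    using Suc by linarith
  then show ?case by (simp add: distrib_left left_diff_distrib)
qed

lemma cov_const_nonneg: "0 \<le> cov_const c"
  using diff_const_nonneg fourth_const_ge_one by (simp add: cov_const_def)

text \<open>The deviations of the volatility average out against the weights \<open>Y\<^sup>2\<close>, although the two are
  dependent.  After summation by parts the filter, of size \<open>\<kappa>\<close> in mean square, is multiplied either by an increment of
  \<open>Y\<^sup>2\<close>, of size \<open>k\<^sup>1\<^sup>/\<^sup>2 = \<kappa>\<^sup>2\<close>, or by \<open>\<kappa>\<^bsup>-2\<^esup> Y\<^sup>2\<close>, which has the same size.  Either term is of order \<open>\<kappa>\<^sup>3\<close>,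
  against the order \<open>k = \<kappa>\<^sup>4\<close> of \<open>Y\<^sup>2\<close>.\<close>

lemma weighted_vol_dev_bound:
  shows "integrable M (\<lambda>\<omega>. \<Sum>t=1..n. (Y (t - 1) \<omega>)\<^sup>2 * vol_dev n t \<omega>)"
    and "expectation (\<lambda>\<omega>. \<bar>\<Sum>t=1..n. (Y (t - 1) \<omega>)\<^sup>2 * vol_dev n t \<omega>\<bar>)
      \<le> cov_const c * (real n * \<kappa> ^ 3 * R ^ 4 + \<kappa> ^ 5 * R ^ 4)"
proof -
  have mY: "random_variable borel (\<lambda>\<omega>. (Y t \<omega>)\<^sup>2)" if "t \<le> n" for t using Y_measurable[OF that] by simp
  show int: "integrable M (\<lambda>\<omega>. \<Sum>t=1..n. (Y (t - 1) \<omega>)\<^sup>2 * vol_dev n t \<omega>)"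
    using mY vol_dev_measurable Y_sq_square_integrable vol_dev_sq_integrable
    by (intro Bochner_Integration.integrable_sum integrable_mult_of_squares) auto
  let ?A = filtered and ?\<theta> = "1 - 1 / \<kappa>\<^sup>2"
  have \<kappa>: "0 < \<kappa>" using kappa by simp
  have \<theta>: "0 \<le> ?\<theta>" "?\<theta> \<le> 1" using kappa(1) by (auto simp: field_simps)
  have R24: "R\<^sup>2 \<le> R ^ 4" using R_ge_one by (intro power_increasing) auto
  have YA_int: "integrable M (\<lambda>\<omega>. (Y t \<omega>)\<^sup>2 * ?A t \<omega>)" if "t \<le> n" for t
    by (rule integrable_mult_of_squares[OF mY[OF that] filtered(1)[OF that] Y_sq_square_integrable[OF that] filtered(2)[OF that]])
  have YA: "expectation (\<lambda>\<omega>. \<bar>(Y t \<omega>)\<^sup>2 * ?A t \<omega>\<bar>) \<le> (fourth_const c + 12 / \<alpha>\<^sup>2) * (\<kappa> ^ 5 * R ^ 4)" if "t \<le> n" for t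
  proof -
    have "expectation (\<lambda>\<omega>. ((Y t \<omega>)\<^sup>2)\<^sup>2) \<le> fourth_const c * (k n)\<^sup>2 * R\<^sup>2"
      using Y_fourth(2)[OF that] by (simp flip: power_mult)
    then have "expectation (\<lambda>\<omega>. \<bar>(Y t \<omega>)\<^sup>2 * ?A t \<omega>\<bar>)
        \<le> 1 / \<kappa> ^ 3 * (fourth_const c * (k n)\<^sup>2 * R\<^sup>2) + 12 / \<alpha>\<^sup>2 * R ^ 4 * \<kappa>\<^sup>2 / (1 / \<kappa> ^ 3)"
      using \<kappa> by (intro expectation_abs_mult_le mY filtered that Y_sq_square_integrable) auto
    also have "\<dots> = fourth_const c * (\<kappa> ^ 5 * R\<^sup>2) + 12 / \<alpha>\<^sup>2 * (\<kappa> ^ 5 * R ^ 4)"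
      unfolding kappa(2)[symmetric] using \<kappa> by (simp add: eval_nat_numeral)
    also have "\<dots> \<le> fourth_const c * (\<kappa> ^ 5 * R ^ 4) + 12 / \<alpha>\<^sup>2 * (\<kappa> ^ 5 * R ^ 4)"
      using fourth_const_ge_one \<kappa> R24 by (intro add_right_mono mult_left_mono) auto
    finally show ?thesis by (simp add: distrib_right)
  qed
  have m\<Delta>: "random_variable borel (\<lambda>\<omega>. (Y (t - 1) \<omega>)\<^sup>2 - (Y t \<omega>)\<^sup>2)" if "1 \<le> t" "t \<le> n" for t
    using mY[of t] mY[of "t - 1"] that by simp
  have \<Delta>_int: "integrable M (\<lambda>\<omega>. ((Y (t - 1) \<omega>)\<^sup>2 - (Y t \<omega>)\<^sup>2)\<^sup>2)"
    and \<Delta>_le: "expectation (\<lambda>\<omega>. ((Y (t - 1) \<omega>)\<^sup>2 - (Y t \<omega>)\<^sup>2)\<^sup>2) \<le> diff_const c * k n * R\<^sup>2" if "1 \<le> t" "t \<le> n" for t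
    using Y_sq_increment[of "t - 1"] that by simp_all
  have \<Delta>A_int: "integrable M (\<lambda>\<omega>. ((Y (t - 1) \<omega>)\<^sup>2 - (Y t \<omega>)\<^sup>2) * ?A t \<omega>)" if "1 \<le> t" "t \<le> n" for t
    by (rule integrable_mult_of_squares[OF m\<Delta>[OF that] filtered(1)[OF that(2)] \<Delta>_int[OF that] filtered(2)[OF that(2)]])
  have \<Delta>A: "expectation (\<lambda>\<omega>. \<bar>((Y (t - 1) \<omega>)\<^sup>2 - (Y t \<omega>)\<^sup>2) * ?A t \<omega>\<bar>)
      \<le> (diff_const c + 12 / \<alpha>\<^sup>2) * (\<kappa> ^ 3 * R ^ 4)" if "1 \<le> t" "t \<le> n" for t
  proof -
    have "expectation (\<lambda>\<omega>. \<bar>((Y (t - 1) \<omega>)\<^sup>2 - (Y t \<omega>)\<^sup>2) * ?A t \<omega>\<bar>)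
        \<le> 1 / \<kappa> * (diff_const c * k n * R\<^sup>2) + 12 / \<alpha>\<^sup>2 * R ^ 4 * \<kappa>\<^sup>2 / (1 / \<kappa>)"
      using \<kappa> by (intro expectation_abs_mult_le m\<Delta> filtered that \<Delta>_int \<Delta>_le) auto
    also have "\<dots> = diff_const c * (\<kappa> ^ 3 * R\<^sup>2) + 12 / \<alpha>\<^sup>2 * (\<kappa> ^ 3 * R ^ 4)"
      unfolding kappa(2)[symmetric] using \<kappa> by (simp add: eval_nat_numeral)
    also have "\<dots> \<le> diff_const c * (\<kappa> ^ 3 * R ^ 4) + 12 / \<alpha>\<^sup>2 * (\<kappa> ^ 3 * R ^ 4)"
      using diff_const_nonneg \<kappa> R24 by (intro add_right_mono mult_left_mono) auto
    finally show ?thesis by (simp add: distrib_right)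
  qed
  let ?S1 = "\<lambda>\<omega>. \<Sum>t=1..n. ((Y (t - 1) \<omega>)\<^sup>2 - (Y t \<omega>)\<^sup>2) * ?A t \<omega>" and ?S2 = "\<lambda>\<omega>. \<Sum>t=1..n. (Y t \<omega>)\<^sup>2 * ?A t \<omega>"
  let ?T1 = "\<lambda>\<omega>. \<Sum>t=1..n. \<bar>((Y (t - 1) \<omega>)\<^sup>2 - (Y t \<omega>)\<^sup>2) * ?A t \<omega>\<bar>" and ?T2 = "\<lambda>\<omega>. \<Sum>t=1..n. \<bar>(Y t \<omega>)\<^sup>2 * ?A t \<omega>\<bar>"
    and ?T3 = "\<lambda>\<omega>. \<bar>(Y n \<omega>)\<^sup>2 * ?A n \<omega>\<bar>"
  have T1: "integrable M ?T1" and T2: "integrable M ?T2" and T3: "integrable M ?T3"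
    using \<Delta>A_int YA_int by (auto intro!: Bochner_Integration.integrable_sum integrable_abs simp del: abs_mult)
  have "expectation (\<lambda>\<omega>. \<bar>\<Sum>t=1..n. (Y (t - 1) \<omega>)\<^sup>2 * vol_dev n t \<omega>\<bar>) \<le> expectation (\<lambda>\<omega>. ?T1 \<omega> + 1 / \<kappa>\<^sup>2 * ?T2 \<omega> + ?T3 \<omega>)"
  proof (rule integral_mono)
    show "integrable M (\<lambda>\<omega>. \<bar>\<Sum>t=1..n. (Y (t - 1) \<omega>)\<^sup>2 * vol_dev n t \<omega>\<bar>)" using int by (rule integrable_abs)
    show "integrable M (\<lambda>\<omega>. ?T1 \<omega> + 1 / \<kappa>\<^sup>2 * ?T2 \<omega> + ?T3 \<omega>)"
      by (intro Bochner_Integration.integrable_add integrable_mult_right T1 T2 T3)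
    fix \<omega>
    have "(\<Sum>t=1..n. (Y (t - 1) \<omega>)\<^sup>2 * vol_dev n t \<omega>) = ?S1 \<omega> + 1 / \<kappa>\<^sup>2 * ?S2 \<omega> + ?\<theta> * ((Y n \<omega>)\<^sup>2 * ?A n \<omega>)"
      using filter_summation_by_parts[of "\<lambda>t. (Y t \<omega>)\<^sup>2" "vol_dev n" \<omega> n ?\<theta>] by simp
    moreover have "\<bar>?S1 \<omega>\<bar> \<le> ?T1 \<omega>" by (rule sum_abs)
    moreover have "\<bar>1 / \<kappa>\<^sup>2 * ?S2 \<omega>\<bar> \<le> 1 / \<kappa>\<^sup>2 * ?T2 \<omega>"
      unfolding abs_mult[of "1 / \<kappa>\<^sup>2"] using sum_abs[of "\<lambda>t. (Y t \<omega>)\<^sup>2 * ?A t \<omega>" "{1..n}"] by (intro mult_mono) auto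
    moreover have "\<bar>?\<theta> * ((Y n \<omega>)\<^sup>2 * ?A n \<omega>)\<bar> \<le> 1 * ?T3 \<omega>"
      unfolding abs_mult[of ?\<theta>] using \<theta> by (intro mult_right_mono) auto
    ultimately show "\<bar>\<Sum>t=1..n. (Y (t - 1) \<omega>)\<^sup>2 * vol_dev n t \<omega>\<bar> \<le> ?T1 \<omega> + 1 / \<kappa>\<^sup>2 * ?T2 \<omega> + ?T3 \<omega>" by linarith
  qed
  also have "\<dots> = expectation ?T1 + 1 / \<kappa>\<^sup>2 * expectation ?T2 + expectation ?T3"
    using T1 T2 T3 by (simp del: abs_mult)
  also have "\<dots> \<le> (\<Sum>t=1..n. (diff_const c + 12 / \<alpha>\<^sup>2) * (\<kappa> ^ 3 * R ^ 4))
      + 1 / \<kappa>\<^sup>2 * (\<Sum>t=1..n. (fourth_const c + 12 / \<alpha>\<^sup>2) * (\<kappa> ^ 5 * R ^ 4)) + (fourth_const c + 12 / \<alpha>\<^sup>2) * (\<kappa> ^ 5 * R ^ 4)"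
  proof (intro add_mono mult_left_mono)
    have "expectation ?T1 = (\<Sum>t=1..n. expectation (\<lambda>\<omega>. \<bar>((Y (t - 1) \<omega>)\<^sup>2 - (Y t \<omega>)\<^sup>2) * ?A t \<omega>\<bar>))"
      using \<Delta>A_int by (intro Bochner_Integration.integral_sum integrable_abs) auto
    also have "\<dots> \<le> (\<Sum>t=1..n. (diff_const c + 12 / \<alpha>\<^sup>2) * (\<kappa> ^ 3 * R ^ 4))"
      by (rule sum_mono) (use \<Delta>A in auto)
    finally show "expectation ?T1 \<le> (\<Sum>t=1..n. (diff_const c + 12 / \<alpha>\<^sup>2) * (\<kappa> ^ 3 * R ^ 4))" .
    have "expectation ?T2 = (\<Sum>t=1..n. expectation (\<lambda>\<omega>. \<bar>(Y t \<omega>)\<^sup>2 * ?A t \<omega>\<bar>))"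
      using YA_int by (intro Bochner_Integration.integral_sum integrable_abs) auto
    also have "\<dots> \<le> (\<Sum>t=1..n. (fourth_const c + 12 / \<alpha>\<^sup>2) * (\<kappa> ^ 5 * R ^ 4))"
      by (rule sum_mono) (use YA in auto)
    finally show "expectation ?T2 \<le> (\<Sum>t=1..n. (fourth_const c + 12 / \<alpha>\<^sup>2) * (\<kappa> ^ 5 * R ^ 4))" .
    show "expectation ?T3 \<le> (fourth_const c + 12 / \<alpha>\<^sup>2) * (\<kappa> ^ 5 * R ^ 4)" by (rule YA) simp
  qed (use \<kappa> in auto)
  also have "\<dots> = (diff_const c + fourth_const c + 24 / \<alpha>\<^sup>2) * (real n * \<kappa> ^ 3 * R ^ 4) + (fourth_const c + 12 / \<alpha>\<^sup>2) * (\<kappa> ^ 5 * R ^ 4)"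
  proof -
    have "1 / \<kappa>\<^sup>2 * (real n * ((fourth_const c + 12 / \<alpha>\<^sup>2) * (\<kappa> ^ 5 * R ^ 4))) = (fourth_const c + 12 / \<alpha>\<^sup>2) * (real n * \<kappa> ^ 3 * R ^ 4)"
      using \<kappa> by (simp add: eval_nat_numeral)
    then show ?thesis by (simp add: algebra_simps)
  qed
  also have "\<dots> \<le> cov_const c * (real n * \<kappa> ^ 3 * R ^ 4) + cov_const c * (\<kappa> ^ 5 * R ^ 4)"
  proof (intro add_mono mult_right_mono)
    have p: "0 \<le> 12 / \<alpha>\<^sup>2" "24 / \<alpha>\<^sup>2 = 2 * (12 / \<alpha>\<^sup>2)" "36 / \<alpha>\<^sup>2 = 3 * (12 / \<alpha>\<^sup>2)" by simp_all
    show "diff_const c + fourth_const c + 24 / \<alpha>\<^sup>2 \<le> cov_const c" "fourth_const c + 12 / \<alpha>\<^sup>2 \<le> cov_const c"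
      unfolding cov_const_def using p fourth_const_ge_one diff_const_nonneg by linarith+
    show "0 \<le> real n * \<kappa> ^ 3 * R ^ 4" "0 \<le> \<kappa> ^ 5 * R ^ 4" using \<kappa> R_ge_one by auto
  qed
  finally show "expectation (\<lambda>\<omega>. \<bar>\<Sum>t=1..n. (Y (t - 1) \<omega>)\<^sup>2 * vol_dev n t \<omega>\<bar>)
      \<le> cov_const c * (real n * \<kappa> ^ 3 * R ^ 4 + \<kappa> ^ 5 * R ^ 4)" by (simp add: distrib_left)
qed

text \<open>The martingale differences of the normalised score are \<open>clt_coeff t * eps t\<close>.\<close>

definition clt_coeff :: "nat \<Rightarrow> 'a \<Rightarrow> real" where
  "clt_coeff t \<omega> = Y (t - 1) \<omega> * \<sigma> t \<omega> / (sqrt (real n * k n) * \<mu>)"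

lemma conditional_variance_L1:
  "expectation (\<lambda>\<omega>. \<bar>(\<Sum>t=1..n. (clt_coeff t \<omega>)\<^sup>2) - 1 / (2 * c)\<bar>) \<le> cond_var_error c n"
proof -
  let ?W = "\<lambda>\<omega>. \<Sum>t=1..n. (Y (t - 1) \<omega>)\<^sup>2 * vol_dev n t \<omega>"
  have k: "0 < k n" and n0: "0 < real n" and mu: "0 < \<mu>" and \<kappa>: "0 < \<kappa>" using k_ge_one n mu_ge_one kappa by auto
  have eq: "(\<Sum>t=1..n. (clt_coeff t \<omega>)\<^sup>2) = norm_sum_squares n \<omega> + ?W \<omega> / (real n * k n * \<mu>\<^sup>2)" for \<omega>
  proof -
    have "(\<Sum>t=1..n. (clt_coeff t \<omega>)\<^sup>2) = (\<Sum>t=1..n. (\<mu> * (Y (t - 1) \<omega>)\<^sup>2 + (Y (t - 1) \<omega>)\<^sup>2 * vol_dev n t \<omega>) / (real n * k n * \<mu>\<^sup>2))"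
      using k by (intro sum.cong) (auto simp: clt_coeff_def vol_dev_def power_divide power_mult_distrib algebra_simps)
    also have "\<dots> = \<mu> * (\<Sum>t=1..n. (Y (t - 1) \<omega>)\<^sup>2) / (real n * k n * \<mu>\<^sup>2) + ?W \<omega> / (real n * k n * \<mu>\<^sup>2)"
      by (simp only: sum_divide_distrib[symmetric] sum.distrib sum_distrib_left add_divide_distrib)
    also have "\<mu> * (\<Sum>t=1..n. (Y (t - 1) \<omega>)\<^sup>2) / (real n * k n * \<mu>\<^sup>2) = norm_sum_squares n \<omega>"
      using mu by (simp add: norm_sum_squares_def power2_eq_square)
    finally show ?thesis .
  qed
  note W = weighted_vol_dev_bound
  have "expectation (\<lambda>\<omega>. \<bar>(\<Sum>t=1..n. (clt_coeff t \<omega>)\<^sup>2) - 1 / (2 * c)\<bar>)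
      \<le> expectation (\<lambda>\<omega>. \<bar>norm_sum_squares n \<omega> - 1 / (2 * c)\<bar> + \<bar>?W \<omega>\<bar> / (real n * k n))"
    unfolding eq
  proof (rule integral_mono)
    show "integrable M (\<lambda>\<omega>. \<bar>norm_sum_squares n \<omega> + ?W \<omega> / (real n * k n * \<mu>\<^sup>2) - 1 / (2 * c)\<bar>)"
      using norm_sum_squares_integrable W(1) by (intro integrable_abs Bochner_Integration.integrable_diff
        Bochner_Integration.integrable_add integrable_divide) auto
    show "integrable M (\<lambda>\<omega>. \<bar>norm_sum_squares n \<omega> - 1 / (2 * c)\<bar> + \<bar>?W \<omega>\<bar> / (real n * k n))"
      using norm_sum_squares_integrable W(1) by (intro integrable_abs Bochner_Integration.integrable_diff
        Bochner_Integration.integrable_add integrable_divide) auto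
    fix \<omega>
    have "\<bar>?W \<omega> / (real n * k n * \<mu>\<^sup>2)\<bar> = \<bar>?W \<omega>\<bar> / (real n * k n * \<mu>\<^sup>2)" using k n0 mu by (simp add: abs_mult)
    also have "\<dots> \<le> \<bar>?W \<omega>\<bar> / (real n * k n)"
    proof (rule divide_left_mono)
      have "1 \<le> \<mu>\<^sup>2" using mu_ge_one by simp
      then show "real n * k n \<le> real n * k n * \<mu>\<^sup>2"
        using mult_left_mono[of 1 "\<mu>\<^sup>2" "real n * k n"] k n0 by simp
    qed (use k n0 mu in auto)
    finally show "\<bar>norm_sum_squares n \<omega> + ?W \<omega> / (real n * k n * \<mu>\<^sup>2) - 1 / (2 * c)\<bar>
        \<le> \<bar>norm_sum_squares n \<omega> - 1 / (2 * c)\<bar> + \<bar>?W \<omega>\<bar> / (real n * k n)" by linarith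
  qed
  also have "\<dots> = expectation (\<lambda>\<omega>. \<bar>norm_sum_squares n \<omega> - 1 / (2 * c)\<bar>) + expectation (\<lambda>\<omega>. \<bar>?W \<omega>\<bar>) / (real n * k n)"
    using norm_sum_squares_integrable integrable_abs[OF W(1)] by simp
  also have "\<dots> \<le> expectation (\<lambda>\<omega>. \<bar>norm_sum_squares n \<omega> - 1 / (2 * c)\<bar>)
      + cov_const c * (real n * \<kappa> ^ 3 * R ^ 4 + \<kappa> ^ 5 * R ^ 4) / (real n * k n)"
    using W(2) k n0 by (intro add_left_mono divide_right_mono) auto
  also have "cov_const c * (real n * \<kappa> ^ 3 * R ^ 4 + \<kappa> ^ 5 * R ^ 4) / (real n * k n) = cov_const c * (R ^ 4 / \<kappa> + \<kappa> * R ^ 4 / real n)"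
  proof -
    have "real n * \<kappa> ^ 3 * R ^ 4 / (real n * k n) = R ^ 4 / \<kappa>" "\<kappa> ^ 5 * R ^ 4 / (real n * k n) = \<kappa> * R ^ 4 / real n"
      unfolding kappa(2)[symmetric] using \<kappa> n0 by (simp_all add: eval_nat_numeral)
    then show ?thesis by (simp only: add_divide_distrib flip: times_divide_eq_right)
  qed
  finally show ?thesis using norm_sum_squares_L1 by (simp add: cond_var_error_def \<kappa>_def)
qed

lemma clt_coeff_past:
  assumes "1 \<le> t" "t \<le> n"
  shows "clt_coeff t \<in> borel_measurable (past n (t - 1))"
  unfolding clt_coeff_def[abs_def] using Y_past[of "t - 1"] vol_past[OF n, of t "t - 1"] assms
  by (intro borel_measurable_times borel_measurable_divide) auto

lemma norm_score_eq: "norm_score n \<omega> = (\<Sum>t=1..n. clt_coeff t \<omega> * eps t \<omega>)"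
  by (simp add: norm_score_def clt_coeff_def sum_divide_distrib)

lemma clt_coeff_sq:
  assumes "1 \<le> t" "t \<le> n"
  shows "integrable M (\<lambda>\<omega>. (clt_coeff t \<omega>)\<^sup>2)"
  using Y_vol_sq(1)[of "t - 1" t] assms by (simp add: clt_coeff_def power_divide)

lemma clt_coeff_cube:
  assumes "1 \<le> t" "t \<le> n"
  shows "integrable M (\<lambda>\<omega>. \<bar>clt_coeff t \<omega>\<bar> ^ 3)"
    and "expectation (\<lambda>\<omega>. \<bar>clt_coeff t \<omega>\<bar> ^ 3) \<le> (fourth_const c + 1) * R ^ 18 / (real n * sqrt (real n))"
proof -
  let ?s = "sqrt (real n * k n) * \<mu>"
  have k: "0 < k n" and n0: "0 < real n" and mu: "0 < \<mu>" using k_ge_one n mu_ge_one by auto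
  have s: "0 < ?s" using k n0 mu by simp
  have eq: "\<bar>clt_coeff t \<omega>\<bar> ^ 3 = \<bar>Y (t - 1) \<omega> * \<sigma> t \<omega>\<bar> ^ 3 / ?s ^ 3" for \<omega>
  proof -
    have "\<bar>clt_coeff t \<omega>\<bar> = \<bar>Y (t - 1) \<omega> * \<sigma> t \<omega>\<bar> / ?s"
      using s by (simp only: clt_coeff_def abs_divide abs_of_pos)
    then show ?thesis by (simp only: power_divide)
  qed
  note YV = Y_vol_cube[of "t - 1" t]
  show "integrable M (\<lambda>\<omega>. \<bar>clt_coeff t \<omega>\<bar> ^ 3)" unfolding eq using YV(1) assms by simp
  have "expectation (\<lambda>\<omega>. \<bar>clt_coeff t \<omega>\<bar> ^ 3) = expectation (\<lambda>\<omega>. \<bar>Y (t - 1) \<omega> * \<sigma> t \<omega>\<bar> ^ 3) / ?s ^ 3"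
    unfolding eq by simp
  also have "\<dots> \<le> (fourth_const c + 1) * sqrt (k n) ^ 3 * R ^ 18 / ?s ^ 3"
    using YV(2) assms s by (intro divide_right_mono) auto
  also have "\<dots> \<le> (fourth_const c + 1) * sqrt (k n) ^ 3 * R ^ 18 / (sqrt (real n * k n)) ^ 3"
  proof (intro divide_left_mono power_mono)
    show "sqrt (real n * k n) \<le> ?s" using mult_left_mono[OF mu_ge_one, of "sqrt (real n * k n)"] k n0 by simp
  qed (use k n0 mu fourth_const_ge_one R_ge_one in auto)
  also have "\<dots> = (fourth_const c + 1) * R ^ 18 / (real n * sqrt (real n))"
  proof -
    have "sqrt (real n) ^ 3 = real n * sqrt (real n)" by (simp add: power3_eq_cube)
    then have "sqrt (real n * k n) ^ 3 = real n * sqrt (real n) * sqrt (k n) ^ 3"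
      by (simp only: real_sqrt_mult power_mult_distrib)
    then show ?thesis using k by simp
  qed
  finally show "expectation (\<lambda>\<omega>. \<bar>clt_coeff t \<omega>\<bar> ^ 3) \<le> (fourth_const c + 1) * R ^ 18 / (real n * sqrt (real n))" .
qed

lemma norm_score_integrable: "integrable M (norm_score n)"
  unfolding norm_score_def[abs_def] using score_integrable by simp

lemma norm_score_char:
  "cmod (expectation (\<lambda>\<omega>. iexp (s * norm_score n \<omega>)) - of_real (exp (- (s\<^sup>2 * (1 / (2 * c)) / 2))))
    \<le> clt_const s (1 / (2 * c)) (1 + eps_fourth_moment) * ((fourth_const c + 1) * R ^ 18 / sqrt (real n) + cond_var_error c n)"
proof -
  have w: "0 \<le> 1 / (2 * c)" using c_pos by simp
  have "cmod (expectation (\<lambda>\<omega>. iexp (s * norm_score n \<omega>)) - of_real (exp (- (s\<^sup>2 * (1 / (2 * c)) / 2))))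
    \<le> clt_const s (1 / (2 * c)) (1 + eps_fourth_moment) *
      ((\<Sum>t=1..n. expectation (\<lambda>\<omega>. \<bar>clt_coeff t \<omega>\<bar> ^ 3)) + expectation (\<lambda>\<omega>. \<bar>(\<Sum>t=1..n. (clt_coeff t \<omega>)\<^sup>2) - 1 / (2 * c)\<bar>))"
    unfolding norm_score_eq
    by (rule martingale_clt_bound)
      (use integrable_eps_sq integrable_eps_cube eps_mean eps_var expectation_eps_cube_le eps_fourth_moment_nonneg
        clt_coeff_past clt_coeff_sq clt_coeff_cube(1) w in auto)
  also have "\<dots> \<le> clt_const s (1 / (2 * c)) (1 + eps_fourth_moment) *
      ((\<Sum>t=1..n. (fourth_const c + 1) * R ^ 18 / (real n * sqrt (real n))) + cond_var_error c n)"
  proof (intro mult_left_mono add_mono sum_mono conditional_variance_L1)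
    show "0 \<le> clt_const s (1 / (2 * c)) (1 + eps_fourth_moment)"
      unfolding clt_const_def using eps_fourth_moment_nonneg c_pos by (intro mult_nonneg_nonneg add_nonneg_nonneg) auto
  qed (use clt_coeff_cube(2) in auto)
  finally show ?thesis using n by simp
qed

text \<open>This keeps the laws of \<open>norm_score\<close> tight: the second moment is the expectation of the sum of squares.\<close>

lemma norm_score_L1: "expectation (\<lambda>\<omega>. \<bar>norm_score n \<omega>\<bar>) \<le> sqrt (1 / (2 * c) + cond_var_error c n)"
proof -
  let ?V = "\<lambda>\<omega>. \<Sum>t=1..n. (clt_coeff t \<omega>)\<^sup>2"
  have V: "integrable M ?V" using clt_coeff_sq by (intro Bochner_Integration.integrable_sum) auto
  have "(\<Sum>t=1..n. expectation (\<lambda>\<omega>. (clt_coeff t \<omega>)\<^sup>2)) = expectation ?V"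
    using clt_coeff_sq by (subst Bochner_Integration.integral_sum) auto
  also have "\<dots> \<le> expectation (\<lambda>\<omega>. 1 / (2 * c) + \<bar>?V \<omega> - 1 / (2 * c)\<bar>)"
    using V by (intro integral_mono) auto
  also have "\<dots> = 1 / (2 * c) + expectation (\<lambda>\<omega>. \<bar>?V \<omega> - 1 / (2 * c)\<bar>)"
    using V by (subst Bochner_Integration.integral_add) (auto simp: prob_space)
  also have "\<dots> \<le> 1 / (2 * c) + cond_var_error c n" using conditional_variance_L1 by simp
  finally have "sqrt (\<Sum>t=1..n. expectation (\<lambda>\<omega>. (clt_coeff t \<omega>)\<^sup>2)) \<le> sqrt (1 / (2 * c) + cond_var_error c n)"
    by simp
  with innovation_sum_bound(2)[OF clt_coeff_past clt_coeff_sq] show ?thesis unfolding norm_score_eq by linarith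
qed

end

section \<open>Passage to the limit\<close>

context prob_space
begin

text \<open>The domination is asked for only near the limit, as is natural for a quotient whose denominator
  is bounded away from \<open>0\<close> there.\<close>

lemma tendsto_in_prob_0_of_dominated:
  assumes V: "tendsto_in_prob M V 0" and W: "tendsto_in_prob M W 0" and "\<delta> > 0"
    and [measurable]: "\<And>n. random_variable borel (V n)" "\<And>n. random_variable borel (W n)"
    and D: "\<forall>\<^sub>F n in sequentially. \<forall>\<omega>\<in>space M. \<bar>V n \<omega>\<bar> \<le> \<delta> \<longrightarrow> \<bar>D n \<omega>\<bar> \<le> \<bar>W n \<omega>\<bar>"
  shows "tendsto_in_prob M D 0"
  unfolding tendsto_in_prob_def
proof (intro allI impI)
  fix e :: real assume "e > 0"
  let ?P = "\<lambda>X d n. prob {\<omega> \<in> space M. \<bar>X n \<omega> - 0\<bar> > d}"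
  have "\<forall>\<^sub>F n in sequentially. norm (?P D e n) \<le> ?P V \<delta> n + ?P W e n"
    using D
  proof eventually_elim
    case (elim n)
    have "?P D e n \<le> prob ({\<omega> \<in> space M. \<bar>V n \<omega> - 0\<bar> > \<delta>} \<union> {\<omega> \<in> space M. \<bar>W n \<omega> - 0\<bar> > e})"
      using elim by (intro finite_measure_mono) force+
    also have "\<dots> \<le> ?P V \<delta> n + ?P W e n" by (intro measure_Un_le) auto
    finally show ?case by simp
  qed
  moreover have "(\<lambda>n. ?P V \<delta> n + ?P W e n) \<longlonglongrightarrow> 0"
    using tendsto_add[of "?P V \<delta>" 0 sequentially "?P W e" 0] V W \<open>\<delta> > 0\<close> \<open>e > 0\<close>
    by (simp add: tendsto_in_prob_def)
  ultimately show "?P D e \<longlonglongrightarrow> 0" by (rule Lim_null_comparison)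
qed

lemma tendsto_in_prob_0_mult_bounded:
  assumes V: "tendsto_in_prob M V 0"
    and [measurable]: "\<And>n. random_variable borel (V n)" "\<And>n. random_variable borel (Z n)"
    and Z: "\<forall>\<^sub>F n in sequentially. integrable M (Z n) \<and> expectation (\<lambda>\<omega>. \<bar>Z n \<omega>\<bar>) \<le> B" and B: "0 \<le> B"
  shows "tendsto_in_prob M (\<lambda>n \<omega>. Z n \<omega> * V n \<omega>) 0"
  unfolding tendsto_in_prob_def
proof (intro allI impI)
  fix e :: real assume e: "e > 0"
  show "(\<lambda>n. prob {\<omega> \<in> space M. \<bar>Z n \<omega> * V n \<omega> - 0\<bar> > e}) \<longlonglongrightarrow> 0"
  proof (rule LIMSEQ_I)
    fix r :: real assume r: "r > 0"
    define T where "T = 2 * (B + 1) / r"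
    have T: "T > 0" "B / T < r / 2" using r B by (auto simp: T_def field_simps)
    have "\<forall>\<^sub>F n in sequentially. prob {\<omega> \<in> space M. \<bar>V n \<omega> - 0\<bar> > e / T} < r / 2"
      using V e T r by (intro order_tendstoD(2)[of _ 0]) (auto simp: tendsto_in_prob_def)
    with Z have "\<forall>\<^sub>F n in sequentially. norm (prob {\<omega> \<in> space M. \<bar>Z n \<omega> * V n \<omega> - 0\<bar> > e} - 0) < r"
    proof eventually_elim
      case (elim n)
      have "prob {\<omega> \<in> space M. \<bar>Z n \<omega> * V n \<omega> - 0\<bar> > e}
          \<le> prob ({\<omega> \<in> space M. \<bar>Z n \<omega>\<bar> > T} \<union> {\<omega> \<in> space M. \<bar>V n \<omega> - 0\<bar> > e / T})"
      proof (intro finite_measure_mono subsetI)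
        fix \<omega> assume w: "\<omega> \<in> {\<omega> \<in> space M. \<bar>Z n \<omega> * V n \<omega> - 0\<bar> > e}"
        show "\<omega> \<in> {\<omega> \<in> space M. \<bar>Z n \<omega>\<bar> > T} \<union> {\<omega> \<in> space M. \<bar>V n \<omega> - 0\<bar> > e / T}"
        proof (rule ccontr)
          assume "\<omega> \<notin> {\<omega> \<in> space M. \<bar>Z n \<omega>\<bar> > T} \<union> {\<omega> \<in> space M. \<bar>V n \<omega> - 0\<bar> > e / T}"
          with w have "\<bar>Z n \<omega>\<bar> \<le> T" "\<bar>V n \<omega>\<bar> \<le> e / T" by auto
          then have "\<bar>Z n \<omega>\<bar> * \<bar>V n \<omega>\<bar> \<le> T * (e / T)" using T by (intro mult_mono) auto
          then show False using w T by (simp add: abs_mult)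
        qed
      qed auto
      also have "\<dots> \<le> prob {\<omega> \<in> space M. \<bar>Z n \<omega>\<bar> > T} + prob {\<omega> \<in> space M. \<bar>V n \<omega> - 0\<bar> > e / T}"
        by (intro measure_Un_le) auto
      also have "prob {\<omega> \<in> space M. \<bar>Z n \<omega>\<bar> > T} \<le> expectation (\<lambda>\<omega>. \<bar>Z n \<omega>\<bar>) / T"
        using elim T by (intro prob_gt_le_expectation) auto
      also have "expectation (\<lambda>\<omega>. \<bar>Z n \<omega>\<bar>) / T \<le> B / T" using elim T by (intro divide_right_mono) auto
      finally have "prob {\<omega> \<in> space M. \<bar>Z n \<omega> * V n \<omega> - 0\<bar> > e} < r" using elim T by linarith
      then show ?case by simp
    qed
    then show "\<exists>N. \<forall>n\<ge>N. norm (prob {\<omega> \<in> space M. \<bar>Z n \<omega> * V n \<omega> - 0\<bar> > e} - 0) < r"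
      by (simp add: eventually_sequentially)
  qed
qed

end

text \<open>The estimation error is the quotient of the score and the sum of squares, and the stationary mean cancels.\<close>

lemma (in regular_row) normalised_estimation_error:
  assumes w: "\<omega> \<in> space M" and pos: "norm_sum_squares n \<omega> \<noteq> 0"
  shows "sqrt (real n * k n) * (lse y n \<omega> - \<rho> n) = norm_score n \<omega> / norm_sum_squares n \<omega>"
proof -
  let ?S = "\<Sum>t=1..n. (Y (t - 1) \<omega>)\<^sup>2" and ?N = "\<Sum>t=1..n. Y (t - 1) \<omega> * \<sigma> t \<omega> * eps t \<omega>"
  let ?s = "sqrt (real n * k n)"
  have k: "0 < k n" and n0: "0 < real n" and mu: "0 < \<mu>" using k_ge_one n mu_ge_one by auto
  then have s: "0 < ?s" "?s * ?s = real n * k n" by auto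
  have S: "?S \<noteq> 0" using pos by (auto simp: norm_sum_squares_def)
  have "(\<Sum>t=1..n. Y (t - 1) \<omega> * Y t \<omega>) = (\<Sum>t=1..n. \<rho> n * (Y (t - 1) \<omega>)\<^sup>2 + Y (t - 1) \<omega> * \<sigma> t \<omega> * eps t \<omega>)"
  proof (rule sum.cong)
    fix t assume "t \<in> {1..n}"
    then show "Y (t - 1) \<omega> * Y t \<omega> = \<rho> n * (Y (t - 1) \<omega>)\<^sup>2 + Y (t - 1) \<omega> * \<sigma> t \<omega> * eps t \<omega>"
      using Y_Suc[of "t - 1" \<omega>] w by (simp add: power2_eq_square algebra_simps)
  qed simp
  also have "\<dots> = \<rho> n * ?S + ?N" by (simp only: sum.distrib sum_distrib_left)
  finally have "lse y n \<omega> - \<rho> n = ?N / ?S" using S by (simp add: lse_def field_simps)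
  moreover have "norm_score n \<omega> / norm_sum_squares n \<omega> = (?N / ?S) * ((real n * k n) / ?s)"
    using mu k n0 s(1) by (simp add: norm_score_def norm_sum_squares_def)
  moreover have "(real n * k n) / ?s = ?s" using k by (intro real_div_sqrt) simp
  ultimately show ?thesis by simp
qed

locale nearly_stationary_sv = ar_stochastic_volatility M d \<alpha> k r \<phi> \<rho> eps eta vol u y
  for M :: "'a measure" and d \<alpha> k r \<phi> \<rho> eps eta vol u y +
  fixes c :: real
  assumes c_pos: "c > 0"
    and nearly_stationary: "\<And>n. n \<ge> 1 \<Longrightarrow> \<rho> n = 1 - c / k n"
    and rate1: "\<And>q::real. q > 0 \<Longrightarrow> (\<lambda>n. r n powr q) \<in> o(k)"
    and rate2: "\<And>q::real. q > 0 \<Longrightarrow> (\<lambda>n. k n * r n powr q) \<in> o(\<lambda>n. real n)"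
    and y0_integrable: "\<forall>\<^sub>F n in sequentially. integrable M (\<lambda>\<omega>. (y n 0 \<omega>)^4)"
    and y0_small: "(\<lambda>n. \<integral>\<omega>. (y n 0 \<omega>)^4 \<partial>M) \<in> o(\<lambda>n. (k n)^2)"
begin

lemma eventually_regular_row:
  "\<forall>\<^sub>F n in sequentially. regular_row M d \<alpha> k r \<phi> \<rho> eps eta vol u y c n"
proof -
  have "\<forall>\<^sub>F n in sequentially. max 1 c \<le> k n"
    using k_tendsto unfolding filterlim_at_top by blast
  moreover have "\<forall>\<^sub>F n in sequentially. norm (expectation (\<lambda>\<omega>. (y n 0 \<omega>) ^ 4)) \<le> 1 * norm ((k n)\<^sup>2)"
    using y0_small by (rule landau_o.smallD) simp
  moreover note y0_integrable eventually_ge_at_top[of 1]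
  ultimately show ?thesis
  proof eventually_elim
    case (elim n)
    then show ?case
      by unfold_locales (use c_pos nearly_stationary in auto)
  qed
qed

text \<open>Since \<open>\<phi> = 1 - d / ln r\<close>, the stationary variance grows at most like a multiple of \<open>ln r\<close>.\<close>

lemma vol_scale_growth:
  obtains C q where "q > 0" "C > 0" "\<forall>\<^sub>F n in sequentially. vol_scale n \<le> C * r n powr q"
proof -
  define q where "q = \<alpha>\<^sup>2 / d"
  have q: "q > 0" using \<alpha>_pos d_pos by (simp add: q_def)
  from r_cases show ?thesis
  proof
    assume "filterlim r at_top sequentially"
    then have "\<forall>\<^sub>F n in sequentially. exp d \<le> r n" by (simp add: filterlim_at_top)
    with eventually_ge_at_top[of 1]
    have "\<forall>\<^sub>F n in sequentially. vol_scale n \<le> 1 * r n powr q"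
    proof eventually_elim
      case (elim n)
      let ?L = "ln (r n)"
      have r: "r n > 0" using r_gt_1[OF elim(1)] by simp
      have L: "d \<le> ?L" using elim(2) r by (simp add: ln_ge_iff)
      then have L0: "0 < ?L" using d_pos by simp
      have x: "0 < d / ?L" "d / ?L \<le> 1" using L d_pos L0 by auto
      have "1 - (\<phi> n)\<^sup>2 = d / ?L + d / ?L * (1 - d / ?L)"
        unfolding \<phi>_eq[OF elim(1)] by (simp add: power2_eq_square algebra_simps)
      moreover have "0 \<le> d / ?L * (1 - d / ?L)" using x by (intro mult_nonneg_nonneg) auto
      ultimately have "d / ?L \<le> 1 - (\<phi> n)\<^sup>2" by linarith
      then have "stat_var n \<le> \<alpha>\<^sup>2 / (d / ?L)"
        unfolding stat_var_def using x phi_sq_less_one[OF elim(1)] by (intro divide_left_mono mult_pos_pos) auto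
      then have "stat_var n \<le> q * ?L" by (simp add: q_def)
      then show ?case using r by (simp add: vol_scale_def powr_def)
    qed
    with that[of q 1] q show ?thesis by simp
  next
    assume "\<exists>R. \<forall>n\<ge>1. r n = R"
    then obtain r\<^sub>0 where R: "\<And>n. n \<ge> 1 \<Longrightarrow> r n = r\<^sub>0" by blast
    have "\<forall>\<^sub>F n in sequentially. vol_scale n \<le> vol_scale 1 * r n powr q"
      using eventually_ge_at_top[of 1]
    proof eventually_elim
      case (elim n)
      have "\<phi> n = \<phi> 1" using \<phi>_eq[OF elim] \<phi>_eq[of 1] R[OF elim] R[of 1] by simp
      then have eq: "vol_scale n = vol_scale 1" by (simp add: vol_scale_def stat_var_def)
      have "1 \<le> r n powr q" using r_gt_1[OF elim] q by (simp add: ge_one_powr_ge_zero)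
      then show ?case unfolding eq using vol_scale_ge_one[of 1] by (simp add: mult_le_cancel_left1)
    qed
    moreover have "0 < vol_scale 1" by (simp add: vol_scale_def)
    ultimately show ?thesis using that[of q "vol_scale 1"] q by blast
  qed
qed

lemma vol_scale_power_growth:
  obtains C q where "q > 0" "C > 0" "\<forall>\<^sub>F n in sequentially. vol_scale n ^ p \<le> C * r n powr q"
proof -
  obtain C q where q: "q > 0" "C > 0" and ev: "\<forall>\<^sub>F n in sequentially. vol_scale n \<le> C * r n powr q"
    by (rule vol_scale_growth)
  from ev eventually_ge_at_top[of 1]
  have "\<forall>\<^sub>F n in sequentially. vol_scale n ^ p \<le> C ^ p * r n powr (q * (real p + 1))"
  proof eventually_elim
    case (elim n)
    have r: "1 < r n" using r_gt_1[OF elim(2)] .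
    have "vol_scale n ^ p \<le> (C * r n powr q) ^ p"
      using elim by (intro power_mono) (auto simp: vol_scale_def)
    also have "\<dots> = C ^ p * r n powr (q * real p)"
      using r by (simp add: power_mult_distrib powr_powr flip: powr_realpow)
    also have "\<dots> \<le> C ^ p * r n powr (q * (real p + 1))"
      using r q by (intro mult_left_mono powr_mono) auto
    finally show ?case .
  qed
  with that[of "q * (real p + 1)" "C ^ p"] q show ?thesis by simp
qed

lemma vol_scale_power_div_k: "(\<lambda>n. vol_scale n ^ p / k n) \<longlonglongrightarrow> 0"
proof -
  obtain C q where q: "q > 0" "C > 0" and ev: "\<forall>\<^sub>F n in sequentially. vol_scale n ^ p \<le> C * r n powr q"
    by (rule vol_scale_power_growth)
  have "(\<lambda>n. r n powr q / k n) \<longlonglongrightarrow> 0" by (rule smalloD_tendsto[OF rate1[OF q(1)]])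
  from tendsto_mult_left[OF this, of C] have "(\<lambda>n. C * (r n powr q / k n)) \<longlonglongrightarrow> 0" by simp
  moreover from ev eventually_ge_at_top[of 1]
  have "\<forall>\<^sub>F n in sequentially. norm (vol_scale n ^ p / k n) \<le> C * (r n powr q / k n)"
  proof eventually_elim
    case (elim n)
    then show ?case using k_pos[of n] by (simp add: vol_scale_def divide_right_mono)
  qed
  ultimately show ?thesis by (rule Lim_null_comparison[rotated])
qed

lemma k_vol_scale_power_div_n: "(\<lambda>n. k n * vol_scale n ^ p / real n) \<longlonglongrightarrow> 0"
proof -
  obtain C q where q: "q > 0" "C > 0" and ev: "\<forall>\<^sub>F n in sequentially. vol_scale n ^ p \<le> C * r n powr q"
    by (rule vol_scale_power_growth)
  have "(\<lambda>n. k n * r n powr q / real n) \<longlonglongrightarrow> 0" by (rule smalloD_tendsto[OF rate2[OF q(1)]])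
  from tendsto_mult_left[OF this, of C] have "(\<lambda>n. C * (k n * r n powr q / real n)) \<longlonglongrightarrow> 0" by simp
  moreover from ev eventually_ge_at_top[of 1]
  have "\<forall>\<^sub>F n in sequentially. norm (k n * vol_scale n ^ p / real n) \<le> C * (k n * r n powr q / real n)"
  proof eventually_elim
    case (elim n)
    have "k n * vol_scale n ^ p \<le> k n * (C * r n powr q)"
      using elim k_pos[of n] by (intro mult_left_mono) auto
    then have "k n * vol_scale n ^ p / real n \<le> k n * (C * r n powr q) / real n" by (rule divide_right_mono) simp
    then show ?case using k_pos[of n] elim by (simp add: vol_scale_def mult_ac)
  qed
  ultimately show ?thesis by (rule Lim_null_comparison[rotated])
qed

lemma eventually_k_ge_one: "\<forall>\<^sub>F n in sequentially. 1 \<le> k n \<and> 1 \<le> n"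
  using k_tendsto eventually_ge_at_top[of 1] by (simp add: filterlim_at_top eventually_conj_iff)

text \<open>The fourth root of the case of the power \<open>16\<close>.\<close>

lemma vol_scale_power_div_root: "(\<lambda>n. vol_scale n ^ 4 / root 4 (k n)) \<longlonglongrightarrow> 0"
proof -
  have "(\<lambda>n. root 4 (vol_scale n ^ 16 / k n)) \<longlonglongrightarrow> root 4 0"
    by (rule tendsto_real_root[OF vol_scale_power_div_k])
  moreover have "root 4 (vol_scale n ^ 16 / k n) = vol_scale n ^ 4 / root 4 (k n)" for n
  proof -
    have "vol_scale n ^ 16 = (vol_scale n ^ 4) ^ 4" by (simp flip: power_mult)
    moreover have "root 4 ((vol_scale n ^ 4) ^ 4) = vol_scale n ^ 4"
      by (rule real_root_power_cancel) (auto simp: vol_scale_def)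
    ultimately have "root 4 (vol_scale n ^ 16) = vol_scale n ^ 4" by (simp only:)
    then show ?thesis by (simp add: real_root_divide)
  qed
  ultimately show ?thesis by simp
qed

lemma root_vol_scale_power_div_n: "(\<lambda>n. root 4 (k n) * vol_scale n ^ 4 / real n) \<longlonglongrightarrow> 0"
proof (rule Lim_null_comparison[OF _ k_vol_scale_power_div_n[of 4]])
  show "\<forall>\<^sub>F n in sequentially. norm (root 4 (k n) * vol_scale n ^ 4 / real n) \<le> k n * vol_scale n ^ 4 / real n"
    using eventually_k_ge_one
  proof eventually_elim
    case (elim n)
    have "root 4 (k n) ^ 1 \<le> root 4 (k n) ^ 4" using elim by (intro power_increasing) auto
    then have "root 4 (k n) \<le> k n" using elim by simp
    then show ?case using elim by (simp add: vol_scale_def divide_right_mono mult_right_mono)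
  qed
qed

lemma cond_var_error_tendsto: "cond_var_error c \<longlonglongrightarrow> 0"
proof -
  have s: "(\<lambda>n. sqrt (k n * vol_scale n ^ 4 / real n)) \<longlonglongrightarrow> sqrt 0"
    by (rule tendsto_real_sqrt[OF k_vol_scale_power_div_n])
  have "(\<lambda>n. 1 / 2 * (vol_scale n ^ 0 / k n)) \<longlonglongrightarrow> 1 / 2 * 0" by (intro tendsto_mult tendsto_const vol_scale_power_div_k)
  then have h: "(\<lambda>n. 1 / (2 * k n)) \<longlonglongrightarrow> 0" by simp
  have "(\<lambda>n. quad_const c / c * (sqrt (k n * vol_scale n ^ 4 / real n) + k n * vol_scale n ^ 4 / real n) + 1 / (2 * k n)
     + cov_const c * (vol_scale n ^ 4 / root 4 (k n) + root 4 (k n) * vol_scale n ^ 4 / real n))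
    \<longlonglongrightarrow> quad_const c / c * (sqrt 0 + 0) + 0 + cov_const c * (0 + 0)"
    by (intro tendsto_add tendsto_mult tendsto_const s h k_vol_scale_power_div_n vol_scale_power_div_root root_vol_scale_power_div_n)
  then show ?thesis unfolding cond_var_error_def[abs_def] by simp
qed

lemma norm_sum_squares_tendsto_L1:
  "(\<lambda>n. expectation (\<lambda>\<omega>. \<bar>norm_sum_squares n \<omega> - 1 / (2 * c)\<bar>)) \<longlonglongrightarrow> 0"
proof (rule Lim_null_comparison[OF _ cond_var_error_tendsto])
  show "\<forall>\<^sub>F n in sequentially. norm (expectation (\<lambda>\<omega>. \<bar>norm_sum_squares n \<omega> - 1 / (2 * c)\<bar>)) \<le> cond_var_error c n"
    using eventually_regular_row
  proof eventually_elim
    case (elim n)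
    then interpret regular_row M d \<alpha> k r \<phi> \<rho> eps eta vol u y c n .
    have "0 \<le> cov_const c * (R ^ 4 / root 4 (k n) + root 4 (k n) * R ^ 4 / real n)"
      using cov_const_nonneg R_ge_one k_ge_one by (intro mult_nonneg_nonneg add_nonneg_nonneg) auto
    then show ?case using norm_sum_squares_L1 by (simp add: cond_var_error_def)
  qed
qed

lemma norm_sum_squares_integrable: "\<forall>\<^sub>F n in sequentially. integrable M (norm_sum_squares n)"
  using eventually_regular_row by eventually_elim (rule regular_row.norm_sum_squares_integrable)

lemma norm_score_integrable: "\<forall>\<^sub>F n in sequentially. integrable M (norm_score n)"
  using eventually_regular_row by eventually_elim (rule regular_row.norm_score_integrable)

lemma norm_score_L1_bounded:
  "\<forall>\<^sub>F n in sequentially. integrable M (norm_score n) \<and> expectation (\<lambda>\<omega>. \<bar>norm_score n \<omega>\<bar>) \<le> sqrt (1 / (2 * c) + 1)"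
proof -
  have "\<forall>\<^sub>F n in sequentially. cond_var_error c n < 1"
    by (rule order_tendstoD(2)[OF cond_var_error_tendsto]) simp
  with eventually_regular_row show ?thesis
  proof eventually_elim
    case (elim n)
    have "sqrt (1 / (2 * c) + cond_var_error c n) \<le> sqrt (1 / (2 * c) + 1)" using elim by simp
    with regular_row.norm_score_L1[OF elim(1)] regular_row.norm_score_integrable[OF elim(1)]
    show ?case by linarith
  qed
qed

text \<open>The two error terms of the quantitative central limit theorem vanish; the one with third moments is
  \<open>vol_scale\<^sup>1\<^sup>8 / n\<^sup>1\<^sup>/\<^sup>2\<close>, the root of a product of the two rate conditions.\<close>

lemma norm_score_tendsto: "tendsto_in_distr M norm_score (normal_law 0 (1 / (2 * c)))"
proof (subst tendsto_in_distr_normal_iff_char[OF norm_score_measurable])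
  show "0 < 1 / (2 * c)" using c_pos by simp
  show "\<forall>s. (\<lambda>n. expectation (\<lambda>\<omega>. iexp (s * norm_score n \<omega>))) \<longlonglongrightarrow> of_real (exp (- (s\<^sup>2 * (1 / (2 * c)) / 2)))"
  proof
    fix s
    let ?K = "clt_const s (1 / (2 * c)) (1 + eps_fourth_moment)"
    have "(\<lambda>n. sqrt (vol_scale n ^ 36 / k n * (k n * vol_scale n ^ 0 / real n))) \<longlonglongrightarrow> sqrt (0 * 0)"
      by (intro tendsto_real_sqrt tendsto_mult vol_scale_power_div_k k_vol_scale_power_div_n)
    moreover have "\<forall>\<^sub>F n in sequentially. sqrt (vol_scale n ^ 36 / k n * (k n * vol_scale n ^ 0 / real n)) = vol_scale n ^ 18 / sqrt (real n)"
      using eventually_k_ge_one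
    proof eventually_elim
      case (elim n)
      have "(vol_scale n ^ 18)\<^sup>2 = vol_scale n ^ 36" by (simp flip: power_mult)
      then have "sqrt (vol_scale n ^ 36) = vol_scale n ^ 18"
        by (rule real_sqrt_unique) (simp add: vol_scale_def)
      then show ?case using elim by (simp add: real_sqrt_divide)
    qed
    ultimately have l: "(\<lambda>n. vol_scale n ^ 18 / sqrt (real n)) \<longlonglongrightarrow> 0" by (simp add: tendsto_cong)
    have "(\<lambda>n. ?K * ((fourth_const c + 1) * (vol_scale n ^ 18 / sqrt (real n)) + cond_var_error c n))
        \<longlonglongrightarrow> ?K * ((fourth_const c + 1) * 0 + 0)"
      by (intro tendsto_add tendsto_mult tendsto_const l cond_var_error_tendsto)
    then have "(\<lambda>n. ?K * ((fourth_const c + 1) * (vol_scale n ^ 18 / sqrt (real n)) + cond_var_error c n)) \<longlonglongrightarrow> 0" by simp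
    moreover have "\<forall>\<^sub>F n in sequentially.
        norm (expectation (\<lambda>\<omega>. iexp (s * norm_score n \<omega>)) - of_real (exp (- (s\<^sup>2 * (1 / (2 * c)) / 2))))
        \<le> ?K * ((fourth_const c + 1) * (vol_scale n ^ 18 / sqrt (real n)) + cond_var_error c n)"
      using eventually_regular_row
      by eventually_elim (use regular_row.norm_score_char in simp)
    ultimately have "(\<lambda>n. expectation (\<lambda>\<omega>. iexp (s * norm_score n \<omega>)) - of_real (exp (- (s\<^sup>2 * (1 / (2 * c)) / 2)))) \<longlonglongrightarrow> 0"
      by (rule Lim_null_comparison[rotated])
    then show "(\<lambda>n. expectation (\<lambda>\<omega>. iexp (s * norm_score n \<omega>))) \<longlonglongrightarrow> of_real (exp (- (s\<^sup>2 * (1 / (2 * c)) / 2)))"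
      by (rule LIM_zero_cancel)
  qed
qed

definition mean_ratio :: "nat \<Rightarrow> real" where
  "mean_ratio n = stat_mean n / mean_vol M vol n"

lemma mean_ratio_tendsto: "mean_ratio \<longlonglongrightarrow> 1"
proof -
  have "(\<lambda>n. 2 / \<alpha>\<^sup>2 * (vol_scale n ^ 3 / k n * (k n * vol_scale n ^ 0 / real n))) \<longlonglongrightarrow> 2 / \<alpha>\<^sup>2 * (0 * 0)"
    by (intro tendsto_mult tendsto_const vol_scale_power_div_k k_vol_scale_power_div_n)
  then have l: "(\<lambda>n. 2 / \<alpha>\<^sup>2 * (vol_scale n ^ 3 / k n * (k n * vol_scale n ^ 0 / real n))) \<longlonglongrightarrow> 0" by simp
  have "(\<lambda>n. mean_ratio n - 1) \<longlonglongrightarrow> 0"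
  proof (rule Lim_null_comparison[OF _ l])
    show "\<forall>\<^sub>F n in sequentially. norm (mean_ratio n - 1) \<le> 2 / \<alpha>\<^sup>2 * (vol_scale n ^ 3 / k n * (k n * vol_scale n ^ 0 / real n))"
      using eventually_k_ge_one
    proof eventually_elim
      case (elim n)
      then have n: "1 \<le> n" by simp
      let ?m = "mean_vol M vol n"
      have m: "1 \<le> ?m" "?m \<le> stat_mean n" "stat_mean n - ?m \<le> 2 / \<alpha>\<^sup>2 * vol_scale n ^ 3 / real n"
        by (rule mean_vol_ge_one[OF n] mean_vol_le[OF n] stat_mean_minus_mean_vol_le[OF n])+
      have "mean_ratio n - 1 = (stat_mean n - ?m) / ?m" using m by (simp add: mean_ratio_def diff_divide_distrib)
      also have "norm \<dots> \<le> (stat_mean n - ?m) / 1" using m by (simp add: divide_le_eq mult_le_cancel_left1)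
      finally show ?case using m(3) elim by simp
    qed
  qed
  then show ?thesis by (rule LIM_zero_cancel)
qed

lemma sum_squares_tendsto:
  "tendsto_in_prob M
     (\<lambda>n \<omega>. 1 / (real n * mean_vol M vol n * k n) * (\<Sum>t=1..n. (y n (t - 1) \<omega>)^2)) (1 / (2 * c))"
proof -
  have eq: "1 / (real n * mean_vol M vol n * k n) * (\<Sum>t=1..n. (y n (t - 1) \<omega>)^2) = mean_ratio n * norm_sum_squares n \<omega>" for n \<omega>
    by (cases "n = 0") (simp_all add: mean_ratio_def norm_sum_squares_def stat_mean_def mult_ac)
  let ?w = "1 / (2 * c)"
  have w: "0 < ?w" using c_pos by simp
  show ?thesis
    unfolding eq
  proof (rule tendsto_in_prob_of_L1)
    show "random_variable borel (\<lambda>\<omega>. mean_ratio n * norm_sum_squares n \<omega>)" for n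
      using norm_sum_squares_measurable by simp
    show "\<forall>\<^sub>F n in sequentially. integrable M (\<lambda>\<omega>. mean_ratio n * norm_sum_squares n \<omega>)"
      using norm_sum_squares_integrable by eventually_elim simp
    have "(\<lambda>n. \<bar>mean_ratio n\<bar> * expectation (\<lambda>\<omega>. \<bar>norm_sum_squares n \<omega> - ?w\<bar>) + ?w * \<bar>mean_ratio n - 1\<bar>) \<longlonglongrightarrow> \<bar>1\<bar> * 0 + ?w * \<bar>1 - 1\<bar>"
      by (intro tendsto_add tendsto_mult tendsto_const tendsto_rabs tendsto_diff mean_ratio_tendsto norm_sum_squares_tendsto_L1)
    then have "(\<lambda>n. \<bar>mean_ratio n\<bar> * expectation (\<lambda>\<omega>. \<bar>norm_sum_squares n \<omega> - ?w\<bar>) + ?w * \<bar>mean_ratio n - 1\<bar>) \<longlonglongrightarrow> 0" by simp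
    moreover have "\<forall>\<^sub>F n in sequentially. norm (expectation (\<lambda>\<omega>. \<bar>mean_ratio n * norm_sum_squares n \<omega> - ?w\<bar>))
        \<le> \<bar>mean_ratio n\<bar> * expectation (\<lambda>\<omega>. \<bar>norm_sum_squares n \<omega> - ?w\<bar>) + ?w * \<bar>mean_ratio n - 1\<bar>"
      using norm_sum_squares_integrable
    proof eventually_elim
      case (elim n)
      have "expectation (\<lambda>\<omega>. \<bar>mean_ratio n * norm_sum_squares n \<omega> - ?w\<bar>)
          \<le> expectation (\<lambda>\<omega>. \<bar>mean_ratio n\<bar> * \<bar>norm_sum_squares n \<omega> - ?w\<bar> + ?w * \<bar>mean_ratio n - 1\<bar>)"
      proof (rule integral_mono)
        fix \<omega>
        have "mean_ratio n * norm_sum_squares n \<omega> - ?w = mean_ratio n * (norm_sum_squares n \<omega> - ?w) + ?w * (mean_ratio n - 1)"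
          by (simp add: right_diff_distrib)
        then show "\<bar>mean_ratio n * norm_sum_squares n \<omega> - ?w\<bar> \<le> \<bar>mean_ratio n\<bar> * \<bar>norm_sum_squares n \<omega> - ?w\<bar> + ?w * \<bar>mean_ratio n - 1\<bar>"
          using abs_triangle_ineq[of "mean_ratio n * (norm_sum_squares n \<omega> - ?w)" "?w * (mean_ratio n - 1)"] w
          by (simp only: abs_mult abs_of_pos)
      qed (use elim in auto)
      also have "\<dots> = \<bar>mean_ratio n\<bar> * expectation (\<lambda>\<omega>. \<bar>norm_sum_squares n \<omega> - ?w\<bar>) + ?w * \<bar>mean_ratio n - 1\<bar>"
        using elim by (subst Bochner_Integration.integral_add) (auto simp: prob_space)
      finally show ?case by simp
    qed
    ultimately show "(\<lambda>n. expectation (\<lambda>\<omega>. \<bar>mean_ratio n * norm_sum_squares n \<omega> - ?w\<bar>)) \<longlonglongrightarrow> 0"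
      by (rule Lim_null_comparison[rotated])
  qed
qed

lemma u_measurable:
  assumes "1 \<le> t" "t \<le> n"
  shows "random_variable borel (u n t)"
proof -
  have "random_variable borel (\<lambda>\<omega>. vol n t \<omega> * eps t \<omega>)"
    using past_measurable[OF _ vol_past, of n t] eps_measurable[OF assms(1)] assms by simp
  then show ?thesis using u_eq[OF assms] by (subst measurable_cong) auto
qed

lemma score_tendsto:
  "tendsto_in_distr M
     (\<lambda>n \<omega>. 1 / (sqrt (real n * k n) * mean_vol M vol n) * (\<Sum>t=1..n. y n (t - 1) \<omega> * u n t \<omega>))
     (normal_law 0 (1 / (2 * c)))"
proof (rule tendsto_in_distr_normal_perturb[OF norm_score_tendsto _ norm_score_measurable])
  let ?Z = "\<lambda>n \<omega>. 1 / (sqrt (real n * k n) * mean_vol M vol n) * (\<Sum>t=1..n. y n (t - 1) \<omega> * u n t \<omega>)"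
  show "0 < 1 / (2 * c)" using c_pos by simp
  show meas: "random_variable borel (?Z n)" for n
  proof (cases "1 \<le> n")
    case True
    then show ?thesis
      using past_measurable[OF True y_past[OF True]] u_measurable
      by (intro borel_measurable_times borel_measurable_const borel_measurable_sum) auto
  qed simp
  have eq: "?Z n \<omega> - norm_score n \<omega> = (mean_ratio n - 1) * norm_score n \<omega>" if "\<omega> \<in> space M" for n \<omega>
  proof -
    have "(\<Sum>t=1..n. y n (t - 1) \<omega> * u n t \<omega>) = (\<Sum>t=1..n. y n (t - 1) \<omega> * vol n t \<omega> * eps t \<omega>)"
      using u_eq that by (intro sum.cong) auto
    then have "?Z n \<omega> = mean_ratio n * norm_score n \<omega>"
      by (cases "n = 0") (simp_all add: mean_ratio_def norm_score_def stat_mean_def mult_ac)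
    then show ?thesis by (simp add: left_diff_distrib)
  qed
  show "tendsto_in_prob M (\<lambda>n \<omega>. ?Z n \<omega> - norm_score n \<omega>) 0"
  proof (rule tendsto_in_prob_of_L1)
    show "random_variable borel (\<lambda>\<omega>. ?Z n \<omega> - norm_score n \<omega>)" for n
      using meas norm_score_measurable by (rule borel_measurable_diff)
    have cong: "integrable M (\<lambda>\<omega>. ?Z n \<omega> - norm_score n \<omega>) = integrable M (\<lambda>\<omega>. (mean_ratio n - 1) * norm_score n \<omega>)"
      "expectation (\<lambda>\<omega>. \<bar>?Z n \<omega> - norm_score n \<omega> - 0\<bar>) = expectation (\<lambda>\<omega>. \<bar>(mean_ratio n - 1) * norm_score n \<omega>\<bar>)" for n
      by (rule Bochner_Integration.integrable_cong[OF refl], rule eq, assumption)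
        (rule Bochner_Integration.integral_cong[OF refl], simp only: eq diff_zero)
    show "\<forall>\<^sub>F n in sequentially. integrable M (\<lambda>\<omega>. ?Z n \<omega> - norm_score n \<omega>)"
      unfolding cong using norm_score_integrable by eventually_elim simp
    have "(\<lambda>n. \<bar>mean_ratio n - 1\<bar> * sqrt (1 / (2 * c) + 1)) \<longlonglongrightarrow> \<bar>1 - 1\<bar> * sqrt (1 / (2 * c) + 1)"
      by (intro tendsto_mult tendsto_const tendsto_rabs tendsto_diff mean_ratio_tendsto)
    then have "(\<lambda>n. \<bar>mean_ratio n - 1\<bar> * sqrt (1 / (2 * c) + 1)) \<longlonglongrightarrow> 0" by simp
    moreover have "\<forall>\<^sub>F n in sequentially. norm (expectation (\<lambda>\<omega>. \<bar>(mean_ratio n - 1) * norm_score n \<omega>\<bar>))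
        \<le> \<bar>mean_ratio n - 1\<bar> * sqrt (1 / (2 * c) + 1)"
      using norm_score_L1_bounded by eventually_elim (simp add: abs_mult mult_left_mono)
    ultimately show "(\<lambda>n. expectation (\<lambda>\<omega>. \<bar>?Z n \<omega> - norm_score n \<omega> - 0\<bar>)) \<longlonglongrightarrow> 0"
      unfolding cong by (rule Lim_null_comparison[rotated])
  qed
qed

text \<open>The quotient \<open>norm_score / norm_sum_squares\<close> is compared with \<open>2 c * norm_score\<close>.  Where the denominator is within
  half of its limit \<open>1 / (2 c)\<close>, the difference is at most a tight factor times the deviation of the denominator.\<close>

lemma lse_tendsto:
  "tendsto_in_distr M (\<lambda>n \<omega>. sqrt (real n * k n) * (lse y n \<omega> - \<rho> n)) (normal_law 0 (2 * c))"
proof -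
  let ?w = "1 / (2 * c)" and ?X = "\<lambda>n \<omega>. 2 * c * norm_score n \<omega>" and ?E = "\<lambda>n \<omega>. sqrt (real n * k n) * (lse y n \<omega> - \<rho> n)"
  let ?V = "\<lambda>n \<omega>. norm_sum_squares n \<omega> - ?w"
  note [measurable] = norm_score_measurable norm_sum_squares_measurable
  have lim: "tendsto_in_distr M ?X (normal_law 0 (2 * c))"
    using tendsto_in_distr_normal_scale[OF norm_score_tendsto _ _ norm_score_measurable, of "2 * c"] c_pos
    by (simp add: power2_eq_square)
  have V: "tendsto_in_prob M ?V 0"
    using norm_sum_squares_tendsto_L1 norm_sum_squares_integrable
    by (intro tendsto_in_prob_of_L1) (auto elim: eventually_mono)
  have ZV: "tendsto_in_prob M (\<lambda>n \<omega>. (8 * c\<^sup>2 * norm_score n \<omega>) * ?V n \<omega>) 0"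
  proof (rule tendsto_in_prob_0_mult_bounded[OF V])
    show "\<forall>\<^sub>F n in sequentially. integrable M (\<lambda>\<omega>. 8 * c\<^sup>2 * norm_score n \<omega>)
        \<and> expectation (\<lambda>\<omega>. \<bar>8 * c\<^sup>2 * norm_score n \<omega>\<bar>) \<le> 8 * c\<^sup>2 * sqrt (1 / (2 * c) + 1)"
      using norm_score_L1_bounded by eventually_elim (simp add: abs_mult mult_left_mono)
  qed (use c_pos in auto)
  have "tendsto_in_prob M (\<lambda>n \<omega>. ?E n \<omega> - ?X n \<omega>) 0"
  proof (rule tendsto_in_prob_0_of_dominated[OF V ZV, of "?w / 2"])
    show "\<forall>\<^sub>F n in sequentially. \<forall>\<omega>\<in>space M. \<bar>?V n \<omega>\<bar> \<le> ?w / 2 \<longrightarrow>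
        \<bar>?E n \<omega> - ?X n \<omega>\<bar> \<le> \<bar>8 * c\<^sup>2 * norm_score n \<omega> * ?V n \<omega>\<bar>"
      using eventually_regular_row
    proof eventually_elim
      case (elim n)
      show ?case
      proof (intro ballI impI)
        fix \<omega> assume w: "\<omega> \<in> space M" and near: "\<bar>?V n \<omega>\<bar> \<le> ?w / 2"
        define q where "q = norm_sum_squares n \<omega>"
        have w0: "0 < ?w" using c_pos by simp
        have q: "?w / 2 \<le> q" using near by (simp only: q_def abs_le_iff) linarith
        with half_gt_zero[OF w0] have q0: "0 < q" by (rule less_le_trans)
        have "?E n \<omega> - ?X n \<omega> = norm_score n \<omega> / q - 2 * c * norm_score n \<omega>"
          using regular_row.normalised_estimation_error[OF elim w] q0 by (simp add: q_def)
        also have "\<dots> = norm_score n \<omega> * (2 * c * (?w - q)) / q"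
          using q0 c_pos by (simp add: field_simps)
        also have "\<bar>\<dots>\<bar> = \<bar>norm_score n \<omega>\<bar> * (2 * c * \<bar>q - ?w\<bar>) / q"
          using q0 c_pos by (simp add: abs_mult abs_minus_commute)
        also have "\<dots> \<le> \<bar>norm_score n \<omega>\<bar> * (2 * c * \<bar>q - ?w\<bar>) / (?w / 2)"
        proof (rule divide_left_mono[OF q])
          show "0 < q * (?w / 2)" by (rule mult_pos_pos[OF q0 half_gt_zero[OF w0]])
        qed (use c_pos in simp)
        also have "\<dots> = \<bar>8 * c\<^sup>2 * norm_score n \<omega> * ?V n \<omega>\<bar>"
          using c_pos by (simp add: q_def abs_mult power2_eq_square)
        finally show "\<bar>?E n \<omega> - ?X n \<omega>\<bar> \<le> \<bar>8 * c\<^sup>2 * norm_score n \<omega> * ?V n \<omega>\<bar>" .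
      qed
    qed
  qed (use c_pos in auto)
  moreover have "random_variable borel (?E n)" for n
  proof (cases "1 \<le> n")
    case True
    note m = past_measurable[OF True y_past[OF True]]
    have "random_variable borel (lse y n)"
      unfolding lse_def[abs_def] using m
      by (intro borel_measurable_divide borel_measurable_sum borel_measurable_times borel_measurable_power) auto
    then show ?thesis by simp
  qed (simp add: lse_def)
  ultimately show ?thesis
    using c_pos by (intro tendsto_in_distr_normal_perturb[OF lim]) auto
qed

end

theorem theorem3p5:
  fixes M :: "'a measure"
    and c d \<alpha> :: real
    and k r \<phi> \<rho> :: "nat \<Rightarrow> real"
    and eps eta :: "nat \<Rightarrow> 'a \<Rightarrow> real"
    and vol u y :: "nat \<Rightarrow> nat \<Rightarrow> 'a \<Rightarrow> real"
  assumes model: "ar_stochastic_volatility M d \<alpha> k r \<phi> \<rho> eps eta vol u y"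
    and c_pos: "c > 0"
    and nearly_stationary: "\<And>n. n \<ge> 1 \<Longrightarrow> \<rho> n = 1 - c / k n"
    and rate1: "\<And>q::real. q > 0 \<Longrightarrow> (\<lambda>n. r n powr q) \<in> o(k)"
    and rate2: "\<And>q::real. q > 0 \<Longrightarrow> (\<lambda>n. k n * r n powr q) \<in> o(\<lambda>n. real n)"
    and y0_integrable: "\<forall>\<^sub>F n in sequentially. integrable M (\<lambda>\<omega>. (y n 0 \<omega>)^4)"
    and y0_small: "(\<lambda>n. \<integral>\<omega>. (y n 0 \<omega>)^4 \<partial>M) \<in> o(\<lambda>n. (k n)^2)"
  shows "tendsto_in_prob M
           (\<lambda>n \<omega>. 1 / (real n * mean_vol M vol n * k n) * (\<Sum>t=1..n. (y n (t - 1) \<omega>)^2))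
           (1 / (2 * c))
       \<and> tendsto_in_distr M
           (\<lambda>n \<omega>. 1 / (sqrt (real n * k n) * mean_vol M vol n)
                    * (\<Sum>t=1..n. y n (t - 1) \<omega> * u n t \<omega>))
           (normal_law 0 (1 / (2 * c)))
       \<and> tendsto_in_distr M
           (\<lambda>n \<omega>. sqrt (real n * k n) * (lse y n \<omega> - \<rho> n))
           (normal_law 0 (2 * c))"
proof -
  interpret ar_stochastic_volatility M d \<alpha> k r \<phi> \<rho> eps eta vol u y by (rule model)
  interpret nearly_stationary_sv M d \<alpha> k r \<phi> \<rho> eps eta vol u y c
    by unfold_locales (fact c_pos, erule nearly_stationary, erule rate1, erule rate2, fact y0_integrable, fact y0_small)
  show ?thesis using sum_squares_tendsto score_tendsto lse_tendsto by blast
qed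

end
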